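(* Let $D=S\cap K$, where $S\subseteq\mathbb{R}^n$ is open and $K\subseteq\mathbb{R}^n$ is closed, and let $F:\overline{D}\rightrightarrows\mathbb{R}^n$ be a uniformly bounded multi-valued mapping with nonempty values. Let $\varepsilon>0$, let $\mathcal{U}$ be a $\sigma$-relatively open partition of $D$ and let $(\mathcal{U},\mathcal{G})$ be an invariant partial $\varepsilon$-approximation of $F$. Let $w:D\to\mathbb{R}$ be a quasi-Lyapunov function for $(\mathcal{U},\mathcal{G})$. Then for each point $x_0\in\overline{\bigcup(\mathbf{Green}\,\mathcal{U})}\cap D$ there exists an $\varepsilon$-solution $\varphi(\cdot)$ of $\dot{x}\in F(x)$ starting from $x_0$ and defined on an interval $[0,T)$, where either $T=+\infty$ or $\varphi(t)$ tends to a point in $\mathbb{R}^n\setminus S$ as $t\to T$, such that $w(\varphi(t))\ge w(x_0)+t$ for all $t\in[0,T)$. Moreover, if the starting point $x_0$ belongs to $\bigcup(\mathbf{Green}\,\mathcal{U})$, then each element of $\mathbf{Green}\,\mathcal{U}$ is forward invariant with respect to the corresponding $\varepsilon$-solution $\varphi(\cdot)$ starting from $x_0$.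
   Context: Notation. $\overline{\mathbf{B}}$ is the closed unit ball of $\mathbb{R}^n$. A multi-valued mapping $F:\overline{D}\rightrightarrows\mathbb{R}^n$ is uniformly bounded if there is $c>0$ with $\|v\|\le c$ for all $x\in\overline{D}$, $v\in F(x)$. A set is locally closed if it is the intersection of an open set and a closed set. For a family of sets $\mathcal{A}$, $\bigcup\mathcal{A}$ denotes the union of its members. $\varepsilon$-solution. An $\varepsilon$-solution of $\dot x\in F(x)$ starting from $x_0$, defined on an interval $I$ ($I=[0,T)$ or $[0,T]$, $T>0$), is a function $\varphi:I\to D$, absolutely continuous on compact subintervals of $I$, with $\varphi(0)=x_0$ and $\dot\varphi(t)\in F(\varphi(t))+\varepsilon\overline{\mathbf{B}}$ for almost every $t\in I$. Forward invariance. A set $A\subseteq\mathbb{R}^n$ is forward invariant with respect to an absolutely continuous function $\varphi:[0,T)\to\mathbb{R}^n$ if for each $t\in[0,T)$ with $\varphi(t)\in A$ there exists $\delta>0$ such that $\varphi(\tau)\in A$ for all $\tau\in[t,t+\delta)$. Bouligand tangent cone. For $A\subseteq\mathbb{R}^n$ and $x\in A$, $T^B_A(x)=\{\lim_{n\to\infty}\frac{x_n-x}{t_n}: \{x_n\}\subseteq A,\ x_n\to x,\ t_n\searrow 0\}$. Relatively open partition. A well-ordered family $\mathcal{U}=\{U_\alpha:1\le\alpha<\alpha_0\}$ of subsets of a topological space $X$ is a relatively open partition of $X$ if (i) for every $\alpha$, $U_\alpha$ is contained in $X\setminus\bigcup_{\beta<\alpha}U_\beta$ and is relatively open in it; (ii)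 $X=\bigcup_{1\le\alpha<\alpha_0}U_\alpha$. Refinement of partitions. For relatively open partitions $\mathcal{U}^1,\mathcal{U}^2$ of $X$, $\mathcal{U}^2$ is a refinement of $\mathcal{U}^1$ (written $\mathcal{U}^2\prec\mathcal{U}^1$) if (i) for each $U^2\in\mathcal{U}^2$ there is $U^1\in\mathcal{U}^1$ with $U^2\subseteq U^1$; (ii) if $\mathcal{U}^2\ni U^2_{\beta_i}\subseteq U^1_{\alpha_i}\in\mathcal{U}^1$, $i=1,2$, with $\alpha_1<\alpha_2$, then $\beta_1<\beta_2$. Invariant partial $\varepsilon$-approximation. Let $D\subseteq\mathbb{R}^n$ be locally closed, $F:\overline{D}\rightrightarrows\mathbb{R}^n$ have nonempty values and $\varepsilon>0$. A $\sigma$-relatively open partition of $D$ is a family $\mathcal{U}=\bigcup_{m=1}^\infty\mathcal{U}^m$ where each $\mathcal{U}^m$ is a relatively open partition of $D$. Let $\mathcal{U}$ be such a family with $\mathcal{U}^{m+1}\prec\mathcal{U}^m$ for all $m\in\mathbb{N}$, let $\mathbf{Green}\,\mathcal{U}$ be a (specified) disjoint subfamily of $\mathcal{U}$, and let $\mathcal{G}=\{G_U:U\in\mathbf{Green}\,\mathcal{U}\}$ be a family of multi-valued mappings. Then $(\mathcal{U},\mathcal{G})$ is an invariant partial $\varepsilon$-approximation of $F$ if: (i) if $U\in(\mathbf{Green}\,\mathcal{U})\cap\mathcal{U}^m$ then $U\in\mathcal{U}^k$ for all $k\ge m$; (ii) each $x\in\bigcup(\mathbf{Green}\,\mathcal{U})$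 has a neighborhood which intersects at most finitely many elements of $\mathbf{Green}\,\mathcal{U}$; (iii) $\bigcup(\mathbf{Green}\,\mathcal{U})$ is open in $D$; (iv) (a) for each $U\in\mathbf{Green}\,\mathcal{U}$, $G_U:\overline{U}\rightrightarrows\mathbb{R}^n$ is upper semi-continuous with nonempty convex compact values; (b) for each $U\in\mathbf{Green}\,\mathcal{U}$ and $x\in\overline{U}$, $G_U(x)\cap T^B_{\overline{U}}(x)\subseteq F(x)+\varepsilon\overline{\mathbf{B}}$; (c) for each $U\in\mathbf{Green}\,\mathcal{U}$ and $x\in U$, $G_U(x)\cap T^B_U(x)\neq\emptyset$. Quasi-Lyapunov function. Let $(\mathcal{U},\mathcal{G})$ be an invariant partial $\varepsilon$-approximation of $F$. A function $w:D\to\mathbb{R}$ is a quasi-Lyapunov function for $(\mathcal{U},\mathcal{G})$ if: (i) $w(x)\ge 0$ for all $x\in D$, and $w(x)=0$ iff $x\notin\bigcup(\mathbf{Green}\,\mathcal{U})$; (ii) $w$ is continuous; (iii) for all $U\in\mathbf{Green}\,\mathcal{U}$ the restriction $w\!\restriction_U$ is smooth, i.e. it is the restriction to $U$ of a smooth function defined on an open set containing $U$ (and $\mathbf{grad}\,w(x)$ for $x\in U$ denotes the gradient of this smooth function at $x$); (iv) for each $U\in\mathbf{Green}\,\mathcal{U}$ and each $x\in U$, $\max_{y\in G_U(x)\cap T^B_U(x)}\langle\mathbf{grad}\,w(x),y\rangle\ge 1$. *)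

theory Defs
  imports "HOL-Analysis.Analysis"
begin

section \<open>Multi-valued mappings and tangent cones\<close>

text \<open>A multi-valued mapping is a set-valued function; its domain is given separately,
  and values outside that domain are irrelevant.\<close>

definition uniformly_bounded_on ::
    "'a set \<Rightarrow> ('a \<Rightarrow> 'b::real_normed_vector set) \<Rightarrow> bool" where
  "uniformly_bounded_on A F \<longleftrightarrow> (\<exists>c>0. \<forall>x\<in>A. \<forall>v\<in>F x. norm v \<le> c)"

definition usc_on ::
    "'a::topological_space set \<Rightarrow> ('a \<Rightarrow> 'b::topological_space set) \<Rightarrow> bool" where
  "usc_on A F \<longleftrightarrow>
    (\<forall>x\<in>A. \<forall>V. open V \<and> F x \<subseteq> V \<longrightarrow>
      (\<exists>N. open N \<and> x \<in> N \<and> (\<forall>y\<in>A \<inter> N. F y \<subseteq> V)))"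

definition locally_closed_set :: "'a::topological_space set \<Rightarrow> bool" where
  "locally_closed_set D \<longleftrightarrow> (\<exists>S K. open S \<and> closed K \<and> D = S \<inter> K)"

definition bouligand_cone :: "'a::real_normed_vector set \<Rightarrow> 'a \<Rightarrow> 'a set" where
  "bouligand_cone A x =
    {v. \<exists>(X :: nat \<Rightarrow> 'a) (t :: nat \<Rightarrow> real).
        (\<forall>n. X n \<in> A) \<and> X \<longlonglongrightarrow> x \<and>
        (\<forall>n. 0 < t n) \<and> decseq t \<and> t \<longlonglongrightarrow> 0 \<and>
        (\<lambda>n. (X n - x) /\<^sub>R t n) \<longlonglongrightarrow> v}"


section \<open>Approximate solutions and forward invariance\<close>

text \<open>The usual epsilon-delta condition over finite families of non-overlapping compact
  subintervals; \<open>Inf J\<close> and \<open>Sup J\<close> are the end points of the interval \<open>J\<close>.\<close>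

definition abs_cont_on :: "real \<Rightarrow> real \<Rightarrow> (real \<Rightarrow> 'a::real_normed_vector) \<Rightarrow> bool" where
  "abs_cont_on a b f \<longleftrightarrow>
    (\<forall>e>0. \<exists>d>0. \<forall>\<D>.
      \<D> division_of \<Union>\<D> \<and> \<Union>\<D> \<subseteq> {a..b} \<and> (\<Sum>J\<in>\<D>. Sup J - Inf J) < d \<longrightarrow>
      (\<Sum>J\<in>\<D>. norm (f (Sup J) - f (Inf J))) < e)"

definition co_interval :: "ereal \<Rightarrow> real set" where
  "co_interval T = {t. 0 \<le> t \<and> ereal t < T}"

definition cc_interval :: "ereal \<Rightarrow> real set" where
  "cc_interval T = {t. 0 \<le> t \<and> ereal t \<le> T}"

definition eps_solution ::
    "'a::euclidean_space set \<Rightarrow> ('a \<Rightarrow> 'a set) \<Rightarrow> real \<Rightarrow> 'a \<Rightarrow> real set \<Rightarrow> (real \<Rightarrow> 'a) \<Rightarrow> bool"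
  where
  "eps_solution D F \<epsilon> x0 I \<phi> \<longleftrightarrow>
    (\<exists>T>0. I = co_interval T \<or> I = cc_interval T) \<and>
    \<phi> ` I \<subseteq> D \<and>
    (\<forall>a b. a \<le> b \<and> {a..b} \<subseteq> I \<longrightarrow> abs_cont_on a b \<phi>) \<and>
    \<phi> 0 = x0 \<and>
    (AE t in lebesgue. t \<in> I \<longrightarrow>
      (\<exists>v. (\<phi> has_vector_derivative v) (at t within I) \<and> v \<in> F (\<phi> t) + cball 0 \<epsilon>))"

text \<open>Functions are total in HOL, so that \<open>[t, t + \<delta>)\<close> lies in the domain \<open>[0, T)\<close> of \<open>\<phi>\<close>
  has to be said explicitly.\<close>

definition forward_invariant :: "'a set \<Rightarrow> ereal \<Rightarrow> (real \<Rightarrow> 'a) \<Rightarrow> bool" where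
  "forward_invariant A T \<phi> \<longleftrightarrow>
    (\<forall>t\<in>co_interval T. \<phi> t \<in> A \<longrightarrow>
      (\<exists>\<delta>>0. {t..<t + \<delta>} \<subseteq> co_interval T \<and> (\<forall>\<tau>\<in>{t..<t + \<delta>}. \<phi> \<tau> \<in> A)))"


section \<open>Relatively open partitions\<close>

text \<open>A well-ordered family \<open>{U \<alpha> : \<alpha> < \<alpha>0}\<close> is the pair \<open>(\<alpha>0, U)\<close>; the ordinals are the
  elements of an arbitrary well-ordered type, whose least element plays the role of the
  first index. As usual for indexed families, members may be empty, and only empty members
  can be repeated in a partition.\<close>

type_synonym ('i, 'a) wo_family = "'i \<times> ('i \<Rightarrow> 'a set)"

definition members :: "('i::wellorder, 'a) wo_family \<Rightarrow> 'a set set" where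
  "members P = snd P ` {..<fst P}"

definition relatively_open_partition ::
    "'a topology \<Rightarrow> ('i::wellorder, 'a) wo_family \<Rightarrow> bool" where
  "relatively_open_partition X P \<longleftrightarrow>
    (case P of (\<alpha>0, U) \<Rightarrow>
      (\<forall>\<alpha><\<alpha>0.
        U \<alpha> \<subseteq> topspace X - (\<Union>\<beta>\<in>{..<\<alpha>}. U \<beta>) \<and>
        openin (subtopology X (topspace X - (\<Union>\<beta>\<in>{..<\<alpha>}. U \<beta>))) (U \<alpha>)) \<and>
      topspace X = (\<Union>\<alpha>\<in>{..<\<alpha>0}. U \<alpha>))"

text \<open>\<open>refinement Q P\<close> is \<open>Q \<prec> P\<close>: the family \<open>Q\<close> refines the family \<open>P\<close>.\<close>

definition refinement ::
    "('i::wellorder, 'a) wo_family \<Rightarrow> ('i, 'a) wo_family \<Rightarrow> bool" where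
  "refinement Q P \<longleftrightarrow>
    (case (Q, P) of ((\<beta>0, V), (\<alpha>0, U)) \<Rightarrow>
      (\<forall>\<beta><\<beta>0. \<exists>\<alpha><\<alpha>0. V \<beta> \<subseteq> U \<alpha>) \<and>
      (\<forall>\<beta>1<\<beta>0. \<forall>\<beta>2<\<beta>0. \<forall>\<alpha>1<\<alpha>0. \<forall>\<alpha>2<\<alpha>0.
        V \<beta>1 \<subseteq> U \<alpha>1 \<and> V \<beta>2 \<subseteq> U \<alpha>2 \<and> \<alpha>1 < \<alpha>2 \<longrightarrow> \<beta>1 < \<beta>2))"

text \<open>A sigma-relatively open partition is given by its sequence of relatively open
  partitions, numbered from 0 instead of 1; the family itself is the union of their members.\<close>

definition sigma_relatively_open_partition ::
    "'a::topological_space set \<Rightarrow> (nat \<Rightarrow> ('i::wellorder, 'a) wo_family) \<Rightarrow> bool" where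
  "sigma_relatively_open_partition D \<U> \<longleftrightarrow>
    (\<forall>m. relatively_open_partition (top_of_set D) (\<U> m))"


section \<open>Invariant partial approximations\<close>

definition invariant_partial_approx ::
    "'a::euclidean_space set \<Rightarrow> ('a \<Rightarrow> 'a set) \<Rightarrow> real \<Rightarrow>
     (nat \<Rightarrow> ('i::wellorder, 'a) wo_family) \<Rightarrow> 'a set set \<Rightarrow> ('a set \<Rightarrow> 'a \<Rightarrow> 'a set) \<Rightarrow> bool"
  where
  "invariant_partial_approx D F \<epsilon> \<U> Green G \<longleftrightarrow>
    locally_closed_set D \<and> (\<forall>x\<in>closure D. F x \<noteq> {}) \<and> 0 < \<epsilon> \<and>
    sigma_relatively_open_partition D \<U> \<and> (\<forall>m. refinement (\<U> (Suc m)) (\<U> m)) \<and>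
    Green \<subseteq> (\<Union>m. members (\<U> m)) \<and> disjoint Green \<and>
    (\<forall>m. \<forall>U\<in>Green \<inter> members (\<U> m). \<forall>k\<ge>m. U \<in> members (\<U> k)) \<and>
    (\<forall>x\<in>\<Union>Green. \<exists>N. open N \<and> x \<in> N \<and> finite {U\<in>Green. U \<inter> N \<noteq> {}}) \<and>
    openin (top_of_set D) (\<Union>Green) \<and>
    (\<forall>U\<in>Green.
      usc_on (closure U) (G U) \<and>
      (\<forall>x\<in>closure U. G U x \<noteq> {} \<and> convex (G U x) \<and> compact (G U x)) \<and>
      (\<forall>x\<in>closure U. G U x \<inter> bouligand_cone (closure U) x \<subseteq> F x + cball 0 \<epsilon>) \<and>
      (\<forall>x\<in>U. G U x \<inter> bouligand_cone U x \<noteq> {}))"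


section \<open>Quasi-Lyapunov functions\<close>

text \<open>\<open>higher_differentiable_on S f k\<close> means that \<open>f\<close> is of class \<open>C\<^sup>k\<close> on the open set \<open>S\<close>.\<close>

primrec higher_differentiable_on ::
    "'a::real_normed_vector set \<Rightarrow> ('a \<Rightarrow> 'b::real_normed_vector) \<Rightarrow> nat \<Rightarrow> bool" where
  "higher_differentiable_on S f 0 \<longleftrightarrow> continuous_on S f"
| "higher_differentiable_on S f (Suc k) \<longleftrightarrow>
    (\<forall>x\<in>S. f differentiable (at x)) \<and>
    (\<forall>v. higher_differentiable_on S (\<lambda>x. frechet_derivative f (at x) v) k)"

definition smooth_on ::
    "'a::real_normed_vector set \<Rightarrow> ('a \<Rightarrow> 'b::real_normed_vector) \<Rightarrow> bool" where
  "smooth_on S f \<longleftrightarrow> (\<forall>k. higher_differentiable_on S f k)"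

text \<open>The last two requirements on \<open>w\<close> (smoothness on \<open>U\<close>, and the maximum condition) share
  the smooth extension \<open>f\<close>, whose gradient on \<open>U\<close> is \<open>g\<close>. The choice of \<open>f\<close> is immaterial:
  for \<open>y\<close> in the Bouligand cone of \<open>U\<close> at \<open>x\<close>, the number \<open>inner (g x) y\<close> is determined by
  the values of \<open>f\<close> on \<open>U\<close>, where \<open>f = w\<close>.\<close>

definition quasi_lyapunov ::
    "'a::euclidean_space set \<Rightarrow> 'a set set \<Rightarrow> ('a set \<Rightarrow> 'a \<Rightarrow> 'a set) \<Rightarrow> ('a \<Rightarrow> real) \<Rightarrow> bool"
  where
  "quasi_lyapunov D Green G w \<longleftrightarrow>
    (\<forall>x\<in>D. 0 \<le> w x \<and> (w x = 0 \<longleftrightarrow> x \<notin> \<Union>Green)) \<and>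
    continuous_on D w \<and>
    (\<forall>U\<in>Green. \<exists>W f g.
      open W \<and> U \<subseteq> W \<and> smooth_on W f \<and> (\<forall>x\<in>U. f x = w x) \<and>
      (\<forall>x\<in>U. GDERIV f x :> g x) \<and>
      (\<forall>x\<in>U. \<exists>y. is_arg_max (\<lambda>z. inner (g x) z) (\<lambda>z. z \<in> G U x \<inter> bouligand_cone U x) y \<and>
                 1 \<le> inner (g x) y))"

end

(*
  On a single green set U the relation x' : G_U(x), <grad w(x), x'> >= 1 has locally viable solutions
  (polygonal approximation and compactness), and w grows along them at rate at least 1. Starting from
  a green point, such local solutions are continued greedily. If the path stops at a finite time, then
  its end point p is not green; since w has grown, w(p) > 0 would hold if p were in D, so p is outside S.
  If x0 is only a limit of green points, take a limit of the solutions starting at these points. For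
  t > 0 the limit is again green, hence near t only finitely many green sets matter, and they all
  belong to one partition of the sequence. The indices of the sets visited by the approximating
  solutions are nondecreasing in time, so for almost every t infinitely many of these solutions stay in
  one and the same set U near t, and the limit inherits the inclusion with G_U on the closure of U.

  Until the very end all differential inclusions are conditions on right difference quotients at every
  time; they pass to limits by a mean value theorem for closed convex sets.
*)
theory Submission
  imports Defs "HOL-Complex_Analysis.Great_Picard"
begin

section \<open>Differentiability of Lipschitz functions\<close>


text \<open>The values of \<open>G U\<close> carry no common bound; their intersections with the
  tangent cones do, because they lie in F + \<epsilon>B. Velocities are therefore cut to the ball of
  radius \<open>max_speed\<close>, which serves all green sets at once. A polygon may miss such a
  velocity by at most 1, whence the Lipschitz constant \<open>max_speed + 1\<close>. One Lipschitz
  constant for all paths gives compactness, an end point at each finite time, and differentiability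
  almost everywhere; the last turns quotients back into derivatives.

  Conditions on right germs at every time are blind to the past: concatenation preserves them even
  at the joint, and a Dini argument integrates them without derivatives.

  Velocities are picked in the tangent cone of U, but a limit path stays only in the closure of U
  and its derivative is tangent to the closure. It is the inclusion for the cone of the closure that
  leads back to F.

  Growth of \<open>w\<close> survives the limit in the integrated form
  \<open>w (\<phi> t) \<ge> t\<close>, and the missing information at time 0 costs one null
  point.\<close>

lemma emeasure_interval_measure_le_lborel:
  fixes f :: "real \<Rightarrow> real"
  assumes mono: "mono f" and mono': "mono (\<lambda>x. x - f x)" and A: "A \<in> sets borel"
  shows "emeasure (interval_measure f) A \<le> emeasure lborel A"
proof -
  let ?\<mu> = "interval_measure f" and ?\<nu> = "interval_measure (\<lambda>x. x - f x)"
  have lip: "\<bar>f x - f y\<bar> \<le> \<bar>x - y\<bar>" for x y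
    using monoD[OF mono, of x y] monoD[OF mono', of x y] monoD[OF mono, of y x] monoD[OF mono', of y x]
    by (cases "x \<le> y") auto
  have "1-lipschitz_on UNIV f"
    by (rule lipschitz_onI) (use lip in \<open>auto simp: dist_real_def\<close>)
  then have cont: "continuous_on UNIV f"
    by (rule lipschitz_on_continuous_on)
  \<comment> \<open>the interval measures of \<open>f\<close> and \<open>x - f x\<close> add up to Lebesgue measure\<close>
  define M where "M = measure_of UNIV (sets borel) (\<lambda>X. emeasure ?\<mu> X + emeasure ?\<nu> X)"
  have sets_M: "sets M = sets borel"
    unfolding M_def using sets.sigma_sets_eq[of "borel :: real measure"] by simp
  have M: "emeasure M X = emeasure ?\<mu> X + emeasure ?\<nu> X" if "X \<in> sets borel" for X
    unfolding M_def
  proof (rule emeasure_measure_of_sigma)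
    show "sigma_algebra UNIV (sets borel)"
      using sets.sigma_algebra_axioms[of borel] by simp
    show "positive (sets borel) (\<lambda>X. emeasure ?\<mu> X + emeasure ?\<nu> X)"
      by (auto simp: positive_def)
    show "countably_additive (sets borel) (\<lambda>X. emeasure ?\<mu> X + emeasure ?\<nu> X)"
      unfolding countably_additive_def
      by (auto simp: suminf_add[symmetric] suminf_emeasure)
  qed fact
  have Ioc: "emeasure M {a<..b} = emeasure lborel {a<..b}" if "a \<le> b" for a b
  proof -
    have "continuous (at_right x) f" "continuous (at_right x) (\<lambda>x. x - f x)" for x
      using cont by (auto simp: continuous_on_def continuous_within
          intro!: tendsto_diff tendsto_ident_at intro: tendsto_within_subset)
    then have "emeasure ?\<mu> {a<..b} = ennreal (f b - f a)"
      "emeasure ?\<nu> {a<..b} = ennreal ((b - f b) - (a - f a))"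
      using that monoD[OF mono] monoD[OF mono']
      by (auto intro!: emeasure_interval_measure_Ioc)
    then show ?thesis
      using that monoD[OF mono, of a b] monoD[OF mono', of a b] by (simp add: M flip: ennreal_plus)
  qed
  \<comment> \<open>In general an inequality between measures does not extend from a generating
    pi-system to the sigma-algebra, while an equality does (under finiteness on a cover). This is
    why the complementary measure of \<open>x - f x\<close> was added; dropping it again gives the
    inequality on every Borel set.\<close>
  have "M = lborel"
  proof (rule measure_eqI_generator_eq)
    let ?E = "range (\<lambda>(a, b). {a<..b::real})"
    show "Int_stable ?E"
    proof (rule Int_stableI_image)
      fix x y :: "real \<times> real"
      show "\<exists>z\<in>UNIV. (case x of (a, b) \<Rightarrow> {a<..b}) \<inter> (case y of (a, b) \<Rightarrow> {a<..b}) = (case z of (a, b) \<Rightarrow> {a<..b})"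
      proof (cases x, cases y)
        fix a b c d assume "x = (a, b)" "y = (c, d)"
        then show ?thesis
          by (intro bexI[of _ "(max a c, min b d)"]) simp_all
      qed
    qed
    show "emeasure M X = emeasure lborel X" if "X \<in> ?E" for X
    proof -
      obtain a b where X: "X = {a<..b}" using \<open>X \<in> ?E\<close> by fast
      show ?thesis unfolding X by (cases "a \<le> b") (auto simp: Ioc)
    qed
    show "sets M = sigma_sets UNIV ?E" "sets lborel = sigma_sets UNIV ?E"
      by (simp_all add: sets_M borel_sigma_sets_Ioc)
    show "range (\<lambda>i::nat. {- real i<..real i}) \<subseteq> ?E"
      by fast
    show "(\<Union>i. {- real i<..real i}) = UNIV"
    proof (intro equalityI subsetI UNIV_I)
      fix x :: real
      obtain i :: nat where "\<bar>x\<bar> < real i" using reals_Archimedean2 by blast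
      then show "x \<in> (\<Union>i::nat. {- real i<..real i})" by (auto intro!: exI[of _ i])
    qed
    show "emeasure M {- real i<..real i} \<noteq> \<infinity>" for i
      by (subst Ioc) auto
  qed auto
  then show ?thesis
    using M[OF A] by simp
qed

text \<open>Domination by Lebesgue measure makes the interval measure of \<open>f\<close> absolutely
  continuous, so it has a Radon-Nikodym density; sigma-finiteness makes this density finite almost
  everywhere, so that \<open>enn2real\<close> loses nothing.\<close>

lemma mono_difference_mono_imp_integral:
  fixes f :: "real \<Rightarrow> real"
  assumes mono: "mono f" and mono': "mono (\<lambda>x. x - f x)"
  obtains d where "\<And>a b. a \<le> b \<Longrightarrow> (d has_integral (f b - f a)) {a..b}"
proof -
  let ?\<mu> = "interval_measure f"
  have lip: "\<bar>f x - f y\<bar> \<le> \<bar>x - y\<bar>" for x y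
    using monoD[OF mono, of x y] monoD[OF mono', of x y] monoD[OF mono, of y x] monoD[OF mono', of y x]
    by (cases "x \<le> y") auto
  have "1-lipschitz_on UNIV f"
    by (rule lipschitz_onI) (use lip in \<open>auto simp: dist_real_def\<close>)
  then have cont: "continuous_on UNIV f"
    by (rule lipschitz_on_continuous_on)
  have ac: "absolutely_continuous lborel ?\<mu>"
    unfolding absolutely_continuous_def
  proof
    fix A assume "A \<in> null_sets (lborel :: real measure)"
    then show "A \<in> null_sets ?\<mu>"
      using emeasure_interval_measure_le_lborel[OF mono mono', of A] by (auto simp: null_sets_def)
  qed
  have "continuous (at_right x) f" for x
    using cont by (auto simp: continuous_on_def continuous_within intro: tendsto_within_subset)
  then have sf: "sigma_finite_measure ?\<mu>"
    by (intro sigma_finite_interval_measure monoD[OF mono])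
  define D where "D = RN_deriv lborel ?\<mu>"
  have D: "density lborel D = ?\<mu>"
    unfolding D_def by (rule sigma_finite_measure.density_RN_deriv[OF lborel.sigma_finite_measure_axioms ac]) simp
  have Dm[measurable]: "D \<in> borel_measurable borel"
    unfolding D_def using borel_measurable_RN_deriv[of lborel] by simp
  have fin: "AE x in lborel. D x \<noteq> \<infinity>"
    unfolding D_def by (rule sigma_finite_measure.RN_deriv_finite[OF lborel.sigma_finite_measure_axioms sf ac]) simp
  define d where "d x = enn2real (D x)" for x
  have dm[measurable]: "d \<in> borel_measurable borel"
    unfolding d_def by measurable
  show thesis
  proof
    fix a b :: real assume "a \<le> b"
    have "(\<integral>\<^sup>+x. ennreal (d x * indicator {a..b} x) \<partial>lborel) = (\<integral>\<^sup>+x. D x * indicator {a..b} x \<partial>lborel)"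
    proof (rule nn_integral_cong_AE)
      show "AE x in lborel. ennreal (d x * indicator {a..b} x) = D x * indicator {a..b} x"
        using fin by eventually_elim (auto simp: d_def indicator_def less_top)
    qed
    also have "\<dots> = emeasure ?\<mu> {a..b}"
      by (subst D[symmetric], subst emeasure_density) auto
    also have "\<dots> = f b - f a"
      by (intro emeasure_interval_measure_Icc \<open>a \<le> b\<close> monoD[OF mono] cont)
    finally have "((\<lambda>x. d x * indicator {a..b} x) has_integral (f b - f a)) UNIV"
      using monoD[OF mono \<open>a \<le> b\<close>]
      by (intro nn_integral_has_integral) (simp_all add: d_def)
    moreover have "(\<lambda>x. d x * indicator {a..b} x) = (\<lambda>x. if x \<in> {a..b} then d x else 0)"
      by (auto simp: indicator_def)
    ultimately show "(d has_integral (f b - f a)) {a..b}"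
      by (simp only: has_integral_restrict_UNIV)
  qed
qed

text \<open>\<open>f\<close> is an indefinite integral, and this is Lebesgue's differentiation
  theorem for its integrand.\<close>

lemma mono_difference_mono_imp_differentiable_ae:
  fixes f :: "real \<Rightarrow> real"
  assumes mono: "mono f" and mono': "mono (\<lambda>x. x - f x)"
  obtains N where "negligible N" "\<And>x. x \<notin> N \<Longrightarrow> \<exists>d. (f has_real_derivative d) (at x)"
proof -
  obtain d where d: "\<And>a b. a \<le> b \<Longrightarrow> (d has_integral (f b - f a)) {a..b}"
    using mono_difference_mono_imp_integral[OF assms] by blast
  \<comment> \<open>the averages in \<open>integrable_ccontinuous_explicit\<close> are one-sided, so the left derivative needs the reflected function\<close>
  have d': "((\<lambda>x. d (- x)) has_integral (f (- a) - f (- b))) {a..b}" if "a \<le> b" for a b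
    using d[of "- b" "- a"] that has_integral_reflect_real[of d "f (- a) - f (- b)" "- a" "- b"] by auto
  have "d integrable_on cbox a b" "(\<lambda>x. d (- x)) integrable_on cbox a b" for a b
    using d[of a b] d'[of a b] by (cases "a \<le> b"; force)+
  note int = this
  obtain N1 where N1: "negligible N1" "\<And>x e. x \<notin> N1 \<Longrightarrow> 0 < e \<Longrightarrow>
      \<exists>\<delta>>0. \<forall>h. 0 < h \<and> h < \<delta> \<longrightarrow> norm (integral (cbox x (x + h *\<^sub>R One)) d /\<^sub>R h ^ DIM(real) - d x) < e"
    using integrable_ccontinuous_explicit[of d, OF int(1)] by metis
  obtain N2 where N2: "negligible N2" "\<And>x e. x \<notin> N2 \<Longrightarrow> 0 < e \<Longrightarrow>
      \<exists>\<delta>>0. \<forall>h. 0 < h \<and> h < \<delta> \<longrightarrow>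
        norm (integral (cbox x (x + h *\<^sub>R One)) (\<lambda>x. d (- x)) /\<^sub>R h ^ DIM(real) - d (- x)) < e"
    using integrable_ccontinuous_explicit[of "\<lambda>x. d (- x)", OF int(2)] by metis
  show thesis
  proof
    show "negligible (N1 \<union> uminus ` N2)"
      using N1(1) N2(1)
      by (intro negligible_Un negligible_differentiable_image_negligible)
        (auto intro!: derivative_intros)
    fix x assume "x \<notin> N1 \<union> uminus ` N2"
    then have x: "x \<notin> N1" "- x \<notin> N2" by force+
    have "((\<lambda>h. (f (x + h) - f x) / h) \<longlongrightarrow> d x) (at 0)"
      unfolding LIM_eq
    proof (intro allI impI)
      fix e :: real assume "0 < e"
      obtain \<delta>1 where 1: "\<delta>1 > 0" "\<And>h. 0 < h \<Longrightarrow> h < \<delta>1 \<Longrightarrow> \<bar>integral {x..x + h} d / h - d x\<bar> < e"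
        using N1(2)[OF x(1) \<open>0 < e\<close>] by (auto simp: divide_inverse_commute)
      obtain \<delta>2 where 2: "\<delta>2 > 0" "\<And>h. 0 < h \<Longrightarrow> h < \<delta>2 \<Longrightarrow> \<bar>integral {- x..- x + h} (\<lambda>x. d (- x)) / h - d x\<bar> < e"
        using N2(2)[OF x(2) \<open>0 < e\<close>] by (auto simp: divide_inverse_commute)
      show "\<exists>\<delta>>0. \<forall>h. h \<noteq> 0 \<and> norm (h - 0) < \<delta> \<longrightarrow> norm ((f (x + h) - f x) / h - d x) < e"
      proof (intro exI[of _ "min \<delta>1 \<delta>2"] conjI allI impI)
        fix h :: real assume h: "h \<noteq> 0 \<and> norm (h - 0) < min \<delta>1 \<delta>2"
        show "norm ((f (x + h) - f x) / h - d x) < e"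
        proof (cases "h > 0")
          case True
          then show ?thesis using 1(2)[of h] h integral_unique[OF d[of x "x + h"]] by auto
        next
          case False
          have "integral {- x..- x + - h} (\<lambda>x. d (- x)) = f (- (- x)) - f (- (- x + - h))"
            by (rule integral_unique[OF d']) (use False h in simp)
          also have "- (- x + - h) = x + h" by simp
          finally have "integral {- x..- x + - h} (\<lambda>x. d (- x)) = f x - f (x + h)" by simp
          moreover have "(f x - f (x + h)) / (- h) = (f (x + h) - f x) / h"
            using h by (simp add: field_simps)
          ultimately have "integral {- x..- x + - h} (\<lambda>x. d (- x)) / (- h) = (f (x + h) - f x) / h"
            by simp
          then show ?thesis using 2(2)[of "- h"] h False by simp
        qed
      qed (use 1 2 in auto)
    qed
    then show "\<exists>d. (f has_real_derivative d) (at x)"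
      by (auto simp: DERIV_def)
  qed
qed

text \<open>The average of the identity and \<open>f / K\<close> has slopes between 0 and 1, which
  is what the two monotonicity conditions ask, and \<open>f\<close> is recovered from it by an
  affine formula. Adding 1 to \<open>L\<close> keeps the divisor positive when \<open>L\<close> is
  0.\<close>

lemma lipschitz_imp_differentiable_ae_real:
  fixes f :: "real \<Rightarrow> real"
  assumes "L-lipschitz_on UNIV f"
  obtains N where "negligible N" "\<And>x. x \<notin> N \<Longrightarrow> \<exists>d. (f has_real_derivative d) (at x)"
proof -
  define K where "K = L + 1"
  have "0 \<le> L" using assms by (rule lipschitz_on_nonneg)
  then have K: "K > 0" by (simp add: K_def)
  have lip: "\<bar>f x - f y\<bar> \<le> K * \<bar>x - y\<bar>" for x y
    using lipschitz_onD[OF assms, of x y] mult_right_mono[of L K "\<bar>x - y\<bar>"]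
    by (auto simp: dist_real_def K_def)
  define g where "g x = (f x / K + x) / 2" for x
  have "\<bar>f x / K - f y / K\<bar> \<le> \<bar>x - y\<bar>" for x y
    using lip[of x y] K by (simp add: field_simps flip: diff_divide_distrib)
  then have lip': "\<And>x y. x \<le> y \<Longrightarrow> \<bar>f x / K - f y / K\<bar> \<le> y - x"
    by (metis abs_minus_commute abs_of_nonneg diff_ge_0_iff_ge)
  have "mono g" "mono (\<lambda>x. x - g x)"
  proof -
    have g: "2 * g x = f x / K + x" for x by (simp add: g_def)
    have "g x \<le> g y" "x - g x \<le> y - g y" if "x \<le> y" for x y
      using lip'[OF that] g[of x] g[of y] by linarith+
    then show "mono g" "mono (\<lambda>x. x - g x)" unfolding mono_def by simp_all
  qed
  then obtain N where N: "negligible N" "\<And>x. x \<notin> N \<Longrightarrow> \<exists>d. (g has_real_derivative d) (at x)"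
    using mono_difference_mono_imp_differentiable_ae by blast
  show thesis
  proof (rule that[OF N(1)])
    fix x assume "x \<notin> N"
    then obtain d where "(g has_real_derivative d) (at x)" using N by blast
    then have "((\<lambda>x. K * (2 * g x - x)) has_real_derivative K * (2 * d - 1)) (at x)"
      by (auto intro!: derivative_eq_intros)
    moreover have "(\<lambda>x. K * (2 * g x - x)) = f" using K by (auto simp: g_def field_simps)
    ultimately show "\<exists>d. (f has_real_derivative d) (at x)" by auto
  qed
qed

lemma lipschitz_imp_has_vector_derivative_ae:
  fixes f :: "real \<Rightarrow> 'a::euclidean_space"
  assumes "L-lipschitz_on UNIV f"
  obtains N where "negligible N" "\<And>x. x \<notin> N \<Longrightarrow> \<exists>d. (f has_vector_derivative d) (at x)"
proof -
  have "\<exists>N. negligible N \<and> (\<forall>x. x \<notin> N \<longrightarrow> (\<exists>d. ((\<lambda>x. f x \<bullet> i) has_real_derivative d) (at x)))"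
    if "i \<in> Basis" for i
  proof -
    have "L-lipschitz_on UNIV (\<lambda>x. f x \<bullet> i)"
    proof (rule lipschitz_onI)
      fix x y
      have "dist (f x \<bullet> i) (f y \<bullet> i) \<le> norm (f x - f y)"
        using Basis_le_norm[OF that, of "f x - f y"] by (simp add: dist_real_def inner_diff_left)
      then show "dist (f x \<bullet> i) (f y \<bullet> i) \<le> L * dist x y"
        using lipschitz_onD[OF assms, of x y] by (simp add: dist_norm)
    qed (rule lipschitz_on_nonneg[OF assms])
    then show ?thesis using lipschitz_imp_differentiable_ae_real by metis
  qed
  then obtain N where N: "\<And>i. i \<in> Basis \<Longrightarrow> negligible (N i)"
     "\<And>i x. i \<in> Basis \<Longrightarrow> x \<notin> N i \<Longrightarrow> \<exists>d. ((\<lambda>x. f x \<bullet> i) has_real_derivative d) (at x)"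
    by metis
  show thesis
  proof
    show "negligible (\<Union>i\<in>Basis. N i)"
      using N by (intro negligible_Union) auto
    fix x assume "x \<notin> (\<Union>i\<in>Basis. N i)"
    then have "\<forall>i\<in>Basis. \<exists>d. ((\<lambda>x. f x \<bullet> i) has_real_derivative d) (at x)"
      using N(2) by simp
    then obtain d where d: "\<And>i. i \<in> Basis \<Longrightarrow> ((\<lambda>x. f x \<bullet> i) has_real_derivative d i) (at x)"
      using bchoice by metis
    have "(f has_vector_derivative (\<Sum>i\<in>Basis. d i *\<^sub>R i)) (at x)"
      unfolding has_vector_derivative_def
    proof (subst has_derivative_componentwise_within, intro ballI)
      fix i :: 'a assume i: "i \<in> Basis"
      have "(\<lambda>h. (h *\<^sub>R (\<Sum>i\<in>Basis. d i *\<^sub>R i)) \<bullet> i) = (*) (d i)"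
        using i by (simp add: fun_eq_iff)
      then show "((\<lambda>x. f x \<bullet> i) has_derivative (\<lambda>h. (h *\<^sub>R (\<Sum>i\<in>Basis. d i *\<^sub>R i)) \<bullet> i)) (at x)"
        using d[OF i] by (simp add: has_field_derivative_def)
    qed
    then show "\<exists>d. (f has_vector_derivative d) (at x)" by blast
  qed
qed

section \<open>Right difference quotients\<close>


text \<open>The maximum of the compact set \<open>S \<inter> {a..b}\<close> admits no further step,
  so it is \<open>b\<close>. This is the induction on time behind both the Dini estimate and the
  monotonicity of partition indices.\<close>

lemma right_extendable_closed_mem:
  fixes S :: "real set"
  assumes "closed S" "a \<in> S" "a \<le> b"
    and step: "\<And>t. t \<in> S \<Longrightarrow> a \<le> t \<Longrightarrow> t < b \<Longrightarrow> \<exists>u\<in>S. t < u \<and> u \<le> b"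
  shows "b \<in> S"
proof (rule ccontr)
  assume "b \<notin> S"
  have "compact (S \<inter> {a..b})" "S \<inter> {a..b} \<noteq> {}"
    using assms by (auto intro: closed_Int_compact)
  then obtain t where t: "t \<in> S" "a \<le> t" "t \<le> b" and max: "\<And>u. u \<in> S \<inter> {a..b} \<Longrightarrow> u \<le> t"
    using compact_attains_sup[of "S \<inter> {a..b}"] by (metis IntD1 IntD2 atLeastAtMost_iff)
  with \<open>b \<notin> S\<close> have "t < b" by (cases "t = b") auto
  then obtain u where "u \<in> S" "t < u" "u \<le> b" using step t by blast
  with max[of u] t show False by auto
qed

text \<open>With slope \<open>m - \<eta>\<close> the growth inequality can be pushed a little to the
  right from each time, and continuity makes the set of times where it holds closed. The loss in
  slope is made arbitrarily small at the end.\<close>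

lemma dini_lower_bound:
  fixes h :: "real \<Rightarrow> real"
  assumes cont: "continuous_on {a..b} h" and "a \<le> b"
    and dini: "\<And>t \<eta>. a \<le> t \<Longrightarrow> t < b \<Longrightarrow> 0 < \<eta> \<Longrightarrow>
      \<forall>\<^sub>F s in at_right 0. (m - \<eta>) * s \<le> h (t + s) - h t"
  shows "m * (b - a) \<le> h b - h a"
proof (rule field_le_epsilon)
  fix e :: real assume "0 < e"
  \<comment> \<open>The total loss over the interval is \<open>\<eta> * (b - a)\<close>, at most
    \<open>e\<close>; the summand 1 covers the case \<open>a = b\<close>.\<close>
  define \<eta> where "\<eta> = e / (b - a + 1)"
  have \<eta>: "\<eta> > 0" "\<eta> * (b - a) \<le> e" using \<open>0 < e\<close> \<open>a \<le> b\<close> by (auto simp: \<eta>_def field_simps)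
  define S where "S = {t\<in>{a..b}. (m - \<eta>) * (t - a) \<le> h t - h a}"
  have "b \<in> S"
  proof (rule right_extendable_closed_mem[where a = a])
    show "closed S" unfolding S_def
      by (intro continuous_on_closed_Collect_le cont continuous_intros closed_atLeastAtMost)
    show "a \<in> S" using \<open>a \<le> b\<close> by (auto simp: S_def)
    fix t assume t: "t \<in> S" "a \<le> t" "t < b"
    have "\<forall>\<^sub>F s in at_right 0. s \<in> {0<..<b - t}"
      by (rule eventually_at_right_real) (use t in simp)
    then have "\<forall>\<^sub>F s in at_right 0. (m - \<eta>) * s \<le> h (t + s) - h t \<and> s \<in> {0<..<b - t}"
      using dini[OF t(2,3) \<eta>(1)] by eventually_elim simp
    then obtain s where "(m - \<eta>) * s \<le> h (t + s) - h t" "0 < s" "s < b - t"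
      using eventually_happens trivial_limit_at_right_real by fastforce
    then show "\<exists>u\<in>S. t < u \<and> u \<le> b"
      using t by (intro bexI[of _ "t + s"]) (auto simp: S_def algebra_simps)
  qed fact
  then show "m * (b - a) \<le> h b - h a + e"
    using \<eta> by (simp add: S_def algebra_simps)
qed

text \<open>\<open>right_quot f A\<close> says that the right difference quotients of \<open>f\<close> at \<open>0\<close> approach \<open>A\<close>;
  the condition at time \<open>t\<close> on a path \<open>\<phi>\<close> is stated for the germ \<open>\<lambda>h. \<phi> (t + h)\<close>.\<close>

definition right_quot :: "(real \<Rightarrow> 'a::real_normed_vector) \<Rightarrow> 'a set \<Rightarrow> bool" where
  "right_quot f A \<longleftrightarrow> (\<forall>\<eta>>0. \<forall>\<^sub>F h in at_right 0. \<exists>v\<in>A. norm ((f h - f 0) /\<^sub>R h - v) < \<eta>)"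

lemma right_quot_mono: "right_quot f A \<Longrightarrow> A \<subseteq> B \<Longrightarrow> right_quot f B"
  unfolding right_quot_def by (force elim!: all_forward imp_forward eventually_mono)

lemma right_quot_cong:
  assumes "right_quot f A" "0 < \<delta>" "\<And>s. 0 \<le> s \<Longrightarrow> s < \<delta> \<Longrightarrow> f s = g s"
  shows "right_quot g A"
  unfolding right_quot_def
proof (intro allI impI)
  fix \<eta> :: real assume "0 < \<eta>"
  have "\<forall>\<^sub>F h in at_right 0. h \<in> {0<..<\<delta>}"
    by (rule eventually_at_right_real) fact
  moreover have "\<forall>\<^sub>F h in at_right 0. \<exists>v\<in>A. norm ((f h - f 0) /\<^sub>R h - v) < \<eta>"
    using assms(1) \<open>0 < \<eta>\<close> by (auto simp: right_quot_def)
  ultimately show "\<forall>\<^sub>F h in at_right 0. \<exists>v\<in>A. norm ((g h - g 0) /\<^sub>R h - v) < \<eta>"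
    by eventually_elim (use assms(2,3) in auto)
qed

text \<open>A closed convex set is separated from an outside point by a hyperplane, and in the
  normal direction \<open>v\<close> the claim becomes the scalar Dini estimate for
  \<open>v \<bullet> \<phi> t\<close>.\<close>

lemma right_quot_mean_value:
  fixes \<phi> :: "real \<Rightarrow> 'a::euclidean_space"
  assumes cont: "continuous_on {a..b} \<phi>" and "a < b" and C: "convex C" "closed C"
    and rq: "\<And>t. a \<le> t \<Longrightarrow> t < b \<Longrightarrow> right_quot (\<lambda>h. \<phi> (t + h)) C"
  shows "(\<phi> b - \<phi> a) /\<^sub>R (b - a) \<in> C"
proof (rule ccontr)
  assume "(\<phi> b - \<phi> a) /\<^sub>R (b - a) \<notin> C"
  then obtain v m where v: "v \<bullet> ((\<phi> b - \<phi> a) /\<^sub>R (b - a)) < m" "\<And>x. x \<in> C \<Longrightarrow> v \<bullet> x > m"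
    using separating_hyperplane_closed_point[OF C] by blast
  have "m * (b - a) \<le> v \<bullet> \<phi> b - v \<bullet> \<phi> a"
  proof (rule dini_lower_bound)
    show "continuous_on {a..b} (\<lambda>t. v \<bullet> \<phi> t)"
      by (intro continuous_intros cont)
    fix t \<eta> :: real assume t: "a \<le> t" "t < b" "0 < \<eta>"
    \<comment> \<open>By Cauchy-Schwarz an error \<open>e\<close> in the quotient costs at most
      \<open>norm v * e\<close>, hence at most \<eta>, in the direction \<open>v\<close>.\<close>
    define e where "e = \<eta> / (norm v + 1)"
    have "norm v * e \<le> \<eta>" "e > 0" using t by (auto simp: e_def field_simps add_pos_nonneg)
    have "\<forall>\<^sub>F h in at_right 0. \<exists>x\<in>C. norm ((\<phi> (t + h) - \<phi> t) /\<^sub>R h - x) < e"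
      using rq[OF t(1,2)] \<open>e > 0\<close> by (auto simp: right_quot_def)
    moreover have "\<forall>\<^sub>F h in at_right 0. (0::real) < h"
      by (simp add: eventually_at_right_less)
    ultimately show "\<forall>\<^sub>F h in at_right 0. (m - \<eta>) * h \<le> v \<bullet> \<phi> (t + h) - v \<bullet> \<phi> t"
    proof eventually_elim
      case (elim h)
      then obtain x where x: "x \<in> C" "norm ((\<phi> (t + h) - \<phi> t) /\<^sub>R h - x) < e" by blast
      have "\<bar>v \<bullet> ((\<phi> (t + h) - \<phi> t) /\<^sub>R h - x)\<bar> \<le> norm v * e"
        by (rule order_trans[OF Cauchy_Schwarz_ineq2]) (use x in \<open>auto intro: mult_left_mono\<close>)
      then have "m - \<eta> \<le> v \<bullet> ((\<phi> (t + h) - \<phi> t) /\<^sub>R h)"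
        using v(2)[OF x(1)] \<open>norm v * e \<le> \<eta>\<close> by (simp add: inner_diff_right)
      then have "m - \<eta> \<le> (v \<bullet> \<phi> (t + h) - v \<bullet> \<phi> t) / h"
        by (simp add: inner_diff_right divide_inverse_commute)
      then show ?case using elim by (simp add: pos_le_divide_eq)
    qed
  qed (use \<open>a < b\<close> in auto)
  moreover have "v \<bullet> ((\<phi> b - \<phi> a) /\<^sub>R (b - a)) = (v \<bullet> \<phi> b - v \<bullet> \<phi> a) / (b - a)"
    by (simp add: inner_diff_right divide_inverse_commute)
  ultimately show False using v(1) \<open>a < b\<close> by (simp add: pos_divide_less_eq)
qed

section \<open>Passing to pointwise limits of paths\<close>

lemma frequently_mem_closed_tendsto:
  assumes "closed C" "(X \<longlongrightarrow> x) F" "\<exists>\<^sub>F k in F. X k \<in> C"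
  shows "x \<in> C"
proof (rule ccontr)
  assume "x \<notin> C"
  then have "\<forall>\<^sub>F k in F. X k \<in> - C"
    using assms(1,2) by (intro topological_tendstoD) auto
  with assms(3) show False by (auto simp: frequently_def elim: eventually_mono)
qed

text \<open>Chord quotients over a fixed interval converge with the paths, whereas quotients at a
  point involve a second limit; hence the detour through the mean value theorem. Since
  \<open>C\<close> is closed, infinitely many \<open>k\<close> are enough, so that different times
  can be served by different subsequences without extracting them.\<close>

lemma right_quot_mean_value_limit:
  fixes \<phi> :: "real \<Rightarrow> 'a::euclidean_space"
  assumes lim: "\<And>t. (\<lambda>k. \<psi> k t) \<longlonglongrightarrow> \<phi> t" and cont: "\<And>k. continuous_on UNIV (\<psi> k)"
    and "a < b" and C: "convex C" "closed C"
    and rq: "\<exists>\<^sub>F k in sequentially. \<forall>t\<in>{a..<b}. right_quot (\<lambda>h. \<psi> k (t + h)) C"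
  shows "(\<phi> b - \<phi> a) /\<^sub>R (b - a) \<in> C"
proof (rule frequently_mem_closed_tendsto[OF C(2)])
  show "(\<lambda>k. (\<psi> k b - \<psi> k a) /\<^sub>R (b - a)) \<longlonglongrightarrow> (\<phi> b - \<phi> a) /\<^sub>R (b - a)"
    by (intro tendsto_intros lim)
  show "\<exists>\<^sub>F k in sequentially. (\<psi> k b - \<psi> k a) /\<^sub>R (b - a) \<in> C"
    using rq
  proof (rule frequently_elim1)
    fix k assume "\<forall>t\<in>{a..<b}. right_quot (\<lambda>h. \<psi> k (t + h)) C"
    then show "(\<psi> k b - \<psi> k a) /\<^sub>R (b - a) \<in> C"
      using cont[of k] \<open>a < b\<close> C
      by (intro right_quot_mean_value) (auto intro: continuous_on_subset)
  qed
qed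

lemma lipschitz_limit:
  assumes "\<And>k. L-lipschitz_on X (\<psi> k)" "\<And>t. t \<in> X \<Longrightarrow> (\<lambda>k. \<psi> k t) \<longlonglongrightarrow> \<phi> t"
  shows "L-lipschitz_on X \<phi>"
proof (rule lipschitz_onI)
  fix s t assume "s \<in> X" "t \<in> X"
  have "(\<lambda>k. dist (\<psi> k s) (\<psi> k t)) \<longlonglongrightarrow> dist (\<phi> s) (\<phi> t)"
    using assms(2) \<open>s \<in> X\<close> \<open>t \<in> X\<close> by (intro tendsto_intros)
  then show "dist (\<phi> s) (\<phi> t) \<le> L * dist s t"
    by (rule LIMSEQ_le_const2) (use assms(1) \<open>s \<in> X\<close> \<open>t \<in> X\<close> in \<open>auto dest: lipschitz_onD\<close>)
qed (rule lipschitz_on_nonneg[OF assms(1)])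

text \<open>Arzela-Ascoli on the whole line: a diagonal sequence converges at the rationals, and the
  common Lipschitz constant carries the Cauchy property to every real.\<close>

lemma lipschitz_convergent_subsequence:
  fixes \<psi> :: "nat \<Rightarrow> real \<Rightarrow> 'a::euclidean_space"
  assumes lip: "\<And>k. L-lipschitz_on UNIV (\<psi> k)" and bnd: "\<And>k. norm (\<psi> k 0) \<le> M"
  obtains r \<phi> where "strict_mono r" "L-lipschitz_on UNIV \<phi>" "\<And>t. (\<lambda>k. \<psi> (r k) t) \<longlonglongrightarrow> \<phi> t"
proof -
  have L: "0 \<le> L" using lip lipschitz_on_nonneg by blast
  have "0 \<le> M" using bnd[of 0] norm_ge_zero order_trans by blast
  \<comment> \<open>the weight makes the functions uniformly bounded, as \<open>function_convergent_subsequence\<close> requires\<close>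
  define g where "g k t = \<psi> k t /\<^sub>R (1 + \<bar>t\<bar>)" for k t
  have g: "norm (g k t) \<le> M + L" for k t
  proof -
    have "norm (\<psi> k t) \<le> norm (\<psi> k 0) + norm (\<psi> k t - \<psi> k 0)"
      by (metis norm_triangle_sub)
    also have "\<dots> \<le> M + L * \<bar>t\<bar>"
      using lipschitz_onD[OF lip, of t 0 k] bnd[of k] by (simp add: dist_norm)
    also have "\<dots> \<le> (M + L) * (1 + \<bar>t\<bar>)"
      using L \<open>0 \<le> M\<close> by (simp add: algebra_simps)
    finally show ?thesis
      by (simp add: g_def field_simps)
  qed
  obtain r where r: "strict_mono r" "\<And>x. x \<in> \<rat> \<Longrightarrow> \<exists>l. (\<lambda>n. g (r n) x) \<longlonglongrightarrow> l"
    using function_convergent_subsequence[of \<rat> g "M + L"] g countable_rat by metis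
  have conv_rat: "convergent (\<lambda>k. \<psi> (r k) q)" if "q \<in> \<rat>" for q
  proof -
    obtain l where "(\<lambda>n. g (r n) q) \<longlonglongrightarrow> l" using r(2) \<open>q \<in> \<rat>\<close> by blast
    then have "(\<lambda>n. (1 + \<bar>q\<bar>) *\<^sub>R g (r n) q) \<longlonglongrightarrow> (1 + \<bar>q\<bar>) *\<^sub>R l"
      by (intro tendsto_intros)
    then show ?thesis by (auto simp: g_def convergent_def add_pos_nonneg)
  qed
  have conv: "convergent (\<lambda>k. \<psi> (r k) t)" for t
  proof -
    have "Cauchy (\<lambda>k. \<psi> (r k) t)"
    proof (rule metric_CauchyI)
      fix e :: real assume "0 < e"
      define d where "d = e / (3 * (L + 1))"
      have d: "d > 0" "L * d \<le> e / 3" using \<open>0 < e\<close> L by (auto simp: d_def field_simps)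
      obtain q where q: "q \<in> \<rat>" "\<bar>t - q\<bar> < d"
        using Rats_dense_in_real[of t "t + d"] d by force
      obtain N where N: "\<And>m n. m \<ge> N \<Longrightarrow> n \<ge> N \<Longrightarrow> dist (\<psi> (r m) q) (\<psi> (r n) q) < e / 3"
        using convergent_Cauchy[OF conv_rat[OF q(1)]] \<open>0 < e\<close>
        by (metis Cauchy_def divide_pos_pos zero_less_numeral)
      have close: "dist (\<psi> k t) (\<psi> k q) \<le> e / 3" for k
      proof -
        have "dist (\<psi> k t) (\<psi> k q) \<le> L * \<bar>t - q\<bar>"
          using lipschitz_onD[OF lip, of t q k] by (simp add: dist_real_def)
        also have "\<dots> \<le> L * d" using q L by (intro mult_left_mono) auto
        finally show ?thesis using d by simp
      qed
      show "\<exists>N. \<forall>m\<ge>N. \<forall>n\<ge>N. dist (\<psi> (r m) t) (\<psi> (r n) t) < e"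
      proof (intro exI allI impI)
        fix m n assume "m \<ge> N" "n \<ge> N"
        then show "dist (\<psi> (r m) t) (\<psi> (r n) t) < e"
          using close[of "r m"] close[of "r n"] N[of m n]
            dist_triangle[of "\<psi> (r m) t" "\<psi> (r n) t" "\<psi> (r m) q"]
            dist_triangle[of "\<psi> (r m) q" "\<psi> (r n) t" "\<psi> (r n) q"]
          by (simp add: dist_commute)
      qed
    qed
    then show ?thesis by (rule Cauchy_convergent)
  qed
  define \<phi> where "\<phi> t = lim (\<lambda>k. \<psi> (r k) t)" for t
  have \<phi>: "(\<lambda>k. \<psi> (r k) t) \<longlonglongrightarrow> \<phi> t" for t
    using conv[of t] by (simp add: \<phi>_def convergent_LIMSEQ_iff)
  show thesis
    by (rule that[OF r(1) _ \<phi>], rule lipschitz_limit[of L UNIV "\<lambda>k. \<psi> (r k)"]) (use lip \<phi> in auto)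
qed

section \<open>Continuation of paths\<close>


text \<open>Agreement includes negative times, so that the members of a chain converge at every real
  time and the limit is Lipschitz on the whole line.\<close>

definition extends_path :: "real \<times> (real \<Rightarrow> 'a) \<Rightarrow> real \<times> (real \<Rightarrow> 'a) \<Rightarrow> bool" where
  "extends_path \<sigma> \<tau> \<longleftrightarrow> fst \<sigma> \<le> fst \<tau> \<and> (\<forall>t\<le>fst \<sigma>. snd \<tau> t = snd \<sigma> t)"

lemma extends_path_refl: "extends_path \<sigma> \<sigma>"
  by (simp add: extends_path_def)

lemma extends_path_trans: "extends_path \<sigma> \<tau> \<Longrightarrow> extends_path \<tau> \<upsilon> \<Longrightarrow> extends_path \<sigma> \<upsilon>"
  by (auto simp: extends_path_def)

text \<open>Choosing at each step an extension that realises at least half of the possible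
  increase of length (at most 1) replaces Zorn's lemma.\<close>

lemma greedy_path_extension:
  assumes "\<sigma> \<in> \<P>"
  shows "\<exists>\<tau>\<in>\<P>. extends_path \<sigma> \<tau> \<and>
    (\<forall>\<upsilon>\<in>\<P>. extends_path \<sigma> \<upsilon> \<longrightarrow> min (fst \<upsilon> - fst \<sigma>) 1 \<le> 2 * (fst \<tau> - fst \<sigma>))"
proof -
  let ?X = "(\<lambda>\<upsilon>. min (fst \<upsilon> - fst \<sigma>) 1) ` {\<upsilon>\<in>\<P>. extends_path \<sigma> \<upsilon>}"
  have bdd: "bdd_above ?X" by (rule bdd_aboveI[of _ 1]) auto
  have mem: "\<sigma> \<in> {\<upsilon>\<in>\<P>. extends_path \<sigma> \<upsilon>}"
    using assms by (simp add: extends_path_refl)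
  then have ne: "?X \<noteq> {}" by blast
  show ?thesis
  proof (cases "Sup ?X \<le> 0")
    case True
    then have "x \<le> 0" if "x \<in> ?X" for x
      using cSup_upper[OF that bdd] by simp
    then show ?thesis using mem by (intro bexI[of _ \<sigma>]) auto
  next
    case False
    then have "Sup ?X / 2 < Sup ?X" by simp
    then obtain x where "x \<in> ?X" "Sup ?X / 2 < x"
      using less_cSup_iff[OF ne bdd] by blast
    then obtain \<tau> where \<tau>: "\<tau> \<in> \<P>" "extends_path \<sigma> \<tau>" "Sup ?X / 2 < min (fst \<tau> - fst \<sigma>) 1"
      by blast
    have "min (fst \<upsilon> - fst \<sigma>) 1 \<le> 2 * (fst \<tau> - fst \<sigma>)" if "\<upsilon> \<in> \<P>" "extends_path \<sigma> \<upsilon>" for \<upsilon>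
    proof -
      have "min (fst \<upsilon> - fst \<sigma>) 1 \<in> ?X" using that by (intro imageI) simp
      then have "min (fst \<upsilon> - fst \<sigma>) 1 \<le> Sup ?X" by (rule cSup_upper[OF _ bdd])
      also have "Sup ?X \<le> 2 * min (fst \<tau> - fst \<sigma>) 1" using \<tau>(3) unfolding pos_divide_less_eq[OF zero_less_numeral] by (simp only: mult.commute)
      also have "\<dots> \<le> 2 * (fst \<tau> - fst \<sigma>)"
        by (intro mult_left_mono min.cobounded1) simp
      finally show ?thesis .
    qed
    then show ?thesis using \<tau> by blast
  qed
qed

text \<open>\<open>Q\<close> depends only on the germ to the right, so it survives concatenation,
  also at the joint, and passes to the limit of a chain of extensions. If the chain has bounded
  length, its end point is a limit of points of \<Omega>. Were it in \<Omega>, one more step would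
  extend all stages of the chain at once, against their greedy choice.\<close>

lemma continuation:
  fixes Q :: "(real \<Rightarrow> 'a::euclidean_space) \<Rightarrow> bool"
  assumes local: "\<And>f g \<delta>. Q f \<Longrightarrow> 0 < \<delta> \<Longrightarrow> (\<And>s. 0 \<le> s \<Longrightarrow> s < \<delta> \<Longrightarrow> f s = g s) \<Longrightarrow> Q g"
    and step: "\<And>x. x \<in> \<Omega> \<Longrightarrow> \<exists>h>0. \<exists>\<psi>. \<psi> 0 = x \<and> \<psi> h \<in> \<Omega> \<and> L-lipschitz_on UNIV \<psi> \<and>
      (\<forall>t\<in>{0..<h}. Q (\<lambda>s. \<psi> (t + s)))"
    and "x \<in> \<Omega>"
  obtains \<phi> where "\<phi> 0 = x" "L-lipschitz_on UNIV \<phi>"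
    "(\<forall>t\<ge>0. Q (\<lambda>s. \<phi> (t + s))) \<or>
     (\<exists>b>0. (\<forall>t\<in>{0..<b}. Q (\<lambda>s. \<phi> (t + s))) \<and> \<phi> b \<in> closure \<Omega> - \<Omega>)"
proof -
  \<comment> \<open>Freezing the path after time \<open>b\<close> makes it a total Lipschitz
    function. Nothing is asked of the germ at \<open>b\<close> itself, since the next piece decides
    it.\<close>
  define \<P> where "\<P> = {(b, \<psi>). 0 \<le> b \<and> \<psi> 0 = x \<and> L-lipschitz_on UNIV \<psi> \<and> \<psi> b \<in> \<Omega> \<and>
    (\<forall>t\<ge>b. \<psi> t = \<psi> b) \<and> (\<forall>t\<in>{0..<b}. Q (\<lambda>s. \<psi> (t + s)))}"
  have "0 \<le> L" using step[OF \<open>x \<in> \<Omega>\<close>] lipschitz_on_nonneg by blast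
  then have init: "(0, \<lambda>_. x) \<in> \<P>"
    using \<open>x \<in> \<Omega>\<close> by (auto simp: \<P>_def lipschitz_on_def)
  define R where "R \<sigma> \<tau> \<longleftrightarrow> extends_path \<sigma> \<tau> \<and> (\<forall>\<upsilon>\<in>\<P>. extends_path \<sigma> \<upsilon> \<longrightarrow>
      min (fst \<upsilon> - fst \<sigma>) 1 \<le> 2 * (fst \<tau> - fst \<sigma>))" for \<sigma> \<tau>
  have "\<exists>\<tau>. \<tau> \<in> \<P> \<and> R \<sigma> \<tau>" if "\<sigma> \<in> \<P>" for \<sigma>
    using greedy_path_extension[OF that] unfolding R_def by blast
  then obtain \<sigma> where \<sigma>: "\<And>n. \<sigma> n \<in> \<P>" "\<And>n. R (\<sigma> n) (\<sigma> (Suc n))"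
    using dependent_nat_choice[of "\<lambda>_ \<sigma>. \<sigma> \<in> \<P>" "\<lambda>_. R"] init by metis
  have ext_Suc: "extends_path (\<sigma> n) (\<sigma> (Suc n))" for n
    using \<sigma>(2)[of n] by (simp add: R_def)
  have greedy: "min (fst \<upsilon> - fst (\<sigma> n)) 1 \<le> 2 * (fst (\<sigma> (Suc n)) - fst (\<sigma> n))"
    if "\<upsilon> \<in> \<P>" "extends_path (\<sigma> n) \<upsilon>" for n \<upsilon>
    using \<sigma>(2)[of n] that by (simp only: R_def)
  define b where "b n = fst (\<sigma> n)" for n
  define \<psi> where "\<psi> n = snd (\<sigma> n)" for n
  have st: "0 \<le> b n" "\<psi> n 0 = x" "L-lipschitz_on UNIV (\<psi> n)" "\<psi> n (b n) \<in> \<Omega>"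
    "\<And>t. b n \<le> t \<Longrightarrow> \<psi> n t = \<psi> n (b n)" "\<And>t. 0 \<le> t \<Longrightarrow> t < b n \<Longrightarrow> Q (\<lambda>s. \<psi> n (t + s))" for n
  proof -
    have "(b n, \<psi> n) \<in> \<P>" using \<sigma>(1)[of n] by (simp add: b_def \<psi>_def)
    then have *: "0 \<le> b n \<and> \<psi> n 0 = x \<and> L-lipschitz_on UNIV (\<psi> n) \<and> \<psi> n (b n) \<in> \<Omega> \<and>
      (\<forall>t\<ge>b n. \<psi> n t = \<psi> n (b n)) \<and> (\<forall>t\<in>{0..<b n}. Q (\<lambda>s. \<psi> n (t + s)))"
      unfolding \<P>_def mem_Collect_eq prod.case .
    show "0 \<le> b n" "\<psi> n 0 = x" "L-lipschitz_on UNIV (\<psi> n)" "\<psi> n (b n) \<in> \<Omega>"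
      using * by blast+
    show "\<And>t. b n \<le> t \<Longrightarrow> \<psi> n t = \<psi> n (b n)" using * by blast
    show "\<And>t. 0 \<le> t \<Longrightarrow> t < b n \<Longrightarrow> Q (\<lambda>s. \<psi> n (t + s))" using * by (metis atLeastLessThan_iff)
  qed
  have ext: "extends_path (\<sigma> m) (\<sigma> n)" if "m \<le> n" for m n
    using that by (induction rule: dec_induct) (auto intro: extends_path_refl extends_path_trans ext_Suc)
  then have b_mono: "b m \<le> b n" and \<psi>_eq: "\<And>t. t \<le> b m \<Longrightarrow> \<psi> n t = \<psi> m t" if "m \<le> n" for m n
    using that by (auto simp: extends_path_def b_def \<psi>_def)
  have "\<exists>l. (\<lambda>n. \<psi> n t) \<longlonglongrightarrow> l" for t
  proof (cases "\<exists>m. t \<le> b m")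
    case True
    then obtain m where "t \<le> b m" by blast
    then have "\<forall>\<^sub>F n in sequentially. \<psi> n t = \<psi> m t"
      by (intro eventually_sequentiallyI[of m] \<psi>_eq)
    then show ?thesis by (blast intro: tendsto_eventually)
  next
    case False
    \<comment> \<open>Beyond all the times \<open>b n\<close> each path sits at its frozen end
      value, so convergence reduces to that of the bounded increasing sequence
      \<open>b\<close>.\<close>
    then have less: "b n < t" for n by (simp add: not_le)
    have "incseq b" using b_mono by (simp add: incseq_def)
    then have "convergent b"
      using less by (intro Bseq_mono_convergent BseqI'[of _ t]) (auto simp: st(1) less_imp_le incseq_def)
    then have "Cauchy b" by (rule convergent_Cauchy)
    have *: "dist (\<psi> m t) (\<psi> n t) \<le> L * dist (b m) (b n)" if "m \<le> n" for m n
    proof -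
      have "\<psi> m t = \<psi> n (b m)" "\<psi> n t = \<psi> n (b n)"
        using st(5)[of m t] st(5)[of n t] less[of m] less[of n] \<psi>_eq[OF that, of "b m"] by auto
      then show ?thesis using lipschitz_onD[OF st(3)[of n], of "b m" "b n"] by simp
    qed
    have "Cauchy (\<lambda>n. \<psi> n t)"
    proof (rule metric_CauchyI)
      fix e :: real assume "0 < e"
      then have "e / (L + 1) > 0" using \<open>0 \<le> L\<close> by simp
      then obtain N where N: "\<And>m n. m \<ge> N \<Longrightarrow> n \<ge> N \<Longrightarrow> dist (b m) (b n) < e / (L + 1)"
        using \<open>Cauchy b\<close> by (metis Cauchy_def)
      have "dist (\<psi> m t) (\<psi> n t) < e" if "m \<ge> N" "n \<ge> N" for m n
      proof -
        have "dist (\<psi> m t) (\<psi> n t) \<le> L * dist (b m) (b n)"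
          using *[of m n] *[of n m] by (cases "m \<le> n") (auto simp: dist_commute)
        also have "\<dots> \<le> L * (e / (L + 1))"
          using N[OF that] \<open>0 \<le> L\<close> by (intro mult_left_mono) auto
        also have "\<dots> < e" using \<open>0 \<le> L\<close> \<open>0 < e\<close> by (simp add: field_simps)
        finally show ?thesis .
      qed
      then show "\<exists>N. \<forall>m\<ge>N. \<forall>n\<ge>N. dist (\<psi> m t) (\<psi> n t) < e" by blast
    qed
    then show ?thesis by (simp add: Cauchy_convergent_iff convergent_def)
  qed
  then obtain \<phi> where \<phi>: "\<And>t. (\<lambda>n. \<psi> n t) \<longlonglongrightarrow> \<phi> t" by metis
  have \<phi>_eq: "\<phi> t = \<psi> n t" if "t \<le> b n" for t n
  proof (rule LIMSEQ_unique[OF \<phi>])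
    show "(\<lambda>n. \<psi> n t) \<longlonglongrightarrow> \<psi> n t"
      by (rule tendsto_eventually, rule eventually_sequentiallyI[of n]) (use \<psi>_eq that in auto)
  qed
  have lip: "L-lipschitz_on UNIV \<phi>"
    by (rule lipschitz_limit[OF st(3)]) (rule \<phi>)
  have "\<phi> 0 = x" using \<phi>_eq[of 0 0] st(1)[of 0] st(2)[of 0] by simp
  have Q: "Q (\<lambda>s. \<phi> (t + s))" if "0 \<le> t" "t < b n" for t n
  proof (rule local[OF st(6)[OF that]])
    show "0 < b n - t" using that by simp
    show "\<psi> n (t + s) = \<phi> (t + s)" if "s < b n - t" for s
      using \<phi>_eq[of "t + s" n] that by simp
  qed
  show thesis
  proof (cases "\<exists>c. \<forall>n. b n \<le> c")
    case False
    then have "Q (\<lambda>s. \<phi> (t + s))" if "0 \<le> t" for t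
      using Q[OF that] by (meson not_le)
    then show thesis using that[OF \<open>\<phi> 0 = x\<close> lip] by blast
  next
    case True
    then obtain c where c: "\<And>n. b n \<le> c" by blast
    obtain \<beta> where \<beta>: "b \<longlonglongrightarrow> \<beta>" "\<And>n. b n \<le> \<beta>"
      using incseq_convergent[of b c] c b_mono by (auto simp: incseq_def)
    have "(\<lambda>n. \<phi> (b n)) \<longlonglongrightarrow> \<phi> \<beta>"
      by (rule continuous_on_tendsto_compose[OF lipschitz_on_continuous_on[OF lip] \<beta>(1)]) auto
    moreover have "\<phi> (b n) \<in> \<Omega>" for n using st(4)[of n] \<phi>_eq[of "b n" n] by simp
    ultimately have cl: "\<phi> \<beta> \<in> closure \<Omega>"
      unfolding closure_sequential by (intro exI[of _ "\<lambda>n. \<phi> (b n)"]) simp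
    have Q\<beta>: "Q (\<lambda>s. \<phi> (t + s))" if "0 \<le> t" "t < \<beta>" for t
    proof -
      obtain n where "t < b n"
        using order_tendstoD(1)[OF \<beta>(1) \<open>t < \<beta>\<close>] by (auto simp: eventually_sequentially)
      then show ?thesis using Q \<open>0 \<le> t\<close> by blast
    qed
    have "0 \<le> \<beta>" using st(1)[of 0] \<beta>(2)[of 0] by simp
    have notin: "\<phi> \<beta> \<notin> \<Omega>"
    proof
      assume "\<phi> \<beta> \<in> \<Omega>"
      then obtain h \<xi> where "h > 0" and \<xi>: "\<xi> 0 = \<phi> \<beta>" "\<xi> h \<in> \<Omega>" "L-lipschitz_on UNIV \<xi>"
        "\<And>t. t \<in> {0..<h} \<Longrightarrow> Q (\<lambda>s. \<xi> (t + s))"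
        using step by blast
      \<comment> \<open>the concatenation of \<open>\<phi>\<close> and \<open>\<xi>\<close> at time \<open>\<beta>\<close>; clamping the arguments keeps it Lipschitz on the whole line\<close>
      define \<omega> where "\<omega> t = \<phi> (min t \<beta>) + (\<xi> (max 0 (min h (t - \<beta>))) - \<xi> 0)" for t
      have left: "\<omega> t = \<phi> t" if "t \<le> \<beta>" for t
        using that \<open>h > 0\<close> by (auto simp: \<omega>_def max_def min_def)
      have right: "\<omega> t = \<xi> (t - \<beta>)" if "\<beta> \<le> t" "t \<le> \<beta> + h" for t
      proof -
        have "max 0 (min h (t - \<beta>)) = t - \<beta>" "min t \<beta> = \<beta>" using that by auto
        then show ?thesis using \<xi>(1) by (simp add: \<omega>_def)
      qed
      have const: "\<omega> t = \<xi> h" if "\<beta> + h \<le> t" for t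
      proof -
        have "max 0 (min h (t - \<beta>)) = h" "min t \<beta> = \<beta>" using that \<open>h > 0\<close> by auto
        then show ?thesis using \<xi>(1) by (simp add: \<omega>_def)
      qed
      have aux: "dist (\<omega> t) (\<omega> u) \<le> L * (u - t)" if "t \<le> u" for t u
      proof -
        let ?m = "\<lambda>t. min t \<beta>" and ?c = "\<lambda>t. max 0 (min h (t - \<beta>))"
        have "dist (\<omega> t) (\<omega> u) \<le> dist (\<phi> (?m t)) (\<phi> (?m u)) + dist (\<xi> (?c t)) (\<xi> (?c u))"
          unfolding \<omega>_def by (rule order_trans[OF dist_triangle_add]) (simp add: dist_norm)
        also have "\<dots> \<le> L * dist (?m t) (?m u) + L * dist (?c t) (?c u)"
          using lipschitz_onD[OF lip, of "?m t" "?m u"] lipschitz_onD[OF \<xi>(3), of "?c t" "?c u"]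
          by simp
        also have "\<dots> = L * (dist (?m t) (?m u) + dist (?c t) (?c u))"
          by (simp add: algebra_simps)
        also have "\<dots> \<le> L * (u - t)"
          using that \<open>0 \<le> L\<close> \<open>h > 0\<close> by (intro mult_left_mono) (auto simp: dist_real_def)
        finally show ?thesis .
      qed
      have "L-lipschitz_on UNIV \<omega>"
      proof (rule lipschitz_onI)
        show "dist (\<omega> t) (\<omega> u) \<le> L * dist t u" for t u
          using aux[of t u] aux[of u t] by (cases "t \<le> u") (auto simp: dist_commute dist_real_def)
      qed fact
      moreover have "Q (\<lambda>s. \<omega> (t + s))" if "0 \<le> t" "t < \<beta> + h" for t
      proof (cases "t < \<beta>")
        case True
        show ?thesis
          by (rule local[OF Q\<beta>[OF that(1) True], of "\<beta> - t"]) (use True left in auto)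
      next
        case False
        with that have "t - \<beta> \<in> {0..<h}" by auto
        then show ?thesis
          by (rule local[OF \<xi>(4), of _ "\<beta> + h - t"]) (use that False right in \<open>auto simp: algebra_simps\<close>)
      qed
      ultimately have mem: "(\<beta> + h, \<omega>) \<in> \<P>"
        using \<open>0 \<le> \<beta>\<close> \<open>h > 0\<close> left[of 0] \<open>\<phi> 0 = x\<close> const const[of "\<beta> + h"] \<xi>(2)
        unfolding \<P>_def mem_Collect_eq prod.case by (auto intro: const)
      \<comment> \<open>The concatenated path exceeds every stage by at least \<open>h\<close>, so
        each greedy choice gains at least half of \<open>min h 1\<close>. The gains of a convergent
        sequence tend to 0, which is the contradiction.\<close>
      have "min h 1 \<le> 2 * (b (Suc n) - b n)" for n
      proof -
        have "extends_path (\<sigma> n) (\<beta> + h, \<omega>)"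
          unfolding extends_path_def
        proof (intro conjI allI impI)
          show "fst (\<sigma> n) \<le> fst (\<beta> + h, \<omega>)"
            using \<beta>(2)[of n] \<open>h > 0\<close> by (simp add: b_def)
          fix t assume "t \<le> fst (\<sigma> n)"
          then show "snd (\<beta> + h, \<omega>) t = snd (\<sigma> n) t"
            using \<beta>(2)[of n] \<phi>_eq[of t n] left[of t] by (simp add: b_def \<psi>_def)
        qed
        from greedy[OF mem this] show ?thesis
          using \<beta>(2)[of n] by (auto simp: b_def min_def split: if_splits)
      qed
      moreover have "(\<lambda>n. 2 * (b (Suc n) - b n)) \<longlonglongrightarrow> 2 * (\<beta> - \<beta>)"
        by (intro tendsto_intros \<beta>(1) LIMSEQ_Suc)
      ultimately have "min h 1 \<le> 2 * (\<beta> - \<beta>)"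
        by (intro LIMSEQ_le_const) auto
      then show False using \<open>h > 0\<close> by auto
    qed
    have "\<beta> \<noteq> 0" using notin \<open>\<phi> 0 = x\<close> \<open>x \<in> \<Omega>\<close> by auto
    then have "\<beta> > 0" using \<open>0 \<le> \<beta>\<close> by simp
    show thesis
    proof (rule that[OF \<open>\<phi> 0 = x\<close> lip], intro disjI2 exI conjI ballI)
      show "\<phi> \<beta> \<in> closure \<Omega> - \<Omega>" using cl notin by simp
    qed (use \<open>\<beta> > 0\<close> Q\<beta> in auto)
  qed
qed

section \<open>Viability\<close>


lemma right_quot_linear:
  assumes "v \<in> A" "norm (z - v) \<le> \<delta>"
  shows "right_quot (\<lambda>s. x + (t + s) *\<^sub>R z) {y + e |y e. y \<in> A \<and> norm e \<le> \<delta>}"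
  unfolding right_quot_def
proof (intro allI impI)
  fix \<eta> :: real assume "0 < \<eta>"
  have "\<forall>\<^sub>F h in at_right 0. (0::real) < h"
    by (simp add: eventually_at_right_less)
  then show "\<forall>\<^sub>F h in at_right 0. \<exists>w\<in>{y + e |y e. y \<in> A \<and> norm e \<le> \<delta>}.
    norm ((x + (t + h) *\<^sub>R z - (x + (t + 0) *\<^sub>R z)) /\<^sub>R h - w) < \<eta>"
  proof eventually_elim
    case (elim h)
    have "(x + (t + h) *\<^sub>R z - (x + (t + 0) *\<^sub>R z)) /\<^sub>R h = z"
      using elim by (simp add: scaleR_add_left)
    moreover have "z \<in> {y + e |y e. y \<in> A \<and> norm e \<le> \<delta>}"
      using assms by (intro CollectI exI[of _ v] exI[of _ "z - v"]) auto
    ultimately show ?case using \<open>0 < \<eta>\<close> by (intro bexI[of _ z]) auto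
  qed
qed

text \<open>Euler polygons with vertices in \<open>U\<close>: a tangent vector at \<open>x\<close>
  is a limit of directions towards points \<open>X n\<close> of \<open>U\<close>, so a short segment
  ends in \<open>U\<close> again with direction close to the tangent vector. In between the segment
  may leave \<open>U\<close>; the witness \<open>y\<close> is its initial vertex. Step lengths have
  no lower bound, and \<open>continuation\<close> takes care of their accumulation.\<close>

lemma approximate_viability:
  fixes U :: "'a::euclidean_space set"
  assumes "x0 \<in> U" "0 < r" and closed: "closed (U \<inter> cball x0 r)" and "0 \<le> c" and "0 < \<delta>" "\<delta> \<le> 1"
    and tangent: "\<And>x. x \<in> U \<Longrightarrow> dist x0 x < r \<Longrightarrow> \<exists>v \<in> H x \<inter> bouligand_cone U x. norm v \<le> c"
  obtains \<phi> where "\<phi> 0 = x0" "(c + 1)-lipschitz_on UNIV \<phi>"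
    "\<And>t. 0 \<le> t \<Longrightarrow> (c + 1) * t < r \<Longrightarrow> \<exists>y\<in>U. dist y (\<phi> t) \<le> \<delta> \<and>
      right_quot (\<lambda>s. \<phi> (t + s)) {v + e |v e. v \<in> H y \<inter> cball 0 c \<and> norm e \<le> \<delta>}"
proof -
  define Q where "Q f \<longleftrightarrow> (\<exists>y\<in>U. dist y (f 0) \<le> \<delta> \<and>
      right_quot f {v + e |v e. v \<in> H y \<inter> cball 0 c \<and> norm e \<le> \<delta>})" for f :: "real \<Rightarrow> 'a"
  let ?\<Omega> = "U \<inter> ball x0 r"
  obtain \<phi> where \<phi>: "\<phi> 0 = x0" "(c + 1)-lipschitz_on UNIV \<phi>"
    "(\<forall>t\<ge>0. Q (\<lambda>s. \<phi> (t + s))) \<or>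
     (\<exists>b>0. (\<forall>t\<in>{0..<b}. Q (\<lambda>s. \<phi> (t + s))) \<and> \<phi> b \<in> closure ?\<Omega> - ?\<Omega>)"
  proof (rule continuation[where Q = Q and \<Omega> = ?\<Omega> and L = "c + 1" and x = x0])
    fix f g and d :: real assume "Q f" and "0 < d" and eq: "\<And>s. 0 \<le> s \<Longrightarrow> s < d \<Longrightarrow> f s = g s"
    moreover have "f 0 = g 0" using \<open>0 < d\<close> eq by simp
    ultimately show "Q g" unfolding Q_def
      using right_quot_cong[OF _ \<open>0 < d\<close> eq] by fastforce
  next
    show "x0 \<in> ?\<Omega>" using \<open>x0 \<in> U\<close> \<open>0 < r\<close> by simp
  next
    fix x assume "x \<in> ?\<Omega>"
    then obtain v where v: "v \<in> H x" "v \<in> bouligand_cone U x" "norm v \<le> c"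
      using tangent by force
    then obtain X \<tau> where X: "\<And>n. X n \<in> U" "X \<longlonglongrightarrow> x" and \<tau>: "\<And>n. 0 < \<tau> n" "\<tau> \<longlonglongrightarrow> (0::real)"
      and lim: "(\<lambda>n. (X n - x) /\<^sub>R \<tau> n) \<longlonglongrightarrow> v"
      unfolding bouligand_cone_def by blast
    have "\<forall>\<^sub>F n in sequentially. dist ((X n - x) /\<^sub>R \<tau> n) v < \<delta>"
      using lim \<open>0 < \<delta>\<close> by (rule tendstoD)
    \<comment> \<open>A segment travelled for less than this time at speed at most
      \<open>c + 1\<close> stays within \<delta> of its initial vertex.\<close>
    moreover have "\<forall>\<^sub>F n in sequentially. \<tau> n < \<delta> / (c + 1)"
      using \<open>0 < \<delta>\<close> \<open>0 \<le> c\<close> by (intro order_tendstoD(2)[OF \<tau>(2)]) simp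
    moreover have "\<forall>\<^sub>F n in sequentially. X n \<in> ball x0 r"
      using \<open>x \<in> ?\<Omega>\<close> by (intro topological_tendstoD[OF X(2)]) auto
    ultimately have "\<forall>\<^sub>F n in sequentially. dist ((X n - x) /\<^sub>R \<tau> n) v < \<delta> \<and> \<tau> n < \<delta> / (c + 1) \<and> X n \<in> ball x0 r"
      by eventually_elim simp
    from eventually_happens'[OF sequentially_bot this]
    obtain n where n: "dist ((X n - x) /\<^sub>R \<tau> n) v < \<delta>" "\<tau> n < \<delta> / (c + 1)" "X n \<in> ball x0 r"
      by blast
    define z where "z = (X n - x) /\<^sub>R \<tau> n"
    have z: "norm (z - v) \<le> \<delta>" using n(1) by (simp add: z_def dist_norm)
    have "norm z \<le> norm v + norm (z - v)" by (metis norm_triangle_sub)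
    then have z': "norm z \<le> c + 1" using z v(3) \<open>\<delta> \<le> 1\<close> by linarith
    show "\<exists>h>0. \<exists>\<psi>. \<psi> 0 = x \<and> \<psi> h \<in> ?\<Omega> \<and> (c + 1)-lipschitz_on UNIV \<psi> \<and> (\<forall>t\<in>{0..<h}. Q (\<lambda>s. \<psi> (t + s)))"
    proof (intro exI[of _ "\<tau> n"] exI[of _ "\<lambda>t. x + t *\<^sub>R z"] conjI ballI)
      show "x + \<tau> n *\<^sub>R z \<in> ?\<Omega>" using X(1) n(3) \<tau>(1)[of n] by (simp add: z_def)
      show "(c + 1)-lipschitz_on UNIV (\<lambda>t. x + t *\<^sub>R z)"
      proof (rule lipschitz_onI)
        fix s t :: real
        have "dist (x + s *\<^sub>R z) (x + t *\<^sub>R z) = norm z * \<bar>s - t\<bar>"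
          by (simp add: dist_norm flip: scaleR_diff_left)
        also have "\<dots> \<le> (c + 1) * \<bar>s - t\<bar>" using z' by (rule mult_right_mono) simp
        finally show "dist (x + s *\<^sub>R z) (x + t *\<^sub>R z) \<le> (c + 1) * dist s t" by (simp add: dist_real_def)
      qed (use \<open>0 \<le> c\<close> in simp)
      fix t assume t: "t \<in> {0..<\<tau> n}"
      have "norm z * t \<le> (c + 1) * (\<delta> / (c + 1))"
        using t z' n(2) \<open>0 \<le> c\<close> by (intro mult_mono) auto
      then have "dist x (x + t *\<^sub>R z) \<le> \<delta>" using t \<open>0 \<le> c\<close> by (simp add: dist_norm mult.commute)
      moreover have "right_quot (\<lambda>s. x + (t + s) *\<^sub>R z) {v + e |v e. v \<in> H x \<inter> cball 0 c \<and> norm e \<le> \<delta>}"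
        by (rule right_quot_linear[OF _ z]) (use v in simp)
      ultimately show "Q (\<lambda>s. x + (t + s) *\<^sub>R z)"
        unfolding Q_def using \<open>x \<in> ?\<Omega>\<close> by auto
    qed (use \<tau> in auto)
  qed (use that in blast)
  show thesis
  proof (rule that[OF \<phi>(1,2)])
    fix t :: real assume t: "0 \<le> t" "(c + 1) * t < r"
    from \<phi>(3) have "Q (\<lambda>s. \<phi> (t + s))"
    proof
      assume "\<exists>b>0. (\<forall>t\<in>{0..<b}. Q (\<lambda>s. \<phi> (t + s))) \<and> \<phi> b \<in> closure ?\<Omega> - ?\<Omega>"
      then obtain b where b: "b > 0" "\<And>t. t \<in> {0..<b} \<Longrightarrow> Q (\<lambda>s. \<phi> (t + s))"
        "\<phi> b \<in> closure ?\<Omega>" "\<phi> b \<notin> ?\<Omega>" by blast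
      \<comment> \<open>Closedness of \<open>U\<close> inside the ball leaves the sphere as the only
        place where the polygon can stop, and at speed \<open>c + 1\<close> the sphere is not
        reached before time \<open>r / (c + 1)\<close>.\<close>
      have "closure ?\<Omega> \<subseteq> U \<inter> cball x0 r"
        by (rule closure_minimal[OF _ closed]) auto
      then have "r \<le> dist x0 (\<phi> b)" using b(3,4) by auto
      also have "\<dots> \<le> (c + 1) * b"
        using lipschitz_onD[OF \<phi>(2), of 0 b] \<phi>(1) b(1) by (simp add: dist_real_def)
      finally have "(c + 1) * t < (c + 1) * b" using t by simp
      then show ?thesis using b(2) t(1) \<open>0 \<le> c\<close> by simp
    qed (use t in simp)
    then show "\<exists>y\<in>U. dist y (\<phi> t) \<le> \<delta> \<and>
      right_quot (\<lambda>s. \<phi> (t + s)) {v + e |v e. v \<in> H y \<inter> cball 0 c \<and> norm e \<le> \<delta>}"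
      by (simp add: Q_def)
  qed
qed

text \<open>The polygons for \<delta> = 1/(k+1) have a convergent subsequence, and their vertices
  carry membership in \<open>U\<close> to the limit. Velocities are described through an arbitrary
  closed convex \<open>C\<close>, so that one path can later be tested both against neighbourhoods
  of the values of \<open>G U\<close> and against half-spaces of the gradient of
  \<open>w\<close>.\<close>

lemma viability:
  fixes U :: "'a::euclidean_space set"
  assumes "x0 \<in> U" "0 < r" and closed: "closed (U \<inter> cball x0 r)" and "0 \<le> c"
    and tangent: "\<And>x. x \<in> U \<Longrightarrow> dist x0 x < r \<Longrightarrow> \<exists>v \<in> H x \<inter> bouligand_cone U x. norm v \<le> c"
  obtains T \<phi> where "0 < T" "\<phi> 0 = x0" "(c + 1)-lipschitz_on UNIV \<phi>"
    "\<And>t. 0 \<le> t \<Longrightarrow> t \<le> T \<Longrightarrow> \<phi> t \<in> U"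
    "\<And>t C \<rho>. 0 \<le> t \<Longrightarrow> t < T \<Longrightarrow> convex C \<Longrightarrow> closed C \<Longrightarrow> 0 < \<rho> \<Longrightarrow>
      (\<And>y. y \<in> U \<Longrightarrow> dist y (\<phi> t) < \<rho> \<Longrightarrow> H y \<inter> cball 0 c \<subseteq> C) \<Longrightarrow>
      \<forall>\<^sub>F s in at_right 0. (\<phi> (t + s) - \<phi> t) /\<^sub>R s \<in> C"
proof -
  let ?\<delta> = "\<lambda>k::nat. inverse (real (Suc k))"
  have "\<exists>\<psi>. \<psi> 0 = x0 \<and> (c + 1)-lipschitz_on UNIV \<psi> \<and>
    (\<forall>t\<ge>0. (c + 1) * t < r \<longrightarrow> (\<exists>y\<in>U. dist y (\<psi> t) \<le> ?\<delta> k \<and>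
      right_quot (\<lambda>s. \<psi> (t + s)) {v + e |v e. v \<in> H y \<inter> cball 0 c \<and> norm e \<le> ?\<delta> k}))" (is "\<exists>\<psi>. ?P k \<psi>") for k
  proof (rule approximate_viability[OF assms(1-4) _ _ tangent, of "?\<delta> k"])
    show "0 < ?\<delta> k" "?\<delta> k \<le> 1" by (simp_all add: field_simps)
  qed blast+
  then have "\<exists>\<psi>. \<forall>k. ?P k (\<psi> k)" by (intro choice allI)
  then obtain \<psi> where \<psi>0: "\<And>k. \<psi> k 0 = x0" and \<psi>_lip: "\<And>k. (c + 1)-lipschitz_on UNIV (\<psi> k)"
    and \<psi>: "\<And>k t. 0 \<le> t \<Longrightarrow> (c + 1) * t < r \<Longrightarrow> \<exists>y\<in>U. dist y (\<psi> k t) \<le> ?\<delta> k \<and>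
      right_quot (\<lambda>s. \<psi> k (t + s)) {v + e |v e. v \<in> H y \<inter> cball 0 c \<and> norm e \<le> ?\<delta> k}"
    by blast
  obtain q \<phi> where q: "strict_mono q" and lip: "(c + 1)-lipschitz_on UNIV \<phi>"
    and lim: "\<And>t. (\<lambda>k. \<psi> (q k) t) \<longlonglongrightarrow> \<phi> t"
    using lipschitz_convergent_subsequence[where \<psi> = \<psi> and L = "c + 1" and M = "norm x0"] \<psi>_lip \<psi>0 by auto
  have \<delta>0: "(\<lambda>k. ?\<delta> (q k)) \<longlonglongrightarrow> 0"
    using LIMSEQ_subseq_LIMSEQ[OF LIMSEQ_inverse_real_of_nat q] by (simp add: o_def)
  have "\<phi> 0 = x0" using lim[of 0] by (simp add: \<psi>0 LIMSEQ_const_iff)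
  have mem: "\<phi> t \<in> U" if t: "0 \<le> t" "(c + 1) * t < r" for t
  proof -
    have "\<exists>y. y \<in> U \<and> dist y (\<psi> (q k) t) \<le> ?\<delta> (q k)" for k
      using \<psi>[OF t] by blast
    then obtain y where y: "\<And>k. y k \<in> U" "\<And>k. dist (y k) (\<psi> (q k) t) \<le> ?\<delta> (q k)" by metis
    have "(\<lambda>k. dist (y k) (\<psi> (q k) t)) \<longlonglongrightarrow> 0"
      by (rule tendsto_sandwich[OF _ _ tendsto_const \<delta>0]) (use y(2) in auto)
    then have "(\<lambda>k. y k - \<psi> (q k) t) \<longlonglongrightarrow> 0"
      by (simp add: dist_norm tendsto_norm_zero_iff)
    then have y_lim: "y \<longlonglongrightarrow> \<phi> t"
      using tendsto_add[OF _ lim[of t]] by fastforce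
    have "dist x0 (\<phi> t) \<le> (c + 1) * t"
      using lipschitz_onD[OF lip, of 0 t] t \<open>\<phi> 0 = x0\<close> by (simp add: dist_real_def)
    then have "\<forall>\<^sub>F k in sequentially. y k \<in> ball x0 r"
      using t by (intro topological_tendstoD[OF y_lim]) auto
    then have "\<forall>\<^sub>F k in sequentially. y k \<in> U \<inter> cball x0 r"
      by eventually_elim (use y(1) in auto)
    then show ?thesis
      using Lim_in_closed_set[OF closed _ sequentially_bot y_lim] by blast
  qed
  \<comment> \<open>Half of the time needed to reach the sphere keeps \<open>(c + 1) * T\<close>
    strictly below \<open>r\<close>, so that the end time \<open>T\<close> itself is
    covered.\<close>
  define T where "T = r / (2 * (c + 1))"
  have cancel: "(c + 1) * (a / (k * (c + 1))) = a / k" for a k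
    using \<open>0 \<le> c\<close> nonzero_mult_divide_mult_cancel_left[of "c + 1" a k] by (simp add: mult.commute)
  have "(c + 1) * T = r / 2" by (simp only: T_def cancel)
  then have T: "T > 0" "(c + 1) * T < r" using \<open>0 < r\<close> \<open>0 \<le> c\<close> by (auto simp: T_def)
  have T': "(c + 1) * t < r" if "t \<le> T" for t
  proof -
    have "(c + 1) * t \<le> (c + 1) * T" using that \<open>0 \<le> c\<close> by (intro mult_left_mono) auto
    then show ?thesis using T by simp
  qed
  show thesis
  proof (rule that[OF T(1) \<open>\<phi> 0 = x0\<close> lip])
    show "\<phi> t \<in> U" if "0 \<le> t" "t \<le> T" for t using mem[OF that(1)] T'[OF that(2)] by simp
    fix t \<rho> :: real and C :: "'a set"
    assume t: "0 \<le> t" "t < T" and C: "convex C" "closed C" and "0 < \<rho>"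
      and HC: "\<And>y. y \<in> U \<Longrightarrow> dist y (\<phi> t) < \<rho> \<Longrightarrow> H y \<inter> cball 0 c \<subseteq> C"
    \<comment> \<open>Three distances of about \<open>\<rho> / 4\<close> have to add up to less than
      \<rho>: from the vertex to the polygon, along the polygon from \<open>u\<close> back to
      \<open>t\<close>, and from the polygon to the limit at \<open>t\<close>.\<close>
    define d where "d = min (T - t) (\<rho> / (4 * (c + 1)))"
    have d: "d > 0" "d \<le> T - t" "(c + 1) * d \<le> \<rho> / 4"
    proof -
      have "(c + 1) * d \<le> (c + 1) * (\<rho> / (4 * (c + 1)))"
        using \<open>0 \<le> c\<close> by (intro mult_left_mono) (auto simp: d_def)
      also have "\<dots> = \<rho> / 4" by (rule cancel)
      finally show "(c + 1) * d \<le> \<rho> / 4" .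
    qed (use t \<open>0 < \<rho>\<close> \<open>0 \<le> c\<close> in \<open>auto simp: d_def\<close>)
    have in_C: "(\<phi> (t + s) - \<phi> t) /\<^sub>R s \<in> C" if s: "0 < s" "s < d" for s
    proof -
      \<comment> \<open>Polygon velocities lie in \<open>C\<close> only up to a small error. The
        mean value theorem is applied to the sum of \<open>C\<close> and a small ball, and
        closedness of \<open>C\<close> then removes the ball.\<close>
      have near: "\<exists>x\<in>C. dist x ((\<phi> (t + s) - \<phi> t) /\<^sub>R s) < e" if "0 < e" for e
      proof -
        let ?C = "{x + y |x y. x \<in> C \<and> y \<in> cball 0 (e / 2)}"
        have "(\<phi> (t + s) - \<phi> t) /\<^sub>R ((t + s) - t) \<in> ?C"
        proof (rule right_quot_mean_value_limit[where \<psi> = "\<lambda>k. \<psi> (q k)"])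
          have "?C = (\<Union>x\<in>C. \<Union>y\<in>cball 0 (e / 2). {x + y})" by blast
          then show "convex ?C" "closed ?C"
            using convex_sums[OF C(1) convex_cball, of 0 "e / 2"]
              closed_compact_sums[OF C(2) compact_cball, of 0 "e / 2"] by simp_all
          have "\<forall>\<^sub>F k in sequentially. ?\<delta> (q k) < min (\<rho> / 4) (e / 2)"
            by (rule order_tendstoD(2)[OF \<delta>0]) (use \<open>0 < \<rho>\<close> \<open>0 < e\<close> in simp)
          moreover have "\<forall>\<^sub>F k in sequentially. dist (\<psi> (q k) t) (\<phi> t) < \<rho> / 4"
            by (rule tendstoD[OF lim]) (use \<open>0 < \<rho>\<close> in simp)
          ultimately have "\<forall>\<^sub>F k in sequentially. \<forall>u\<in>{t..<t + s}. right_quot (\<lambda>h. \<psi> (q k) (u + h)) ?C"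
          proof eventually_elim
            case (elim k)
            show ?case
            proof
              fix u assume u: "u \<in> {t..<t + s}"
              obtain y where y: "y \<in> U" "dist y (\<psi> (q k) u) \<le> ?\<delta> (q k)"
                "right_quot (\<lambda>h. \<psi> (q k) (u + h)) {v + e |v e. v \<in> H y \<inter> cball 0 c \<and> norm e \<le> ?\<delta> (q k)}"
                using \<psi>[of u "q k"] T'[of u] u t s d by auto
              have "dist (\<psi> (q k) u) (\<psi> (q k) t) \<le> (c + 1) * d"
              proof -
                have "(c + 1) * dist u t \<le> (c + 1) * d"
                  using u s \<open>0 \<le> c\<close> by (intro mult_left_mono) (auto simp: dist_real_def)
                then show ?thesis using lipschitz_onD[OF \<psi>_lip, of u t "q k"] by simp
              qed
              then have "dist (\<psi> (q k) u) (\<psi> (q k) t) \<le> \<rho> / 4" using d(3) by (rule order_trans)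
              moreover have "dist y (\<psi> (q k) u) < \<rho> / 4" using y(2) elim(1) by (simp add: min_less_iff_conj)
              ultimately have "dist y (\<phi> t) < \<rho>"
                using \<open>0 < \<rho>\<close> elim(2) dist_triangle[of y "\<phi> t" "\<psi> (q k) u"]
                  dist_triangle[of "\<psi> (q k) u" "\<phi> t" "\<psi> (q k) t"] by linarith
              then have "H y \<inter> cball 0 c \<subseteq> C" using HC y(1) by blast
              then show "right_quot (\<lambda>h. \<psi> (q k) (u + h)) ?C"
                using elim by (intro right_quot_mono[OF y(3)]) fastforce
            qed
          qed
          then show "\<exists>\<^sub>F k in sequentially. \<forall>u\<in>{t..<t + s}. right_quot (\<lambda>h. \<psi> (q k) (u + h)) ?C"
            by (rule eventually_frequently[OF sequentially_bot])
        qed (use lim lipschitz_on_continuous_on[OF \<psi>_lip] s in auto)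
        then obtain x y where "(\<phi> (t + s) - \<phi> t) /\<^sub>R s = x + y" "x \<in> C" "norm y \<le> e / 2" by auto
        then show ?thesis using \<open>0 < e\<close> by (intro bexI[of _ x]) (auto simp: dist_norm)
      qed
      then show ?thesis using C(2) by (metis closed_approachable)
    qed
    have "\<forall>\<^sub>F s in at_right 0. s \<in> {0<..<d}" by (rule eventually_at_right_real) fact
    then show "\<forall>\<^sub>F s in at_right 0. (\<phi> (t + s) - \<phi> t) /\<^sub>R s \<in> C"
      by eventually_elim (use in_C in simp)
  qed
qed

section \<open>Relatively open partitions\<close>


lemma relatively_open_partition_disjoint:
  assumes "relatively_open_partition X (\<alpha>0, U)" "\<alpha> < \<alpha>0" "\<beta> < \<alpha>0" "x \<in> U \<alpha>" "x \<in> U \<beta>"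
  shows "\<alpha> = \<beta>"
proof -
  have "\<not> \<gamma> < \<delta>" if "\<delta> < \<alpha>0" "x \<in> U \<gamma>" "x \<in> U \<delta>" for \<gamma> \<delta>
    using assms(1) that unfolding relatively_open_partition_def by blast
  then show ?thesis using assms(2-5) by (meson linorder_neqE)
qed

text \<open>A member is the trace of an open \<open>T\<close> outside the union \<open>?V\<close> of
  its predecessors, so together with \<open>?V\<close> it is \<open>T \<union> ?V\<close>, open by
  induction.\<close>

lemma relatively_open_partition_openin_UN:
  assumes P: "relatively_open_partition X (\<alpha>0, U)" and "\<alpha> \<le> \<alpha>0"
  shows "openin X (\<Union>\<gamma>\<in>{..<\<alpha>}. U \<gamma>)"
  using \<open>\<alpha> \<le> \<alpha>0\<close>
proof (induction \<alpha> rule: less_induct)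
  case (less \<alpha>)
  have "openin X (U \<gamma> \<union> (\<Union>\<delta>\<in>{..<\<gamma>}. U \<delta>))" if "\<gamma> < \<alpha>" for \<gamma>
  proof -
    let ?V = "\<Union>\<delta>\<in>{..<\<gamma>}. U \<delta>"
    have V: "openin X ?V" using less that by simp
    have "\<gamma> < \<alpha>0" using that less.prems by simp
    then have "openin (subtopology X (topspace X - ?V)) (U \<gamma>)"
      using P by (auto simp: relatively_open_partition_def)
    then obtain T where T: "openin X T" "U \<gamma> = T \<inter> (topspace X - ?V)"
      by (auto simp: openin_subtopology)
    then have "U \<gamma> \<union> ?V = T \<union> ?V"
      using openin_subset[OF T(1)] by blast
    then show ?thesis using T(1) V by (simp add: openin_Un)
  qed
  then have "openin X (\<Union>\<gamma>\<in>{..<\<alpha>}. U \<gamma> \<union> (\<Union>\<delta>\<in>{..<\<gamma>}. U \<delta>))"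
    by (intro openin_clauses(3)) auto
  moreover have "(\<Union>\<gamma>\<in>{..<\<alpha>}. U \<gamma> \<union> (\<Union>\<delta>\<in>{..<\<gamma>}. U \<delta>)) = (\<Union>\<gamma>\<in>{..<\<alpha>}. U \<gamma>)"
    by (fastforce intro: less_trans)
  ultimately show ?case by simp
qed

text \<open>In a small closed ball around \<open>x\<close> the open conditions defining the member
  hold automatically; what remains is \<open>K\<close> minus the open set that cuts out the
  predecessors. This local closedness is what \<open>viability\<close> asks of a green set.\<close>

lemma relatively_open_partition_member_locally_closed:
  fixes U :: "'i::wellorder \<Rightarrow> 'a::euclidean_space set"
  assumes "open S" "closed K" and P: "relatively_open_partition (top_of_set (S \<inter> K)) (\<alpha>0, U)"
    and "\<alpha> < \<alpha>0" "x \<in> U \<alpha>"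
  obtains r where "0 < r" "closed (U \<alpha> \<inter> cball x r)"
proof -
  let ?D = "S \<inter> K" and ?V = "\<Union>\<delta>\<in>{..<\<alpha>}. U \<delta>"
  have "openin (top_of_set ?D) ?V"
    using relatively_open_partition_openin_UN[OF P] \<open>\<alpha> < \<alpha>0\<close> by simp
  then obtain V where V: "open V" "?V = ?D \<inter> V" by (auto simp: openin_open)
  have "openin (subtopology (top_of_set ?D) (?D - ?V)) (U \<alpha>)"
    using P \<open>\<alpha> < \<alpha>0\<close> by (auto simp: relatively_open_partition_def)
  then obtain T where T: "open T" "U \<alpha> = ?D \<inter> T \<inter> (?D - ?V)"
    by (auto simp: openin_subtopology openin_open)
  have "x \<in> T \<inter> S" "open (T \<inter> S)" using \<open>x \<in> U \<alpha>\<close> T \<open>open S\<close> by auto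
  then obtain r where r: "r > 0" "cball x r \<subseteq> T \<inter> S"
    by (meson open_contains_cball)
  have "U \<alpha> \<inter> cball x r = (K - V) \<inter> cball x r"
    using T(2) V(2) r(2) by auto
  then show thesis
    using that[OF r(1)] \<open>closed K\<close> V(1) by (simp add: closed_Diff closed_Int)
qed

text \<open>The union of the members before \<alpha> is open in \<open>D\<close>, so the times spent
  outside it form a closed set. Persistence to the right extends that set beyond each of its times,
  because members are disjoint; hence the path never falls back to a smaller index.\<close>

lemma relatively_open_partition_index_mono:
  fixes U :: "'i::wellorder \<Rightarrow> 'a::euclidean_space set" and \<phi> :: "real \<Rightarrow> 'a"
  assumes P: "relatively_open_partition (top_of_set D) (\<alpha>0, U)"
    and cont: "continuous_on {a..b} \<phi>" and D: "\<phi> ` {a..b} \<subseteq> D" and "a \<le> b"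
    and right: "\<And>s. a \<le> s \<Longrightarrow> s < b \<Longrightarrow> \<exists>\<alpha><\<alpha>0. \<exists>\<delta>>0. \<forall>u\<in>{s..<s + \<delta>}. \<phi> u \<in> U \<alpha>"
    and "\<alpha> < \<alpha>0" "\<phi> a \<in> U \<alpha>" "\<phi> b \<in> U \<beta>"
  shows "\<alpha> \<le> \<beta>"
proof -
  let ?V = "\<Union>\<delta>\<in>{..<\<alpha>}. U \<delta>"
  have "openin (top_of_set D) ?V"
    using relatively_open_partition_openin_UN[OF P] \<open>\<alpha> < \<alpha>0\<close> by simp
  then obtain V where V: "open V" "?V = D \<inter> V" by (auto simp: openin_open)
  have "b \<in> {s\<in>{a..b}. \<phi> s \<in> - V}"
  proof (rule right_extendable_closed_mem)
    show "closed {s\<in>{a..b}. \<phi> s \<in> - V}"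
      using continuous_closed_preimage[OF cont, of "- V"] V(1) by (auto simp: vimage_def Int_def)
    show "a \<in> {s\<in>{a..b}. \<phi> s \<in> - V}"
    proof -
      have "\<phi> a \<notin> ?V"
      proof
        assume "\<phi> a \<in> ?V"
        then obtain \<beta>' where "\<beta>' < \<alpha>" "\<phi> a \<in> U \<beta>'" by auto
        then show False
          using relatively_open_partition_disjoint[OF P \<open>\<alpha> < \<alpha>0\<close> _ \<open>\<phi> a \<in> U \<alpha>\<close>, of \<beta>'] \<open>\<alpha> < \<alpha>0\<close>
          by (auto dest: less_trans)
      qed
      moreover have "\<phi> a \<in> D" using D \<open>a \<le> b\<close> by (simp add: image_subset_iff)
      ultimately show ?thesis using V \<open>a \<le> b\<close> by auto
    qed
    fix s assume s: "s \<in> {s\<in>{a..b}. \<phi> s \<in> - V}" "a \<le> s" "s < b"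
    obtain \<gamma> \<delta> where \<gamma>: "\<gamma> < \<alpha>0" "\<delta> > 0" "\<And>u. u \<in> {s..<s + \<delta>} \<Longrightarrow> \<phi> u \<in> U \<gamma>"
      using right[OF s(2,3)] by blast
    have "\<phi> s \<in> U \<gamma>" using \<gamma> by simp
    have "\<phi> s \<notin> ?V" unfolding V(2) using s by blast
    with \<open>\<phi> s \<in> U \<gamma>\<close> have "\<alpha> \<le> \<gamma>" by (meson UN_I lessThan_iff not_le)
    define u where "u = min b (s + \<delta> / 2)"
    have u: "s < u" "u \<le> b" "u \<in> {s..<s + \<delta>}" using s \<gamma>(2) by (auto simp: u_def)
    have "\<phi> u \<notin> ?V"
    proof
      assume "\<phi> u \<in> ?V"
      then obtain \<delta>' where "\<delta>' < \<alpha>" "\<phi> u \<in> U \<delta>'" by auto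
      then show False
        using relatively_open_partition_disjoint[OF P _ \<open>\<gamma> < \<alpha>0\<close> _ \<gamma>(3)[OF u(3)], of \<delta>']
          \<open>\<alpha> \<le> \<gamma>\<close> \<open>\<alpha> < \<alpha>0\<close> by simp
    qed
    moreover have "\<phi> u \<in> D" using D u s by (simp add: image_subset_iff)
    ultimately show "\<exists>u\<in>{s\<in>{a..b}. \<phi> s \<in> - V}. s < u \<and> u \<le> b"
      using V u s by (intro bexI[of _ u]) auto
  qed fact
  then have "\<phi> b \<notin> ?V" unfolding V(2) by blast
  then show ?thesis using \<open>\<phi> b \<in> U \<beta>\<close> by (meson UN_I lessThan_iff not_le)
qed

text \<open>A discrete form of Helly's selection theorem: monotone step functions whose values lie in a
  fixed finite set are, near almost every point, infinitely often equal to one constant.\<close>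

lemma frequently_locally_constant_ae:
  fixes r :: "nat \<Rightarrow> real \<Rightarrow> 'i::linorder"
  assumes "finite A"
    and ev: "\<forall>\<^sub>F k in sequentially. r k ` {a<..<b} \<subseteq> A \<and> mono_on {a<..<b} (r k)"
  obtains N where "negligible N"
    "\<And>s. s \<in> {a<..<b} - N \<Longrightarrow> \<exists>\<alpha>\<in>A. \<exists>\<eta>>0. {s - \<eta><..<s + \<eta>} \<subseteq> {a<..<b} \<and>
      (\<exists>\<^sub>F k in sequentially. \<forall>u\<in>{s - \<eta><..<s + \<eta>}. r k u = \<alpha>)"
proof -
  let ?freq = "\<lambda>s \<alpha>. \<exists>\<^sub>F k in sequentially. r k s = \<alpha>"
  \<comment> \<open>By monotonicity infinitely many of the functions are at least \<alpha> at
    \<open>t\<close> too, and since \<open>A\<close> is finite, infinitely many of them share one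
    value there.\<close>
  have upper: "\<exists>\<beta>\<in>A. \<alpha> \<le> \<beta> \<and> ?freq t \<beta>"
    if st: "s \<in> {a<..<b}" "t \<in> {a<..<b}" "s \<le> t" and "\<exists>\<^sub>F k in sequentially. \<alpha> \<le> r k s" for s t \<alpha>
  proof -
    have "\<exists>\<^sub>F k in sequentially. \<alpha> \<le> r k s \<and> (r k ` {a<..<b} \<subseteq> A \<and> mono_on {a<..<b} (r k))"
      using frequently_eventually_conj[OF that(4) ev] by (simp add: conj_commute)
    then have "\<exists>\<^sub>F k in sequentially. \<exists>\<beta>\<in>A. r k t = \<beta> \<and> \<alpha> \<le> \<beta>"
    proof (rule frequently_elim1)
      fix k assume k: "\<alpha> \<le> r k s \<and> (r k ` {a<..<b} \<subseteq> A \<and> mono_on {a<..<b} (r k))"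
      then have "r k s \<le> r k t" using st by (auto elim: mono_onD)
      then show "\<exists>\<beta>\<in>A. r k t = \<beta> \<and> \<alpha> \<le> \<beta>" using k st by (intro bexI[of _ "r k t"]) auto
    qed
    then have "\<exists>\<beta>\<in>A. \<exists>\<^sub>F k in sequentially. r k t = \<beta> \<and> \<alpha> \<le> \<beta>"
      unfolding frequently_bex_finite_distrib[OF \<open>finite A\<close>] .
    then obtain \<beta> where "\<beta> \<in> A" and fr: "\<exists>\<^sub>F k in sequentially. r k t = \<beta> \<and> \<alpha> \<le> \<beta>" by blast
    have "\<alpha> \<le> \<beta>" using frequently_ex[OF fr] by blast
    moreover have "?freq t \<beta>" using fr by (rule frequently_elim1) simp
    ultimately show ?thesis using \<open>\<beta> \<in> A\<close> by blast
  qed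
  \<comment> \<open>The largest value taken infinitely often at \<open>s\<close>. It plays the role
    of Helly's limit function and is monotone in \<open>s\<close> by \<open>upper\<close>.\<close>
  define c where "c s = Max {\<alpha>\<in>A. ?freq s \<alpha>}" for s
  have fin: "finite {\<alpha>\<in>A. ?freq s \<alpha>}" for s using \<open>finite A\<close> by simp
  have c: "c s \<in> A" "?freq s (c s)" if "s \<in> {a<..<b}" for s
  proof -
    have "\<forall>\<^sub>F k in sequentially. \<exists>\<alpha>\<in>A. r k s = \<alpha>"
      using ev by eventually_elim (use that in auto)
    then have "\<exists>\<^sub>F k in sequentially. \<exists>\<alpha>\<in>A. r k s = \<alpha>"
      by (rule eventually_frequently[OF sequentially_bot])
    then have "{\<alpha>\<in>A. ?freq s \<alpha>} \<noteq> {}"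
      unfolding frequently_bex_finite_distrib[OF \<open>finite A\<close>] by blast
    then have "c s \<in> {\<alpha>\<in>A. ?freq s \<alpha>}" unfolding c_def by (intro Max_in fin)
    then show "c s \<in> A" "?freq s (c s)" by auto
  qed
  have c_max: "\<alpha> \<le> c s" if "\<alpha> \<in> A" "?freq s \<alpha>" for \<alpha> s
    unfolding c_def using that by (intro Max_ge fin) simp
  have c_mono: "c s \<le> c t" if st: "s \<in> {a<..<b}" "t \<in> {a<..<b}" "s \<le> t" for s t
  proof -
    have "\<exists>\<^sub>F k in sequentially. c s \<le> r k s" using c(2)[OF st(1)] by (rule frequently_elim1) simp
    then obtain \<beta> where "\<beta> \<in> A" "c s \<le> \<beta>" "?freq t \<beta>" using upper[OF st] by blast
    then show ?thesis using c_max order_trans by blast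
  qed
  \<comment> \<open>Level sets of a monotone function are intervals; the end points of those with
    level in the finite set \<open>A\<close> form the exceptional set.\<close>
  define L where "L \<alpha> = {s\<in>{a<..<b}. c s = \<alpha>}" for \<alpha>
  have conv: "convex (L \<alpha>)" for \<alpha>
    unfolding is_interval_convex_1[symmetric] is_interval_1
  proof (intro ballI allI impI)
    fix s t u assume "s \<in> L \<alpha>" "t \<in> L \<alpha>" "s \<le> u \<and> u \<le> t"
    then have st: "s \<in> {a<..<b}" "t \<in> {a<..<b}" "u \<in> {a<..<b}" "s \<le> u" "u \<le> t"
      and "c s = \<alpha>" "c t = \<alpha>" by (auto simp: L_def)
    moreover have "c s \<le> c u" "c u \<le> c t" using st by (intro c_mono; simp)+
    ultimately show "u \<in> L \<alpha>" by (simp add: L_def)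
  qed
  show thesis
  proof
    show "negligible (\<Union>\<alpha>\<in>A. frontier (L \<alpha>))"
      using \<open>finite A\<close> conv by (intro negligible_Union) (auto intro: negligible_convex_frontier)
    fix s assume s: "s \<in> {a<..<b} - (\<Union>\<alpha>\<in>A. frontier (L \<alpha>))"
    have "c s \<in> A" using c s by simp
    moreover have "s \<in> L (c s)" using s by (simp add: L_def)
    ultimately have "s \<in> interior (L (c s))"
      using s by (auto simp: frontier_def dest: subsetD[OF closure_subset])
    then obtain e where e: "e > 0" "ball s e \<subseteq> L (c s)" by (meson mem_interior)
    define \<eta> where "\<eta> = e / 2"
    have "s - \<eta> \<in> L (c s)" "s + \<eta> \<in> L (c s)" "\<eta> > 0"
      using e by (auto simp: \<eta>_def dist_real_def subset_iff)
    then have ends: "s - \<eta> \<in> {a<..<b}" "s + \<eta> \<in> {a<..<b}" "c (s - \<eta>) = c s" "c (s + \<eta>) = c s"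
      by (auto simp: L_def)
    \<comment> \<open>A squeeze: at \<open>s + \<eta>\<close> almost all functions are at most
      \<open>c s\<close>, at \<open>s - \<eta>\<close> infinitely many equal \<open>c s\<close>, and
      monotonicity fixes these in between.\<close>
    have "\<not> (\<exists>\<^sub>F k in sequentially. \<exists>\<beta>\<in>A. r k (s + \<eta>) = \<beta> \<and> c s < \<beta>)"
    proof
      assume "\<exists>\<^sub>F k in sequentially. \<exists>\<beta>\<in>A. r k (s + \<eta>) = \<beta> \<and> c s < \<beta>"
      then obtain \<beta> where "\<beta> \<in> A" and fr: "\<exists>\<^sub>F k in sequentially. r k (s + \<eta>) = \<beta> \<and> c s < \<beta>"
        unfolding frequently_bex_finite_distrib[OF \<open>finite A\<close>] by blast
      have "c s < \<beta>" using frequently_ex[OF fr] by blast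
      moreover have "\<beta> \<le> c (s + \<eta>)"
        using \<open>\<beta> \<in> A\<close> by (rule c_max) (rule frequently_elim1[OF fr], simp)
      ultimately show False using ends by simp
    qed
    then have "\<forall>\<^sub>F k in sequentially. \<not> (\<exists>\<beta>\<in>A. r k (s + \<eta>) = \<beta> \<and> c s < \<beta>)"
      by (simp add: not_frequently)
    with ev have ev': "\<forall>\<^sub>F k in sequentially. (r k ` {a<..<b} \<subseteq> A \<and> mono_on {a<..<b} (r k)) \<and> r k (s + \<eta>) \<le> c s"
    proof eventually_elim
      case (elim k)
      then have "r k (s + \<eta>) \<in> A" using ends(2) by blast
      then show ?case using elim by (simp add: not_less)
    qed
    have "\<exists>\<^sub>F k in sequentially. r k (s - \<eta>) = c s \<and>
        (r k ` {a<..<b} \<subseteq> A \<and> mono_on {a<..<b} (r k)) \<and> r k (s + \<eta>) \<le> c s"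
      using frequently_eventually_conj[OF c(2)[OF ends(1)] ev'] ends by (simp add: conj_commute)
    then have "\<exists>\<^sub>F k in sequentially. \<forall>u\<in>{s - \<eta><..<s + \<eta>}. r k u = c s"
    proof (rule frequently_elim1, intro ballI)
      fix k u assume k: "r k (s - \<eta>) = c s \<and>
        (r k ` {a<..<b} \<subseteq> A \<and> mono_on {a<..<b} (r k)) \<and> r k (s + \<eta>) \<le> c s"
        and u: "u \<in> {s - \<eta><..<s + \<eta>}"
      have "u \<in> {a<..<b}" using u ends by auto
      have mono: "mono_on {a<..<b} (r k)" using k by blast
      have "r k (s - \<eta>) \<le> r k u" "r k u \<le> r k (s + \<eta>)"
        using mono_onD[OF mono ends(1) \<open>u \<in> {a<..<b}\<close>] mono_onD[OF mono \<open>u \<in> {a<..<b}\<close> ends(2)] u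
        by auto
      then show "r k u = c s" using k by (auto intro: antisym)
    qed
    moreover have "{s - \<eta><..<s + \<eta>} \<subseteq> {a<..<b}" using ends by auto
    ultimately show "\<exists>\<alpha>\<in>A. \<exists>\<eta>>0. {s - \<eta><..<s + \<eta>} \<subseteq> {a<..<b} \<and>
      (\<exists>\<^sub>F k in sequentially. \<forall>u\<in>{s - \<eta><..<s + \<eta>}. r k u = \<alpha>)"
      using \<open>c s \<in> A\<close> \<open>\<eta> > 0\<close> by blast
  qed
qed

text \<open>\<open>C\<close> is the closed \<open>e / 2\<close>-neighbourhood of the compact convex
  value, closed and convex as a sum with a ball. Upper semicontinuity is used in this form because
  the mean value theorem works with closed convex sets.\<close>

lemma usc_on_convex_nbhd:
  fixes H :: "'a::euclidean_space \<Rightarrow> 'b::euclidean_space set"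
  assumes "usc_on A H" "x \<in> A" "convex (H x)" "compact (H x)" "0 < e"
  obtains C \<rho> where "convex C" "closed C" "0 < \<rho>" "\<And>y. y \<in> A \<Longrightarrow> dist y x < \<rho> \<Longrightarrow> H y \<subseteq> C"
    "\<And>z. z \<in> C \<Longrightarrow> \<exists>v\<in>H x. norm (z - v) < e"
proof -
  let ?C = "\<Union>v\<in>H x. \<Union>y\<in>cball 0 (e / 2). {v + y}" and ?V = "\<Union>v\<in>H x. ball v (e / 2)"
  have "open ?V" by blast
  moreover have "H x \<subseteq> ?V" using \<open>0 < e\<close> by force
  ultimately obtain N where N: "open N" "x \<in> N" "\<And>y. y \<in> A \<inter> N \<Longrightarrow> H y \<subseteq> ?V"
    using assms(1)[unfolded usc_on_def, rule_format, OF assms(2)] by meson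
  obtain \<rho> where \<rho>: "\<rho> > 0" "ball x \<rho> \<subseteq> N" using N by (meson openE)
  have "?V \<subseteq> ?C"
  proof
    fix z assume "z \<in> ?V"
    then obtain v where "v \<in> H x" "dist v z < e / 2" by auto
    then show "z \<in> ?C"
      by (intro UN_I[of v] UN_I[of "z - v"]) (auto simp: dist_norm norm_minus_commute)
  qed
  show thesis
  proof
    show "convex ?C" by (intro convex_sums assms convex_cball)
    show "closed ?C" by (intro closed_compact_sums compact_imp_closed assms compact_cball)
    show "H y \<subseteq> ?C" if "y \<in> A" "dist y x < \<rho>" for y
      using N(3)[of y] \<rho> that \<open>?V \<subseteq> ?C\<close> by (auto simp: dist_commute subset_iff)
    show "\<exists>v\<in>H x. norm (z - v) < e" if "z \<in> ?C" for z
    proof -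
      obtain v y where "v \<in> H x" "y \<in> cball 0 (e / 2)" "z = v + y" using \<open>z \<in> ?C\<close> by blast
      then show ?thesis using \<open>0 < e\<close> by (intro bexI[of _ v]) auto
    qed
  qed fact
qed

lemma bouligand_cone_mono: "A \<subseteq> B \<Longrightarrow> bouligand_cone A x \<subseteq> bouligand_cone B x"
  unfolding bouligand_cone_def by blast

lemma lipschitz_imp_abs_cont_on:
  assumes lip: "L-lipschitz_on {a..b} f"
  shows "abs_cont_on a b f"
  unfolding abs_cont_on_def
proof (intro allI impI)
  fix e :: real assume "0 < e"
  have L: "0 \<le> L" by (rule lipschitz_on_nonneg[OF lip])
  show "\<exists>d>0. \<forall>\<D>. \<D> division_of \<Union>\<D> \<and> \<Union>\<D> \<subseteq> {a..b} \<and> (\<Sum>J\<in>\<D>. Sup J - Inf J) < d \<longrightarrow>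
      (\<Sum>J\<in>\<D>. norm (f (Sup J) - f (Inf J))) < e"
  proof (intro exI[of _ "e / (L + 1)"] conjI allI impI)
    show "0 < e / (L + 1)" using \<open>0 < e\<close> L by simp
    fix \<D> assume \<D>: "\<D> division_of \<Union>\<D> \<and> \<Union>\<D> \<subseteq> {a..b} \<and> (\<Sum>J\<in>\<D>. Sup J - Inf J) < e / (L + 1)"
    have J: "norm (f (Sup J) - f (Inf J)) \<le> L * (Sup J - Inf J)" if "J \<in> \<D>" for J
    proof -
      have div: "\<D> division_of \<Union>\<D>" using \<D> by blast
      obtain c d where "J = cbox c d" using division_ofD(4)[OF div \<open>J \<in> \<D>\<close>] by blast
      moreover have "J \<noteq> {}" using division_ofD(3)[OF div \<open>J \<in> \<D>\<close>] .
      moreover have "J \<subseteq> {a..b}" using \<D> that by blast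
      ultimately have "J = {c..d}" "J \<noteq> {}" "J \<subseteq> {a..b}" by auto
      then show ?thesis
        using lipschitz_onD[OF lip, of d c] by (auto simp: dist_norm dist_real_def)
    qed
    have "(\<Sum>J\<in>\<D>. norm (f (Sup J) - f (Inf J))) \<le> (\<Sum>J\<in>\<D>. L * (Sup J - Inf J))"
      by (rule sum_mono) (rule J)
    also have "\<dots> = L * (\<Sum>J\<in>\<D>. Sup J - Inf J)" by (simp add: sum_distrib_left)
    also have "\<dots> \<le> L * (e / (L + 1))" using \<D> L by (intro mult_left_mono) auto
    also have "\<dots> < e" using \<open>0 < e\<close> L by (simp add: field_simps)
    finally show "(\<Sum>J\<in>\<D>. norm (f (Sup J) - f (Inf J))) < e" .
  qed
qed

section \<open>Solutions of the inclusion in the green sets\<close>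


lemma smooth_on_gradient_continuous:
  fixes f :: "'a::euclidean_space \<Rightarrow> real"
  assumes "smooth_on W f" "U \<subseteq> W" and g: "\<And>x. x \<in> U \<Longrightarrow> GDERIV f x :> g x"
  shows "continuous_on U g"
proof -
  have "higher_differentiable_on W f (Suc 0)"
    using assms(1) unfolding smooth_on_def by (rule spec)
  then have cont: "continuous_on U (\<lambda>x. frechet_derivative f (at x) b)" for b
    using \<open>U \<subseteq> W\<close> by (auto intro: continuous_on_subset)
  have eq: "frechet_derivative f (at x) b = g x \<bullet> b" if "x \<in> U" for x b
    using frechet_derivative_at[of f "\<lambda>h. h \<bullet> g x" x] g[OF that]
    by (simp add: gderiv_def inner_commute fun_eq_iff)
  have "continuous_on U (\<lambda>x. g x \<bullet> b)" for b
    using cont[of b] by (rule continuous_on_eq) (simp add: eq)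
  then have "continuous_on U (\<lambda>x. \<Sum>b\<in>Basis. (g x \<bullet> b) *\<^sub>R b)"
    by (intro continuous_on_sum continuous_on_scaleR continuous_on_const)
  then show ?thesis unfolding euclidean_representation .
qed

text \<open>A chain rule for lower right quotients along a Lipschitz path: the remainder of the
  first-order expansion is at most \<open>e * (L * s)\<close>, and \<open>e\<close> is chosen so
  that this uses up the remaining half of \<eta>.\<close>

lemma GDERIV_increment_lower:
  fixes \<psi> :: "real \<Rightarrow> 'a::real_inner"
  assumes g: "GDERIV f (\<psi> 0) :> g" and lip: "L-lipschitz_on UNIV \<psi>" and "0 < \<eta>"
    and ev: "\<forall>\<^sub>F s in at_right 0. m - \<eta> / 2 \<le> g \<bullet> ((\<psi> s - \<psi> 0) /\<^sub>R s)"
  shows "\<forall>\<^sub>F s in at_right 0. (m - \<eta>) * s \<le> f (\<psi> s) - f (\<psi> 0)"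
proof -
  have L: "0 \<le> L" by (rule lipschitz_on_nonneg[OF lip])
  define e where "e = \<eta> / (2 * (L + 1))"
  have e: "e > 0" "e * L \<le> \<eta> / 2" using L \<open>0 < \<eta>\<close> by (auto simp: e_def field_simps add_nonneg_pos)
  obtain d where "d > 0" and d: "\<And>y. norm (y - \<psi> 0) < d \<Longrightarrow>
      norm (f y - f (\<psi> 0) - (y - \<psi> 0) \<bullet> g) \<le> e * norm (y - \<psi> 0)"
    using g e(1) unfolding gderiv_def has_derivative_at_alt by blast
  have "d / (L + 1) > 0" using \<open>d > 0\<close> L by simp
  then have "\<forall>\<^sub>F s in at_right 0. s \<in> {0<..<d / (L + 1)}" by (rule eventually_at_right_real)
  with ev show ?thesis
  proof eventually_elim
    case (elim s)
    have le: "norm (\<psi> s - \<psi> 0) \<le> L * s"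
      using lipschitz_onD[OF lip, of s 0] elim by (simp add: dist_norm)
    also have "\<dots> < d" 
    proof -
      have "L * s \<le> (L + 1) * s" using elim by (intro mult_right_mono) auto
      also have "\<dots> < d" using elim L by (simp add: field_simps add_nonneg_pos)
      finally show ?thesis .
    qed
    finally have "\<bar>f (\<psi> s) - f (\<psi> 0) - (\<psi> s - \<psi> 0) \<bullet> g\<bar> \<le> e * norm (\<psi> s - \<psi> 0)"
      using d by simp
    also have "\<dots> \<le> e * (L * s)" using le e by (intro mult_left_mono) auto
    also have "\<dots> \<le> \<eta> / 2 * s" using mult_right_mono[OF e(2), of s] elim by (simp add: mult.assoc)
    finally have "(\<psi> s - \<psi> 0) \<bullet> g - \<eta> / 2 * s \<le> f (\<psi> s) - f (\<psi> 0)" by linarith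
    moreover have "(m - \<eta> / 2) * s \<le> (\<psi> s - \<psi> 0) \<bullet> g"
    proof -
      have "g \<bullet> ((\<psi> s - \<psi> 0) /\<^sub>R s) = ((\<psi> s - \<psi> 0) \<bullet> g) / s"
        by (simp add: inner_commute divide_inverse_commute)
      then show ?thesis using elim by (simp add: pos_le_divide_eq)
    qed
    moreover have "(m - \<eta>) * s = (m - \<eta> / 2) * s - \<eta> / 2 * s" by (simp add: algebra_simps)
    ultimately show ?case by linarith
  qed
qed

section \<open>Time shifts, intervals of existence and exit times\<close>

lemma lipschitz_on_shift:
  fixes \<phi> :: "real \<Rightarrow> 'a::metric_space"
  assumes "L-lipschitz_on UNIV \<phi>"
  shows "L-lipschitz_on UNIV (\<lambda>s. \<phi> (t + s))"
proof (rule lipschitz_onI)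
  show "dist (\<phi> (t + u)) (\<phi> (t + v)) \<le> L * dist u v" for u v
    using lipschitz_onD[OF assms, of "t + u" "t + v"] by simp
qed (rule lipschitz_on_nonneg[OF assms])

lemma co_interval_infinity [simp]: "co_interval \<infinity> = {0..}"
  and co_interval_ereal [simp]: "co_interval (ereal r) = {0..<r}"
  by (auto simp: co_interval_def)

lemma co_interval_right_nbhd:
  assumes "t \<in> co_interval b"
  obtains \<delta> where "0 < \<delta>" "{t..<t + \<delta>} \<subseteq> co_interval b"
proof (cases b)
  case (real r)
  then show thesis using that[of "r - t"] assms by auto
next
  case PInf
  then show thesis using that[of 1] assms by (auto simp: subset_iff)
next
  case MInf
  then show thesis using assms by (simp add: co_interval_def)
qed

text \<open>Equi-Lipschitz paths that converge pointwise converge uniformly on compact intervals.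
  Compactness enters as bisection: adjacent good intervals combine, and a short interval is
  controlled by convergence at one point.\<close>

lemma lipschitz_limit_eventually_in_open:
  fixes \<psi> :: "nat \<Rightarrow> real \<Rightarrow> 'a::metric_space"
  assumes lip: "\<And>k. L-lipschitz_on UNIV (\<psi> k)" and lim: "\<And>t. (\<lambda>k. \<psi> k t) \<longlonglongrightarrow> \<phi> t"
    and "open S" "a \<le> b" and S: "\<And>t. a \<le> t \<Longrightarrow> t \<le> b \<Longrightarrow> \<phi> t \<in> S"
  shows "\<forall>\<^sub>F k in sequentially. \<forall>u\<in>{a..b}. \<psi> k u \<in> S"
  using \<open>a \<le> b\<close>
proof (induction rule: Bolzano)
  case (trans a b c)
  from trans(1,2) show ?case
  proof eventually_elim
    case (elim k)
    show ?case
    proof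
      fix u assume "u \<in> {a..c}"
      then show "\<psi> k u \<in> S" using elim by (cases "u \<le> b") auto
    qed
  qed
next
  case (local x)
  then obtain e where e: "e > 0" "ball (\<phi> x) e \<subseteq> S" using S \<open>open S\<close> by (meson openE)
  have L: "0 \<le> L" using lip lipschitz_on_nonneg by blast
  define d where "d = e / (2 * (L + 1))"
  have d: "d > 0" "L * d \<le> e / 2" using e L by (auto simp: d_def field_simps)
  have "\<forall>\<^sub>F k in sequentially. dist (\<psi> k x) (\<phi> x) < e / 2"
    by (rule tendstoD[OF lim]) (use e in simp)
  then have "\<forall>\<^sub>F k in sequentially. \<forall>u\<in>{a..b}. \<psi> k u \<in> S" if "a \<le> x" "x \<le> b" "b - a < d" for a b
  proof eventually_elim
    case (elim k)
    show ?case
    proof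
      fix u assume "u \<in> {a..b}"
      then have "L * dist u x \<le> L * d"
        using that L by (intro mult_left_mono) (auto simp: dist_real_def)
      then have "dist (\<psi> k u) (\<psi> k x) \<le> e / 2"
        using lipschitz_onD[OF lip, of u x k] d(2) by simp
      then have "dist (\<psi> k u) (\<phi> x) < e"
        using elim dist_triangle[of "\<psi> k u" "\<phi> x" "\<psi> k x"] by simp
      then show "\<psi> k u \<in> S" using e(2) by (auto simp: dist_commute)
    qed
  qed
  then show ?case using d(1) by blast
qed

lemma exit_time:
  fixes \<phi> :: "real \<Rightarrow> 'a::topological_space"
  assumes cont: "continuous_on UNIV \<phi>" and "open S" "\<phi> 0 \<in> S"
  obtains b where "(0::ereal) < b" "\<And>t. t \<in> co_interval b \<Longrightarrow> \<phi> t \<in> S"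
    "b = \<infinity> \<or> (\<exists>r. b = ereal r \<and> \<phi> r \<notin> S)"
proof (cases "\<forall>t\<ge>0. \<phi> t \<in> S")
  case True
  then show thesis using that[of \<infinity>] by simp
next
  case False
  define A where "A = {0..} \<inter> \<phi> -` (- S)"
  have "closed A"
    unfolding A_def using cont \<open>open S\<close> by (intro closed_Int closed_vimage) auto
  moreover have "A \<noteq> {}" "bdd_below A" using False by (auto simp: A_def intro: bdd_belowI[of _ 0])
  ultimately have "Inf A \<in> A" by (intro closed_contains_Inf)
  then have "\<phi> (Inf A) \<notin> S" "0 \<le> Inf A" by (auto simp: A_def)
  moreover have "\<phi> t \<in> S" if "0 \<le> t" "t < Inf A" for t
    using cInf_lower[OF _ \<open>bdd_below A\<close>, of t] that by (force simp: A_def)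
  moreover have "Inf A \<noteq> 0" using \<open>\<phi> 0 \<in> S\<close> \<open>\<phi> (Inf A) \<notin> S\<close> by metis
  ultimately show thesis using that[of "ereal (Inf A)"] by auto
qed

section \<open>The standing data and the common velocity bound\<close>

locale quasi_lyapunov_system =
  fixes D S K :: "'a::euclidean_space set" and F :: "'a \<Rightarrow> 'a set" and \<epsilon> :: real
    and \<U> :: "nat \<Rightarrow> ('i::wellorder, 'a) wo_family" and Green :: "'a set set"
    and G :: "'a set \<Rightarrow> 'a \<Rightarrow> 'a set" and w :: "'a \<Rightarrow> real"
  assumes open_S: "open S" and closed_K: "closed K" and D_eq: "D = S \<inter> K"
    and bounded: "uniformly_bounded_on (closure D) F"
    and approx: "invariant_partial_approx D F \<epsilon> \<U> Green G"
    and lyap: "quasi_lyapunov D Green G w"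
begin

lemma partition: "relatively_open_partition (top_of_set D) (\<U> m)"
  using approx by (simp add: invariant_partial_approx_def sigma_relatively_open_partition_def)

lemma disjoint_green: "U \<in> Green \<Longrightarrow> V \<in> Green \<Longrightarrow> x \<in> U \<Longrightarrow> x \<in> V \<Longrightarrow> U = V"
proof -
  have "disjoint Green" using approx by (simp add: invariant_partial_approx_def)
  then show "U \<in> Green \<Longrightarrow> V \<in> Green \<Longrightarrow> x \<in> U \<Longrightarrow> x \<in> V \<Longrightarrow> U = V"
    by (auto dest: disjointD)
qed

lemma green_member:
  assumes "U \<in> Green"
  obtains m \<alpha>0 V \<alpha> where "\<U> m = (\<alpha>0, V)" "\<alpha> < \<alpha>0" "U = V \<alpha>"
proof -
  have "Green \<subseteq> (\<Union>m. members (\<U> m))" using approx by (simp add: invariant_partial_approx_def)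
  then obtain m where "U \<in> members (\<U> m)" using assms by blast
  then show thesis using that[of m "fst (\<U> m)" "snd (\<U> m)"] by (auto simp: members_def)
qed

lemma green_subset: "U \<in> Green \<Longrightarrow> U \<subseteq> D"
proof -
  assume "U \<in> Green"
  then obtain m \<alpha>0 V \<alpha> where "\<U> m = (\<alpha>0, V)" "\<alpha> < \<alpha>0" "U = V \<alpha>" by (rule green_member)
  then show ?thesis using partition[of m] by (auto simp: relatively_open_partition_def)
qed

lemma green_locally_closed:
  assumes "U \<in> Green" "x \<in> U"
  obtains r where "0 < r" "closed (U \<inter> cball x r)"
proof -
  obtain m \<alpha>0 V \<alpha> where m: "\<U> m = (\<alpha>0, V)" "\<alpha> < \<alpha>0" "U = V \<alpha>"
    using assms(1) by (rule green_member)
  have "relatively_open_partition (top_of_set (S \<inter> K)) (\<alpha>0, V)"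
    using partition[of m] m(1) D_eq by simp
  then show thesis
    using relatively_open_partition_member_locally_closed[OF open_S closed_K _ m(2)] assms(2) m(3) that
    by metis
qed

lemma usc_G: "U \<in> Green \<Longrightarrow> usc_on (closure U) (G U)"
  and convex_G: "U \<in> Green \<Longrightarrow> x \<in> closure U \<Longrightarrow> convex (G U x)"
  and compact_G: "U \<in> Green \<Longrightarrow> x \<in> closure U \<Longrightarrow> compact (G U x)"
  and tangent_G: "U \<in> Green \<Longrightarrow> x \<in> closure U \<Longrightarrow>
      G U x \<inter> bouligand_cone (closure U) x \<subseteq> F x + cball 0 \<epsilon>"
  using approx by (simp_all add: invariant_partial_approx_def)

lemma w_continuous: "continuous_on D w"
  and w_nonneg: "x \<in> D \<Longrightarrow> 0 \<le> w x"
  and w_eq_0_iff: "x \<in> D \<Longrightarrow> w x = 0 \<longleftrightarrow> x \<notin> \<Union>Green"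
  using lyap by (simp_all add: quasi_lyapunov_def)

lemma ex_max_speed:
  "\<exists>c\<ge>0. \<forall>U\<in>Green. \<forall>x\<in>closure U. \<forall>v\<in>G U x \<inter> bouligand_cone (closure U) x. norm v \<le> c"
proof -
  obtain c where c: "c > 0" "\<And>x v. x \<in> closure D \<Longrightarrow> v \<in> F x \<Longrightarrow> norm v \<le> c"
    using bounded by (auto simp: uniformly_bounded_on_def)
  have "0 < \<epsilon>" using approx by (simp add: invariant_partial_approx_def)
  show ?thesis
  proof (intro exI[of _ "c + \<epsilon>"] conjI ballI)
    show "0 \<le> c + \<epsilon>" using c(1) \<open>0 < \<epsilon>\<close> by simp
    fix U x v assume U: "U \<in> Green" "x \<in> closure U" "v \<in> G U x \<inter> bouligand_cone (closure U) x"
    then have "v \<in> F x + cball 0 \<epsilon>" using tangent_G by blast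
    then obtain a b where "v = a + b" "a \<in> F x" "norm b \<le> \<epsilon>" by (auto simp: set_plus_def)
    moreover have "x \<in> closure D" using U closure_mono[OF green_subset] by blast
    ultimately show "norm v \<le> c + \<epsilon>"
      using c(2)[of x a] norm_triangle_ineq[of a b] by simp
  qed
qed

text \<open>A single constant for all green sets and all starting points, as
  \<open>continuation\<close> and the extraction of a convergent subsequence require.\<close>

definition max_speed :: real where
  "max_speed = (SOME c. 0 \<le> c \<and>
    (\<forall>U\<in>Green. \<forall>x\<in>closure U. \<forall>v\<in>G U x \<inter> bouligand_cone (closure U) x. norm v \<le> c))"

lemma max_speed_nonneg: "0 \<le> max_speed"
  and norm_le_max_speed: "U \<in> Green \<Longrightarrow> x \<in> closure U \<Longrightarrow> v \<in> G U x \<Longrightarrow>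
      v \<in> bouligand_cone (closure U) x \<Longrightarrow> norm v \<le> max_speed"
  using someI_ex[OF ex_max_speed, folded max_speed_def] by blast+

text \<open>The property to which \<open>continuation\<close> is applied. Persistence in
  \<open>U\<close> yields forward invariance and the monotonicity of the visited indices; the last
  clause is integrated by \<open>dini_lower_bound\<close>.\<close>

definition green_germ :: "(real \<Rightarrow> 'a) \<Rightarrow> bool" where
  "green_germ f \<longleftrightarrow> (\<exists>U\<in>Green. (\<exists>\<delta>>0. \<forall>s\<in>{0..<\<delta>}. f s \<in> U) \<and> right_quot f (G U (f 0)) \<and>
    (\<forall>\<eta>>0. \<forall>\<^sub>F s in at_right 0. (1 - \<eta>) * s \<le> w (f s) - w (f 0)))"

text \<open>What a limit of paths inherits from \<open>green_germ\<close>, and enough to place the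
  derivative in F + \<epsilon>B. The growth of \<open>w\<close> passes to the limit separately, in
  integrated form.\<close>

definition closed_green_germ :: "(real \<Rightarrow> 'a) \<Rightarrow> bool" where
  "closed_green_germ f \<longleftrightarrow>
    (\<exists>U\<in>Green. (\<exists>\<delta>>0. \<forall>s\<in>{0..<\<delta>}. f s \<in> closure U) \<and> right_quot f (G U (f 0)))"

lemma green_germ_imp_closed: "green_germ f \<Longrightarrow> closed_green_germ f"
  unfolding green_germ_def closed_green_germ_def using closure_subset by (metis subsetD)

lemma green_germ_cong:
  assumes "green_germ f" "0 < \<delta>" and eq: "\<And>s. 0 \<le> s \<Longrightarrow> s < \<delta> \<Longrightarrow> f s = g s"
  shows "green_germ g"
proof -
  obtain U \<delta>' where U: "U \<in> Green" "\<delta>' > 0" "\<And>s. s \<in> {0..<\<delta>'} \<Longrightarrow> f s \<in> U"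
    and rq: "right_quot f (G U (f 0))"
    and inc: "\<And>\<eta>. \<eta> > 0 \<Longrightarrow> \<forall>\<^sub>F s in at_right 0. (1 - \<eta>) * s \<le> w (f s) - w (f 0)"
    using assms(1) unfolding green_germ_def by blast
  have [simp]: "f 0 = g 0" using eq \<open>0 < \<delta>\<close> by simp
  have "\<forall>s\<in>{0..<min \<delta> \<delta>'}. g s \<in> U" using U(3) eq by (metis atLeastLessThan_iff min_less_iff_conj)
  moreover have "min \<delta> \<delta>' > 0" using \<open>0 < \<delta>\<close> U(2) by simp
  moreover have "right_quot g (G U (g 0))"
    using right_quot_cong[OF rq \<open>0 < \<delta>\<close> eq] by simp
  moreover have "\<forall>\<^sub>F s in at_right 0. (1 - \<eta>) * s \<le> w (g s) - w (g 0)" if "\<eta> > 0" for \<eta>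
  proof -
    have "\<forall>\<^sub>F s in at_right 0. s \<in> {0<..<\<delta>}" by (rule eventually_at_right_real) fact
    with inc[OF that] show ?thesis by eventually_elim (use eq in simp)
  qed
  ultimately show ?thesis unfolding green_germ_def using U(1) by blast
qed

text \<open>One path from \<open>viability\<close> is tested against two kinds of convex sets:
  closed neighbourhoods of \<open>G U (\<phi> t)\<close> for the inclusion, and half-spaces of the
  gradient at \<open>\<phi> t\<close> for the growth of \<open>w\<close>.\<close>

lemma local_solution:
  assumes "x \<in> \<Union>Green"
  obtains T \<phi> where "0 < T" "\<phi> 0 = x" "\<phi> T \<in> \<Union>Green" "(max_speed + 1)-lipschitz_on UNIV \<phi>"
    "\<And>t. 0 \<le> t \<Longrightarrow> t < T \<Longrightarrow> green_germ (\<lambda>s. \<phi> (t + s))"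
proof -
  define c where "c = max_speed"
  note c = max_speed_nonneg[folded c_def] norm_le_max_speed[folded c_def]
  obtain U where U: "U \<in> Green" "x \<in> U" using \<open>x \<in> \<Union>Green\<close> by blast
  obtain r where r: "r > 0" "closed (U \<inter> cball x r)" using green_locally_closed[OF U] .
  have "\<exists>W f g. open W \<and> U \<subseteq> W \<and> smooth_on W f \<and> (\<forall>x\<in>U. f x = w x) \<and> (\<forall>x\<in>U. GDERIV f x :> g x) \<and>
      (\<forall>x\<in>U. \<exists>y. is_arg_max (\<lambda>z. g x \<bullet> z) (\<lambda>z. z \<in> G U x \<inter> bouligand_cone U x) y \<and> 1 \<le> g x \<bullet> y)"
    using lyap U(1) by (simp add: quasi_lyapunov_def)
  then obtain W f g where W: "smooth_on W f" "U \<subseteq> W" "\<forall>x\<in>U. f x = w x" "\<forall>x\<in>U. GDERIV f x :> g x"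
    "\<forall>x\<in>U. \<exists>y. is_arg_max (\<lambda>z. g x \<bullet> z) (\<lambda>z. z \<in> G U x \<inter> bouligand_cone U x) y \<and> 1 \<le> g x \<bullet> y"
    by (elim exE conjE)
  note f = W(1,2) W(3)[rule_format] and g = W(4)[rule_format] and max = W(5)[rule_format]
  have g_cont: "continuous_on U g" by (rule smooth_on_gradient_continuous[OF f(1,2) g])
  \<comment> \<open>The maximum condition on \<open>w\<close> provides a vector of \<open>?H\<close>
    tangent to \<open>U\<close>, so the cut by the gradient half-space leaves the tangency
    hypothesis of \<open>viability\<close> intact.\<close>
  let ?H = "\<lambda>x. G U x \<inter> {y. 1 \<le> g x \<bullet> y}"
  have tangent: "\<exists>v \<in> ?H y \<inter> bouligand_cone U y. norm v \<le> c" if "y \<in> U" for y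
  proof -
    obtain v where v: "v \<in> G U y" "v \<in> bouligand_cone U y" "1 \<le> g y \<bullet> v"
      using max[OF \<open>y \<in> U\<close>] by (auto simp: is_arg_max_def)
    moreover have "v \<in> bouligand_cone (closure U) y"
      using v(2) bouligand_cone_mono[OF closure_subset] by blast
    ultimately show ?thesis using c(2)[OF U(1), of y v] that closure_subset by blast
  qed
  obtain T \<phi> where T: "0 < T" "\<phi> 0 = x" and lip: "(c + 1)-lipschitz_on UNIV \<phi>"
    and in_U: "\<And>t. 0 \<le> t \<Longrightarrow> t \<le> T \<Longrightarrow> \<phi> t \<in> U"
    and quot: "\<And>t C \<rho>. 0 \<le> t \<Longrightarrow> t < T \<Longrightarrow> convex C \<Longrightarrow> closed C \<Longrightarrow> 0 < \<rho> \<Longrightarrow>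
      (\<And>y. y \<in> U \<Longrightarrow> dist y (\<phi> t) < \<rho> \<Longrightarrow> ?H y \<inter> cball 0 c \<subseteq> C) \<Longrightarrow>
      \<forall>\<^sub>F s in at_right 0. (\<phi> (t + s) - \<phi> t) /\<^sub>R s \<in> C"
    using viability[OF U(2) r c(1), of ?H] tangent by blast
  show thesis
  proof (rule that[folded c_def, OF T _ lip])
    show "\<phi> T \<in> \<Union>Green" using in_U[of T] T U by auto
    fix t assume t: "0 \<le> t" "t < T"
    have mem: "\<phi> t \<in> U" "\<phi> t \<in> closure U" using in_U[of t] t closure_subset by auto
    have "right_quot (\<lambda>s. \<phi> (t + s)) (G U (\<phi> t))"
      unfolding right_quot_def
    proof (intro allI impI)
      fix \<eta> :: real assume "0 < \<eta>"
      obtain C \<rho> where C: "convex C" "closed C" "0 < \<rho>"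
        "\<And>y. y \<in> closure U \<Longrightarrow> dist y (\<phi> t) < \<rho> \<Longrightarrow> G U y \<subseteq> C"
        "\<And>z. z \<in> C \<Longrightarrow> \<exists>v\<in>G U (\<phi> t). norm (z - v) < \<eta>"
        using usc_on_convex_nbhd[OF usc_G[OF U(1)] mem(2) convex_G[OF U(1) mem(2)] compact_G[OF U(1) mem(2)] \<open>0 < \<eta>\<close>]
        by blast
      have "\<forall>\<^sub>F s in at_right 0. (\<phi> (t + s) - \<phi> t) /\<^sub>R s \<in> C"
        using C(4) closure_subset by (intro quot[OF t C(1-3)]) blast
      then show "\<forall>\<^sub>F h in at_right 0. \<exists>v\<in>G U (\<phi> t). norm ((\<phi> (t + h) - \<phi> (t + 0)) /\<^sub>R h - v) < \<eta>"
        by eventually_elim (use C(5) in simp)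
    qed
    moreover have "\<forall>\<^sub>F s in at_right 0. (1 - \<eta>) * s \<le> w (\<phi> (t + s)) - w (\<phi> t)" if "0 < \<eta>" for \<eta>
    proof -
      \<comment> \<open>Velocities have norm at most \<open>c\<close>, so such a variation of the
        gradient changes the inner product by at most \<open>\<eta> / 2\<close>. The other half is
        left for the first-order remainder of the smooth extension.\<close>
      have "\<eta> / (2 * (c + 1)) > 0" using \<open>0 < \<eta>\<close> c(1) by simp
      then obtain \<rho> where \<rho>: "\<rho> > 0" "\<And>y. y \<in> U \<Longrightarrow> dist y (\<phi> t) < \<rho> \<Longrightarrow> dist (g y) (g (\<phi> t)) < \<eta> / (2 * (c + 1))"
        using g_cont mem(1) unfolding continuous_on_iff by meson
      have "\<forall>\<^sub>F s in at_right 0. (\<phi> (t + s) - \<phi> t) /\<^sub>R s \<in> {v. 1 - \<eta> / 2 \<le> g (\<phi> t) \<bullet> v}"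
      proof (rule quot[OF t])
        show "convex {v. 1 - \<eta> / 2 \<le> g (\<phi> t) \<bullet> v}" "closed {v. 1 - \<eta> / 2 \<le> g (\<phi> t) \<bullet> v}"
          using convex_halfspace_ge[of "1 - \<eta> / 2" "g (\<phi> t)"] closed_halfspace_ge[of "1 - \<eta> / 2" "g (\<phi> t)"]
          by simp_all
        fix y assume y: "y \<in> U" "dist y (\<phi> t) < \<rho>"
        show "?H y \<inter> cball 0 c \<subseteq> {v. 1 - \<eta> / 2 \<le> g (\<phi> t) \<bullet> v}"
        proof
          fix v assume v: "v \<in> ?H y \<inter> cball 0 c"
          have "\<bar>(g y - g (\<phi> t)) \<bullet> v\<bar> \<le> norm (g y - g (\<phi> t)) * norm v" by (rule Cauchy_Schwarz_ineq2)
          also have "\<dots> \<le> \<eta> / (2 * (c + 1)) * (c + 1)"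
            using \<rho>(2)[OF y] v \<open>\<eta> / (2 * (c + 1)) > 0\<close> by (intro mult_mono) (auto simp: dist_norm)
          also have "\<dots> = \<eta> / 2" using c(1) by (simp add: field_simps)
          finally have "g y \<bullet> v - g (\<phi> t) \<bullet> v \<le> \<eta> / 2" unfolding inner_diff_left by linarith
          moreover have "1 \<le> g y \<bullet> v" using v by simp
          ultimately show "v \<in> {v. 1 - \<eta> / 2 \<le> g (\<phi> t) \<bullet> v}" unfolding mem_Collect_eq by linarith
        qed
      qed fact
      then have "\<forall>\<^sub>F s in at_right 0. (1 - \<eta>) * s \<le> f (\<phi> (t + s)) - f (\<phi> (t + 0))"
        using mem(1) g \<open>0 < \<eta>\<close>
        by (intro GDERIV_increment_lower[where L = "c + 1" and g = "g (\<phi> t)"] lipschitz_on_shift[OF lip]) auto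
      moreover have "\<forall>\<^sub>F s in at_right 0. s \<in> {0<..<T - t}" by (rule eventually_at_right_real) (use t in simp)
      ultimately show ?thesis
        by eventually_elim (use in_U t f(3) mem(1) in simp)
    qed
    moreover have "\<exists>\<delta>>0. \<forall>s\<in>{0..<\<delta>}. \<phi> (t + s) \<in> U"
      using t in_U by (intro exI[of _ "T - t"]) auto
    ultimately show "green_germ (\<lambda>s. \<phi> (t + s))"
      unfolding green_germ_def using U(1) by auto
  qed
qed

section \<open>Solutions starting in the union of the green sets\<close>

lemma green_germ_mem: "green_germ f \<Longrightarrow> f 0 \<in> \<Union>Green"
proof -
  assume "green_germ f"
  then obtain U \<delta> where "U \<in> Green" "\<delta> > 0" "\<forall>s\<in>{0..<\<delta>::real}. f s \<in> U"
    unfolding green_germ_def by blast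
  then show ?thesis by (intro UnionI[of U]) auto
qed

text \<open>The end point is asked to lie in \<open>D\<close> rather than in a green set: the
  estimate must reach a possible non-green end point, where \<open>w\<close> vanishes, in order to
  exclude it.\<close>

lemma w_growth:
  assumes "0 \<le> b" and cont: "continuous_on {0..b} \<phi>"
    and germ: "\<And>t. 0 \<le> t \<Longrightarrow> t < b \<Longrightarrow> green_germ (\<lambda>s. \<phi> (t + s))" and "\<phi> b \<in> D"
  shows "w (\<phi> 0) + b \<le> w (\<phi> b)"
proof -
  have D: "\<phi> t \<in> D" if "0 \<le> t" "t \<le> b" for t
    using green_germ_mem[OF germ[of t]] green_subset \<open>\<phi> b \<in> D\<close> that by (cases "t = b") auto
  have "1 * (b - 0) \<le> w (\<phi> b) - w (\<phi> 0)"
  proof (rule dini_lower_bound)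
    show "continuous_on {0..b} (\<lambda>t. w (\<phi> t))"
      by (rule continuous_on_compose2[OF w_continuous cont]) (use D in auto)
    show "\<forall>\<^sub>F s in at_right 0. (1 - \<eta>) * s \<le> w (\<phi> (t + s)) - w (\<phi> t)"
      if "0 \<le> t" "t < b" "0 < \<eta>" for t \<eta>
      using germ[OF that(1,2)] \<open>0 < \<eta>\<close> unfolding green_germ_def add_0_right by blast
  qed fact
  then show ?thesis by simp
qed

lemma green_solution:
  assumes "x \<in> \<Union>Green"
  obtains \<phi> b where "(0::ereal) < b" "\<phi> 0 = x" "(max_speed + 1)-lipschitz_on UNIV \<phi>"
    "\<And>t. t \<in> co_interval b \<Longrightarrow> green_germ (\<lambda>s. \<phi> (t + s))"
    "\<And>t. t \<in> co_interval b \<Longrightarrow> w x + t \<le> w (\<phi> t)"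
    "b = \<infinity> \<or> (\<exists>r. b = ereal r \<and> \<phi> r \<notin> S)"
proof -
  obtain \<phi> where \<phi>: "\<phi> 0 = x" and lip: "(max_speed + 1)-lipschitz_on UNIV \<phi>"
    and alt: "(\<forall>t\<ge>0. green_germ (\<lambda>s. \<phi> (t + s))) \<or>
     (\<exists>b>0. (\<forall>t\<in>{0..<b}. green_germ (\<lambda>s. \<phi> (t + s))) \<and> \<phi> b \<in> closure (\<Union>Green) - \<Union>Green)"
  proof (rule continuation[where Q = green_germ and \<Omega> = "\<Union>Green" and L = "max_speed + 1" and x = x])
    show "\<And>f g \<delta>. green_germ f \<Longrightarrow> 0 < \<delta> \<Longrightarrow> (\<And>s. 0 \<le> s \<Longrightarrow> s < \<delta> \<Longrightarrow> f s = g s) \<Longrightarrow> green_germ g"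
      by (rule green_germ_cong)
    fix y assume "y \<in> \<Union>Green"
    then obtain T \<psi> where "0 < T" "\<psi> 0 = y" "\<psi> T \<in> \<Union>Green" "(max_speed + 1)-lipschitz_on UNIV \<psi>"
      "\<And>t. 0 \<le> t \<Longrightarrow> t < T \<Longrightarrow> green_germ (\<lambda>s. \<psi> (t + s))"
      using local_solution by blast
    then show "\<exists>h>0. \<exists>\<psi>. \<psi> 0 = y \<and> \<psi> h \<in> \<Union>Green \<and> (max_speed + 1)-lipschitz_on UNIV \<psi> \<and>
      (\<forall>t\<in>{0..<h}. green_germ (\<lambda>s. \<psi> (t + s)))"
      by (intro exI[of _ T] exI[of _ \<psi>] conjI) auto
  next
    show "x \<in> \<Union>Green" by fact
  qed (use that in blast)
  have cont: "continuous_on A \<phi>" for A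
    using lipschitz_on_continuous_on[OF lip] continuous_on_subset by blast
  have growth: "w x + t \<le> w (\<phi> t)" if "0 \<le> t" "\<And>u. 0 \<le> u \<Longrightarrow> u < t \<Longrightarrow> green_germ (\<lambda>s. \<phi> (u + s))" "\<phi> t \<in> D" for t
    using w_growth[OF that(1) cont that(2,3)] \<phi> by simp
  have in_D: "f 0 \<in> D" if "green_germ f" for f using green_germ_mem[OF that] green_subset by blast
  from alt show thesis
  proof (elim disjE exE conjE)
    assume germ: "\<forall>t\<ge>0. green_germ (\<lambda>s. \<phi> (t + s))"
    show thesis
    proof (rule that[of \<infinity> \<phi>, OF _ \<phi> lip])
      fix t assume t: "t \<in> co_interval \<infinity>"
      show "green_germ (\<lambda>s. \<phi> (t + s))" using germ t by simp
      then show "w x + t \<le> w (\<phi> t)" using in_D[of "\<lambda>s. \<phi> (t + s)"] germ t by (intro growth) auto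
    qed auto
  next
    fix b assume "b > 0" and germ: "\<forall>t\<in>{0..<b}. green_germ (\<lambda>s. \<phi> (t + s))"
      and b: "\<phi> b \<in> closure (\<Union>Green) - \<Union>Green"
    have "\<phi> b \<notin> D"
    proof
      assume "\<phi> b \<in> D"
      then have "w x + b \<le> w (\<phi> b)" using germ \<open>b > 0\<close> by (intro growth) auto
      moreover have "0 \<le> w x" using \<open>x \<in> \<Union>Green\<close> green_subset by (intro w_nonneg) blast
      moreover have "w (\<phi> b) = 0" using b w_eq_0_iff[OF \<open>\<phi> b \<in> D\<close>] by simp
      ultimately show False using \<open>b > 0\<close> by simp
    qed
    \<comment> \<open>The end point lies in the closed set \<open>K\<close> as a limit of green
      points, so being outside \<open>D\<close> means being outside \<open>S\<close>.\<close>
    moreover have "closure (\<Union>Green) \<subseteq> K"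
      using green_subset D_eq closed_K by (intro closure_minimal) blast+
    ultimately have "\<phi> b \<notin> S" using b D_eq by blast
    show thesis
    proof (rule that[of "ereal b" \<phi>, OF _ \<phi> lip])
      fix t assume t: "t \<in> co_interval (ereal b)"
      show "green_germ (\<lambda>s. \<phi> (t + s))" using germ t by simp
      then show "w x + t \<le> w (\<phi> t)" using in_D[of "\<lambda>s. \<phi> (t + s)"] germ t by (intro growth) auto
    qed (use \<open>b > 0\<close> \<open>\<phi> b \<notin> S\<close> in auto)
  qed
qed

text \<open>The derivative is the limit of the right quotients, hence in the closed set
  \<open>G U (\<phi> t)\<close>; the points of the path just after \<open>t\<close> witness that it
  is tangent to \<open>closure U\<close>. Both together give the inclusion.\<close>

lemma closed_green_germ_derivative:
  assumes "closed_green_germ (\<lambda>s. \<phi> (t + s))" "(\<phi> has_vector_derivative v) (at t)"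
  shows "v \<in> F (\<phi> t) + cball 0 \<epsilon>"
proof -
  obtain U \<delta> where U: "U \<in> Green" "\<delta> > 0" "\<And>s. s \<in> {0..<\<delta>} \<Longrightarrow> \<phi> (t + s) \<in> closure U"
    and rq: "right_quot (\<lambda>s. \<phi> (t + s)) (G U (\<phi> t))"
    using assms(1) unfolding closed_green_germ_def by auto
  have mem: "\<phi> t \<in> closure U" using U(3)[of 0] U(2) by simp
  have lim: "((\<lambda>h. (\<phi> (t + h) - \<phi> t) /\<^sub>R h) \<longlongrightarrow> v) (at 0)"
  proof -
    have "((\<lambda>h. norm (\<phi> (t + h) - \<phi> t - h *\<^sub>R v) / norm h) \<longlongrightarrow> 0) (at 0)"
      using assms(2) by (simp add: has_vector_derivative_def has_derivative_at)
    then have "((\<lambda>h. norm ((\<phi> (t + h) - \<phi> t) /\<^sub>R h - v)) \<longlongrightarrow> 0) (at 0)"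
    proof (rule Lim_transform_eventually)
      have "\<forall>\<^sub>F h in at (0::real). h \<noteq> 0" by (simp add: eventually_at_filter)
      then show "\<forall>\<^sub>F h in at 0. norm (\<phi> (t + h) - \<phi> t - h *\<^sub>R v) / norm h = norm ((\<phi> (t + h) - \<phi> t) /\<^sub>R h - v)"
      proof eventually_elim
        case (elim h)
        then have "(\<phi> (t + h) - \<phi> t) /\<^sub>R h - v = (\<phi> (t + h) - \<phi> t - h *\<^sub>R v) /\<^sub>R h"
          by (simp add: scaleR_diff_right)
        then show ?case by (simp add: divide_inverse_commute)
      qed
    qed
    then have "((\<lambda>h. (\<phi> (t + h) - \<phi> t) /\<^sub>R h - v) \<longlongrightarrow> 0) (at 0)" by (rule tendsto_norm_zero_cancel)
    then show ?thesis by (rule LIM_zero_cancel)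
  qed
  have "v \<in> G U (\<phi> t)"
  proof -
    have "\<exists>y\<in>G U (\<phi> t). dist y v < e" if "e > 0" for e
    proof -
      have "\<forall>\<^sub>F h in at_right 0. \<exists>y\<in>G U (\<phi> t). norm ((\<phi> (t + h) - \<phi> t) /\<^sub>R h - y) < e / 2"
        using rq[unfolded right_quot_def, rule_format, of "e / 2"] \<open>e > 0\<close> unfolding add_0_right by linarith
      moreover have "\<forall>\<^sub>F h in at_right 0. dist ((\<phi> (t + h) - \<phi> t) /\<^sub>R h) v < e / 2"
        using tendsto_within_subset[OF lim] \<open>e > 0\<close> by (intro tendstoD) auto
      ultimately have "\<forall>\<^sub>F h in at_right (0::real). \<exists>y\<in>G U (\<phi> t). dist y v < e"
      proof eventually_elim
        case (elim h)
        then obtain y where y: "y \<in> G U (\<phi> t)" "dist ((\<phi> (t + h) - \<phi> t) /\<^sub>R h) y < e / 2" by (auto simp: dist_norm)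
        have "dist y v < e" by (rule dist_triangle_half_r[OF y(2) elim(2)])
        then show ?case using y(1) by blast
      qed
      then show ?thesis using eventually_happens'[OF trivial_limit_at_right_real] by fast
    qed
    then have "v \<in> closure (G U (\<phi> t))" by (simp add: closure_approachable)
    then show ?thesis using compact_imp_closed[OF compact_G[OF U(1) mem]] by simp
  qed
  moreover have "v \<in> bouligand_cone (closure U) (\<phi> t)"
  proof -
    \<comment> \<open>The shift by 2 makes already \<open>\<tau> 0\<close> strictly smaller than
      \<delta>, where membership in \<open>closure U\<close> is known.\<close>
    define \<tau> where "\<tau> n = \<delta> / real (n + 2)" for n
    have \<tau>_pos: "\<tau> n > 0" "\<tau> n < \<delta>" for n
      using U(2) by (simp_all add: \<tau>_def divide_less_eq)
    have "\<tau> \<longlonglongrightarrow> 0"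
      unfolding \<tau>_def using LIMSEQ_ignore_initial_segment[OF lim_const_over_n[of \<delta>], of 2] by simp
    have "decseq \<tau>"
      unfolding \<tau>_def decseq_def using U(2) by (auto intro!: divide_left_mono)
    have "filterlim \<tau> (at 0) sequentially"
      by (rule filterlim_atI[OF \<open>\<tau> \<longlonglongrightarrow> 0\<close>]) (use \<tau>_pos(1) in \<open>simp add: less_imp_neq[symmetric]\<close>)
    then have "(\<lambda>n. (\<phi> (t + \<tau> n) - \<phi> t) /\<^sub>R \<tau> n) \<longlonglongrightarrow> v"
      by (rule filterlim_compose[OF lim])
    moreover have "(\<lambda>n. \<phi> (t + \<tau> n)) \<longlonglongrightarrow> \<phi> t"
    proof -
      have "continuous (at t) \<phi>" using assms(2) has_vector_derivative_continuous by blast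
      moreover have "(\<lambda>n. t + \<tau> n) \<longlonglongrightarrow> t" using tendsto_add[OF tendsto_const \<open>\<tau> \<longlonglongrightarrow> 0\<close>, of t] by simp
      ultimately show ?thesis by (rule isCont_tendsto_compose)
    qed
    moreover have "\<phi> (t + \<tau> n) \<in> closure U" for n using U(3)[of "\<tau> n"] \<tau>_pos[of n] by simp
    ultimately show ?thesis
      unfolding bouligand_cone_def
      using \<tau>_pos(1) \<open>decseq \<tau>\<close> \<open>\<tau> \<longlonglongrightarrow> 0\<close>
      by (intro CollectI exI[of _ "\<lambda>n. \<phi> (t + \<tau> n)"] exI[of _ \<tau>] conjI allI)
  qed
  ultimately show ?thesis using tangent_G[OF U(1) mem] by blast
qed

text \<open>Two null sets are joined: \<open>N\<close>, where the germ condition may fail, and the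
  set where the Lipschitz path is not differentiable. \<open>N\<close> is empty for a green starting
  point and comes from the limit process otherwise.\<close>

lemma eps_solutionI:
  assumes "0 < b" "\<phi> 0 = x0" and lip: "L-lipschitz_on UNIV \<phi>"
    and D: "\<And>t. t \<in> co_interval b \<Longrightarrow> \<phi> t \<in> D" and N: "negligible N"
    and germ: "\<And>t. t \<in> co_interval b \<Longrightarrow> t \<notin> N \<Longrightarrow> closed_green_germ (\<lambda>s. \<phi> (t + s))"
  shows "eps_solution D F \<epsilon> x0 (co_interval b) \<phi>"
proof -
  obtain N' where N': "negligible N'" "\<And>t. t \<notin> N' \<Longrightarrow> \<exists>d. (\<phi> has_vector_derivative d) (at t)"
    using lipschitz_imp_has_vector_derivative_ae[OF lip] by blast
  have null: "N \<union> N' \<in> null_sets lebesgue"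
    using negligible_Un[OF N N'(1)] by (simp add: negligible_iff_null_sets)
  have "\<exists>v. (\<phi> has_vector_derivative v) (at t within co_interval b) \<and> v \<in> F (\<phi> t) + cball 0 \<epsilon>"
    if t: "t \<in> co_interval b" "t \<notin> N \<union> N'" for t
  proof -
    obtain d where d: "(\<phi> has_vector_derivative d) (at t)" using N'(2) t by blast
    then show ?thesis
      using closed_green_germ_derivative[OF germ d] t has_vector_derivative_at_within by blast
  qed
  then have "AE t in lebesgue. t \<in> co_interval b \<longrightarrow>
      (\<exists>v. (\<phi> has_vector_derivative v) (at t within co_interval b) \<and> v \<in> F (\<phi> t) + cball 0 \<epsilon>)"
    by (intro AE_I'[OF null]) blast
  moreover have "abs_cont_on s t \<phi>" for s t
    using lipschitz_on_subset[OF lip] by (intro lipschitz_imp_abs_cont_on) auto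
  ultimately show ?thesis
    unfolding eps_solution_def using assms(1,2) D by blast
qed

text \<open>Forward invariance is the persistence built into \<open>green_germ\<close>: by
  disjointness its set is the one green set through the current point.\<close>

lemma solution_from_green:
  assumes "x0 \<in> \<Union>Green"
  shows "\<exists>(T :: ereal) \<phi>. 0 < T \<and> eps_solution D F \<epsilon> x0 (co_interval T) \<phi> \<and>
      (T = \<infinity> \<or> (\<exists>r p. T = ereal r \<and> p \<notin> S \<and> (\<phi> \<longlongrightarrow> p) (at_left r))) \<and>
      (\<forall>t \<in> co_interval T. w (\<phi> t) \<ge> w x0 + t) \<and> (\<forall>U\<in>Green. forward_invariant U T \<phi>)"
proof -
  obtain \<phi> b where b: "(0::ereal) < b" "\<phi> 0 = x0" and lip: "(max_speed + 1)-lipschitz_on UNIV \<phi>"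
    and germ: "\<And>t. t \<in> co_interval b \<Longrightarrow> green_germ (\<lambda>s. \<phi> (t + s))"
    and growth: "\<And>t. t \<in> co_interval b \<Longrightarrow> w x0 + t \<le> w (\<phi> t)"
    and alt: "b = \<infinity> \<or> (\<exists>r. b = ereal r \<and> \<phi> r \<notin> S)"
    using green_solution[OF assms] by metis
  have mem: "\<phi> t \<in> \<Union>Green" if "t \<in> co_interval b" for t
    using green_germ_mem[OF germ[OF that]] by simp
  have "eps_solution D F \<epsilon> x0 (co_interval b) \<phi>"
    by (rule eps_solutionI[OF b lip, of "{}"])
      (use mem green_subset germ green_germ_imp_closed in blast)+
  moreover have "b = \<infinity> \<or> (\<exists>r p. b = ereal r \<and> p \<notin> S \<and> (\<phi> \<longlongrightarrow> p) (at_left r))"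
  proof -
    have "(\<phi> \<longlongrightarrow> \<phi> r) (at_left r)" for r
      using lipschitz_on_continuous_on[OF lip] by (auto simp: continuous_on_def intro: tendsto_within_subset)
    then show ?thesis using alt by blast
  qed
  moreover have "forward_invariant U b \<phi>" if U: "U \<in> Green" for U
    unfolding forward_invariant_def
  proof (intro ballI impI)
    fix t assume t: "t \<in> co_interval b" "\<phi> t \<in> U"
    obtain V \<delta> where V: "V \<in> Green" "\<delta> > 0" "\<And>s. s \<in> {0..<\<delta>} \<Longrightarrow> \<phi> (t + s) \<in> V"
      using germ[OF t(1)] unfolding green_germ_def by blast
    have "\<phi> t \<in> V" using V(3)[of 0] V(2) by simp
    then have "V = U" using disjoint_green[OF V(1) U] t(2) by blast
    obtain \<delta>' where \<delta>': "\<delta>' > 0" "{t..<t + \<delta>'} \<subseteq> co_interval b" using co_interval_right_nbhd[OF t(1)] .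
    show "\<exists>\<delta>>0. {t..<t + \<delta>} \<subseteq> co_interval b \<and> (\<forall>\<tau>\<in>{t..<t + \<delta>}. \<phi> \<tau> \<in> U)"
    proof (intro exI[of _ "min \<delta> \<delta>'"] conjI ballI)
      show "\<phi> \<tau> \<in> U" if "\<tau> \<in> {t..<t + min \<delta> \<delta>'}" for \<tau>
      proof -
        have "\<tau> - t < min \<delta> \<delta>'" "0 \<le> \<tau> - t" using that by auto
        then show ?thesis using V(3)[of "\<tau> - t"] \<open>V = U\<close> by simp
      qed
      show "{t..<t + min \<delta> \<delta>'} \<subseteq> co_interval b"
        by (rule subset_trans[OF _ \<delta>'(2)]) (auto simp: min_def split: if_splits)
    qed (use V(2) \<delta>' in auto)
  qed
  ultimately show ?thesis using b(1) growth by blast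
qed

section \<open>Solutions starting on the boundary\<close>

text \<open>A green set belongs to all partitions from some level on, so the largest of finitely
  many levels works. One common partition is what puts the finitely many sets in a single
  order.\<close>

lemma finite_green_common_level:
  assumes "finite \<F>" "\<F> \<subseteq> Green"
  shows "\<exists>m. \<F> \<subseteq> members (\<U> m)"
  using assms
proof (induction \<F> rule: finite_induct)
  case (insert U \<F>)
  have stable: "V \<in> members (\<U> k)" if "V \<in> Green" "V \<in> members (\<U> m)" "m \<le> k" for V m k
    using approx that by (simp add: invariant_partial_approx_def)
  obtain m where m: "\<F> \<subseteq> members (\<U> m)" using insert by auto
  have "Green \<subseteq> (\<Union>m. members (\<U> m))" using approx by (simp add: invariant_partial_approx_def)
  then obtain m' where m': "U \<in> members (\<U> m')" using insert.prems by blast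
  have "insert U \<F> \<subseteq> members (\<U> (max m m'))"
    using m m' insert.prems stable[of _ m "max m m'"] stable[of _ m' "max m m'"] by auto
  then show ?case by blast
qed simp

text \<open>Near \<open>\<phi> s\<close> semicontinuity puts all velocities of \<open>G U\<close> in
  one closed convex \<open>C\<close>; the approximating paths, being equi-Lipschitz, stay near
  \<open>\<phi> s\<close> for a time independent of \<open>k\<close>, so their chords, and with them
  those of \<phi>, have slopes in \<open>C\<close>.\<close>

lemma closed_green_germ_limit:
  assumes lip: "\<And>k. L-lipschitz_on UNIV (\<psi> k)" and lim: "\<And>t. (\<lambda>k. \<psi> k t) \<longlonglongrightarrow> \<phi> t"
    and U: "U \<in> Green" and "0 < \<eta>"
    and fr: "\<exists>\<^sub>F k in sequentially. \<forall>u\<in>{s..<s + \<eta>}. \<psi> k u \<in> U \<and> right_quot (\<lambda>h. \<psi> k (u + h)) (G U (\<psi> k u))"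
  shows "closed_green_germ (\<lambda>h. \<phi> (s + h))"
proof -
  have L: "0 \<le> L" using lip lipschitz_on_nonneg by blast
  have cl: "\<phi> (s + h) \<in> closure U" if "0 \<le> h" "h < \<eta>" for h
  proof (rule frequently_mem_closed_tendsto[OF closed_closure lim])
    show "\<exists>\<^sub>F k in sequentially. \<psi> k (s + h) \<in> closure U"
      using fr by (rule frequently_elim1) (use that closure_subset in force)
  qed
  have mem: "\<phi> s \<in> closure U" using cl[of 0] \<open>0 < \<eta>\<close> by simp
  have "right_quot (\<lambda>h. \<phi> (s + h)) (G U (\<phi> s))"
    unfolding right_quot_def
  proof (intro allI impI)
    fix e :: real assume "0 < e"
    obtain C \<rho> where C: "convex C" "closed C" "0 < \<rho>"
      "\<And>y. y \<in> closure U \<Longrightarrow> dist y (\<phi> s) < \<rho> \<Longrightarrow> G U y \<subseteq> C"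
      "\<And>z. z \<in> C \<Longrightarrow> \<exists>v\<in>G U (\<phi> s). norm (z - v) < e"
      using usc_on_convex_nbhd[OF usc_G[OF U] mem convex_G[OF U mem] compact_G[OF U mem] \<open>0 < e\<close>]
      by blast
    define d where "d = min \<eta> (\<rho> / (2 * (L + 1)))"
    have "L * d \<le> L * (\<rho> / (2 * (L + 1)))" using L by (intro mult_left_mono) (auto simp: d_def)
    also have "\<dots> \<le> \<rho> / 2" using L C(3) by (simp add: field_simps)
    finally have d: "L * d \<le> \<rho> / 2" "d > 0" "d \<le> \<eta>" using \<open>0 < \<eta>\<close> C(3) L by (auto simp: d_def)
    have in_C: "(\<phi> (s + h) - \<phi> s) /\<^sub>R h \<in> C" if h: "0 < h" "h < d" for h
    proof -
      have "\<forall>\<^sub>F k in sequentially. dist (\<psi> k s) (\<phi> s) < \<rho> / 2"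
        by (rule tendstoD[OF lim]) (use C(3) in simp)
      then have "\<exists>\<^sub>F k in sequentially. dist (\<psi> k s) (\<phi> s) < \<rho> / 2 \<and> (\<forall>u\<in>{s..<s + \<eta>}. \<psi> k u \<in> U \<and>
          right_quot (\<lambda>h. \<psi> k (u + h)) (G U (\<psi> k u)))"
        by (rule frequently_eventually_conj[OF fr])
      then have "\<exists>\<^sub>F k in sequentially. \<forall>u\<in>{s..<s + h}. right_quot (\<lambda>h. \<psi> k (u + h)) C"
      proof (rule frequently_elim1)
        fix k assume k: "dist (\<psi> k s) (\<phi> s) < \<rho> / 2 \<and> (\<forall>u\<in>{s..<s + \<eta>}. \<psi> k u \<in> U \<and>
          right_quot (\<lambda>h. \<psi> k (u + h)) (G U (\<psi> k u)))"
        show "\<forall>u\<in>{s..<s + h}. right_quot (\<lambda>h. \<psi> k (u + h)) C"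
        proof
          fix u assume u: "u \<in> {s..<s + h}"
          then have "L * dist u s \<le> L * d" using h L by (intro mult_left_mono) (auto simp: dist_real_def)
          then have "dist (\<psi> k u) (\<psi> k s) \<le> \<rho> / 2"
            using lipschitz_onD[OF lip, of u s k] d(1) by simp
          then have "dist (\<psi> k u) (\<phi> s) < \<rho>"
            using k dist_triangle[of "\<psi> k u" "\<phi> s" "\<psi> k s"] by simp
          moreover have "u \<in> {s..<s + \<eta>}" using u h d by simp
          ultimately show "right_quot (\<lambda>h. \<psi> k (u + h)) C"
            using C(4)[of "\<psi> k u"] closure_subset k right_quot_mono by blast
        qed
      qed
      then have "(\<phi> (s + h) - \<phi> s) /\<^sub>R ((s + h) - s) \<in> C"
        using lim lipschitz_on_continuous_on[OF lip] h(1) C(1,2)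
        by (intro right_quot_mean_value_limit[where \<psi> = \<psi>]) auto
      then show ?thesis by simp
    qed
    have "\<forall>\<^sub>F h in at_right 0. h \<in> {0<..<d}" by (rule eventually_at_right_real) (rule d)
    then show "\<forall>\<^sub>F h in at_right 0. \<exists>v\<in>G U (\<phi> s). norm ((\<phi> (s + h) - \<phi> (s + 0)) /\<^sub>R h - v) < e"
      by eventually_elim (use in_C C(5) in simp)
  qed
  then show ?thesis
    unfolding closed_green_germ_def add_0_right using U cl \<open>0 < \<eta>\<close>
    by (intro bexI[of _ U] conjI exI[of _ \<eta>]) auto
qed

lemma green_germ_in_member:
  assumes "green_germ f" "f 0 \<in> U" "U \<in> Green"
  obtains \<delta> where "0 < \<delta>" "\<And>s. 0 \<le> s \<Longrightarrow> s < \<delta> \<Longrightarrow> f s \<in> U" "right_quot f (G U (f 0))"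
proof -
  obtain V \<delta> where V: "V \<in> Green" "\<delta> > 0" "\<forall>s\<in>{0..<\<delta>}. f s \<in> V" "right_quot f (G V (f 0))"
    using assms(1) unfolding green_germ_def by blast
  have "f 0 \<in> V" using V by simp
  then have "V = U" using disjoint_green[OF V(1) assms(3)] assms(2) by blast
  then show thesis using that[OF V(2)] V(3,4) by simp
qed

text \<open>Local finiteness is available around the green point \<open>\<phi> t0\<close>, and
  equi-Lipschitz paths remain in that neighbourhood for a time independent of \<open>k\<close>. The
  finite index set \<open>A\<close> is therefore common to all large \<open>k\<close>, as the
  selection argument requires.\<close>

lemma green_limit_germ_ae:
  assumes lip: "\<And>k. L-lipschitz_on UNIV (\<psi> k)" and lim: "\<And>t. (\<lambda>k. \<psi> k t) \<longlonglongrightarrow> \<phi> t"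
    and "\<phi> t0 \<in> \<Union>Green" and "0 < \<delta>0"
    and germ: "\<forall>\<^sub>F k in sequentially. \<forall>u\<in>{t0 - \<delta>0<..<t0 + \<delta>0}. green_germ (\<lambda>s. \<psi> k (u + s))"
  obtains \<delta> N where "0 < \<delta>" "negligible N"
    "\<And>s. s \<in> {t0 - \<delta><..<t0 + \<delta>} \<Longrightarrow> s \<notin> N \<Longrightarrow> closed_green_germ (\<lambda>h. \<phi> (s + h))"
proof -
  have L: "0 \<le> L" using lip lipschitz_on_nonneg by blast
  have "\<forall>x\<in>\<Union>Green. \<exists>N. open N \<and> x \<in> N \<and> finite {U\<in>Green. U \<inter> N \<noteq> {}}"
    using approx by (simp add: invariant_partial_approx_def)
  then obtain N0 where N0: "open N0" "\<phi> t0 \<in> N0" "finite {U\<in>Green. U \<inter> N0 \<noteq> {}}"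
    using \<open>\<phi> t0 \<in> \<Union>Green\<close> by blast
  define \<F> where "\<F> = {U\<in>Green. U \<inter> N0 \<noteq> {}}"
  obtain \<rho> where \<rho>: "\<rho> > 0" "ball (\<phi> t0) \<rho> \<subseteq> N0" using N0 by (meson openE)
  obtain m where "\<F> \<subseteq> members (\<U> m)"
    using finite_green_common_level[of \<F>] N0(3) by (auto simp: \<F>_def)
  obtain \<alpha>0 V where \<U>m: "\<U> m = (\<alpha>0, V)" by fastforce
  have \<F>_V: "\<exists>\<alpha><\<alpha>0. U = V \<alpha>" if "U \<in> \<F>" for U
    using \<open>\<F> \<subseteq> members (\<U> m)\<close> that \<U>m by (auto simp: members_def)
  have P: "relatively_open_partition (top_of_set D) (\<alpha>0, V)" using partition[of m] \<U>m by simp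
  define idx where "idx y = (THE \<alpha>. \<alpha> < \<alpha>0 \<and> y \<in> V \<alpha>)" for y
  have idx: "idx y = \<alpha>" if "\<alpha> < \<alpha>0" "y \<in> V \<alpha>" for y \<alpha>
    unfolding idx_def
    by (rule the_equality) (use that relatively_open_partition_disjoint[OF P] in auto)
  define A where "A = {\<alpha>. \<alpha> < \<alpha>0 \<and> V \<alpha> \<in> \<F>}"
  have "finite A"
  proof (rule finite_imageD)
    show "finite (V ` A)" by (rule finite_subset[of _ \<F>]) (use N0(3) in \<open>auto simp: A_def \<F>_def\<close>)
    \<comment> \<open>Empty members may be repeated, but a member in \<open>\<F>\<close> meets
      \<open>N0\<close>, so it has a point and disjointness of the partition determines its
      index.\<close>
    show "inj_on V A"
    proof (rule inj_onI)
      fix \<alpha> \<beta> assume ab: "\<alpha> \<in> A" "\<beta> \<in> A" "V \<alpha> = V \<beta>"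
      then have "V \<alpha> \<noteq> {}" "\<alpha> < \<alpha>0" "\<beta> < \<alpha>0" by (auto simp: A_def \<F>_def)
      then obtain y where y: "y \<in> V \<alpha>" by blast
      moreover have "y \<in> V \<beta>" using y ab(3) by simp
      ultimately show "\<alpha> = \<beta>"
        using relatively_open_partition_disjoint[OF P \<open>\<alpha> < \<alpha>0\<close> \<open>\<beta> < \<alpha>0\<close>] by blast
    qed
  qed
  define \<delta> where "\<delta> = min \<delta>0 (\<rho> / (2 * (L + 1)))"
  have "L * \<delta> \<le> L * (\<rho> / (2 * (L + 1)))" using L by (intro mult_left_mono) (auto simp: \<delta>_def)
  also have "\<dots> \<le> \<rho> / 2" using L \<rho>(1) by (simp add: field_simps)
  finally have \<delta>: "L * \<delta> \<le> \<rho> / 2" "\<delta> > 0" "\<delta> \<le> \<delta>0" using \<open>0 < \<delta>0\<close> \<rho>(1) L by (auto simp: \<delta>_def)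
  let ?I = "{t0 - \<delta><..<t0 + \<delta>}"
  have "\<forall>\<^sub>F k in sequentially. dist (\<psi> k t0) (\<phi> t0) < \<rho> / 2"
    by (rule tendstoD[OF lim]) (use \<rho> in simp)
  with germ have good: "\<forall>\<^sub>F k in sequentially. \<forall>u\<in>?I. green_germ (\<lambda>s. \<psi> k (u + s)) \<and>
      (\<exists>\<alpha>\<in>A. \<psi> k u \<in> V \<alpha>)"
  proof eventually_elim
    case (elim k)
    show ?case
    proof
      fix u assume u: "u \<in> ?I"
      then have g: "green_germ (\<lambda>s. \<psi> k (u + s))" using elim(1) \<delta>(3) by simp
      then obtain U where U: "U \<in> Green" "\<psi> k u \<in> U" using green_germ_mem[OF g] by auto
      have "L * dist u t0 \<le> L * \<delta>" using u L by (intro mult_left_mono) (auto simp: dist_real_def)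
      then have "dist (\<psi> k u) (\<psi> k t0) \<le> \<rho> / 2"
        using lipschitz_onD[OF lip, of u t0 k] \<delta>(1) by simp
      then have "dist (\<psi> k u) (\<phi> t0) < \<rho>"
        using elim(2) dist_triangle[of "\<psi> k u" "\<phi> t0" "\<psi> k t0"] by simp
      then have "\<psi> k u \<in> N0" using \<rho>(2) by (auto simp: dist_commute)
      then have "U \<in> \<F>" using U by (auto simp: \<F>_def)
      then obtain \<alpha> where "\<alpha> < \<alpha>0" "U = V \<alpha>" using \<F>_V by blast
      then have "\<alpha> \<in> A" "\<psi> k u \<in> V \<alpha>" using \<open>U \<in> \<F>\<close> U(2) by (auto simp: A_def)
      then show "green_germ (\<lambda>s. \<psi> k (u + s)) \<and> (\<exists>\<alpha>\<in>A. \<psi> k u \<in> V \<alpha>)" using g by blast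
    qed
  qed
  have A: "\<alpha> < \<alpha>0" "V \<alpha> \<in> Green" if "\<alpha> \<in> A" for \<alpha> using that by (auto simp: A_def \<F>_def)
  have "\<forall>\<^sub>F k in sequentially. (\<lambda>u. idx (\<psi> k u)) ` ?I \<subseteq> A \<and> mono_on ?I (\<lambda>u. idx (\<psi> k u))"
    using good
  proof eventually_elim
    case (elim k)
    have "idx (\<psi> k u) \<in> A" if "u \<in> ?I" for u
    proof -
      obtain \<alpha> where "\<alpha> \<in> A" "\<psi> k u \<in> V \<alpha>" using elim \<open>u \<in> ?I\<close> by blast
      then show ?thesis using idx[of \<alpha> "\<psi> k u"] A(1)[of \<alpha>] by simp
    qed
    moreover have "idx (\<psi> k u) \<le> idx (\<psi> k v)" if uv: "u \<in> ?I" "v \<in> ?I" "u \<le> v" for u v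
    proof -
      obtain \<alpha> \<beta> where \<alpha>: "\<alpha> \<in> A" "\<psi> k u \<in> V \<alpha>" and \<beta>: "\<beta> \<in> A" "\<psi> k v \<in> V \<beta>" using elim uv by blast
      have "\<alpha> \<le> \<beta>"
      proof (rule relatively_open_partition_index_mono[OF P _ _ \<open>u \<le> v\<close> _ A(1)[OF \<alpha>(1)] \<alpha>(2) \<beta>(2)])
        show "continuous_on {u..v} (\<psi> k)"
          using lipschitz_on_continuous_on[OF lip] continuous_on_subset by blast
        show "\<psi> k ` {u..v} \<subseteq> D"
        proof (rule image_subsetI)
          fix s assume "s \<in> {u..v}"
          then have "s \<in> ?I" using uv by simp
          then show "\<psi> k s \<in> D" using elim A(2) green_subset by blast
        qed
        fix s assume s: "u \<le> s" "s < v"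
        then have "s \<in> ?I" using uv by simp
        then obtain \<gamma> where \<gamma>: "\<gamma> \<in> A" "\<psi> k s \<in> V \<gamma>" and g: "green_germ (\<lambda>h. \<psi> k (s + h))" using elim by blast
        obtain d where d: "0 < d" "\<And>h. 0 \<le> h \<Longrightarrow> h < d \<Longrightarrow> \<psi> k (s + h) \<in> V \<gamma>"
          using green_germ_in_member[OF g _ A(2)[OF \<gamma>(1)]] \<gamma>(2) unfolding add_0_right by metis
        have "\<forall>h\<in>{s..<s + d}. \<psi> k h \<in> V \<gamma>"
        proof
          fix h assume "h \<in> {s..<s + d}"
          then show "\<psi> k h \<in> V \<gamma>" using d(2)[of "h - s"] by simp
        qed
        then show "\<exists>\<alpha><\<alpha>0. \<exists>\<delta>>0. \<forall>h\<in>{s..<s + \<delta>}. \<psi> k h \<in> V \<alpha>" using A(1)[OF \<gamma>(1)] d(1) by blast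
      qed
      then show ?thesis using idx[OF A(1)[OF \<alpha>(1)] \<alpha>(2)] idx[OF A(1)[OF \<beta>(1)] \<beta>(2)] by simp
    qed
    ultimately show ?case by (auto intro: mono_onI)
  qed
  from frequently_locally_constant_ae[OF \<open>finite A\<close> this]
  obtain N where N: "negligible N" "\<And>s. s \<in> ?I - N \<Longrightarrow> \<exists>\<alpha>\<in>A. \<exists>\<eta>>0. {s - \<eta><..<s + \<eta>} \<subseteq> ?I \<and>
      (\<exists>\<^sub>F k in sequentially. \<forall>u\<in>{s - \<eta><..<s + \<eta>}. idx (\<psi> k u) = \<alpha>)"
    by blast
  show thesis
  proof (rule that[OF \<delta>(2) N(1)])
    fix s assume "s \<in> ?I" "s \<notin> N"
    then obtain \<alpha> \<eta> where \<alpha>: "\<alpha> \<in> A" "\<eta> > 0" "{s - \<eta><..<s + \<eta>} \<subseteq> ?I"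
      and fr: "\<exists>\<^sub>F k in sequentially. \<forall>u\<in>{s - \<eta><..<s + \<eta>}. idx (\<psi> k u) = \<alpha>"
      using N(2)[of s] by blast
    show "closed_green_germ (\<lambda>h. \<phi> (s + h))"
    proof (rule closed_green_germ_limit[OF lip lim A(2)[OF \<alpha>(1)] \<alpha>(2)])
      show "\<exists>\<^sub>F k in sequentially. \<forall>u\<in>{s..<s + \<eta>}. \<psi> k u \<in> V \<alpha> \<and>
          right_quot (\<lambda>h. \<psi> k (u + h)) (G (V \<alpha>) (\<psi> k u))"
        using frequently_eventually_conj[OF fr good]
      proof (rule frequently_elim1, intro ballI)
        fix k u
        assume k: "(\<forall>u\<in>?I. green_germ (\<lambda>s. \<psi> k (u + s)) \<and> (\<exists>\<alpha>\<in>A. \<psi> k u \<in> V \<alpha>)) \<and>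
            (\<forall>u\<in>{s - \<eta><..<s + \<eta>}. idx (\<psi> k u) = \<alpha>)" and u: "u \<in> {s..<s + \<eta>}"
        then have u': "u \<in> {s - \<eta><..<s + \<eta>}" using \<alpha>(2) by simp
        then have "u \<in> ?I" using \<alpha>(3) by blast
        then obtain \<beta> where \<beta>: "\<beta> \<in> A" "\<psi> k u \<in> V \<beta>" and g: "green_germ (\<lambda>s. \<psi> k (u + s))" using k by blast
        have "\<beta> = \<alpha>" using idx[OF A(1)[OF \<beta>(1)] \<beta>(2)] k u' by simp
        then show "\<psi> k u \<in> V \<alpha> \<and> right_quot (\<lambda>h. \<psi> k (u + h)) (G (V \<alpha>) (\<psi> k u))"
          using green_germ_in_member[OF g _ A(2)[OF \<alpha>(1)]] \<beta>(2) unfolding add_0_right by metis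
      qed
    qed
  qed
qed

lemma solution_from_boundary:
  assumes x0: "x0 \<in> closure (\<Union>Green)" "x0 \<in> D" "x0 \<notin> \<Union>Green"
  shows "\<exists>(T :: ereal) \<phi>. 0 < T \<and> eps_solution D F \<epsilon> x0 (co_interval T) \<phi> \<and>
      (T = \<infinity> \<or> (\<exists>r p. T = ereal r \<and> p \<notin> S \<and> (\<phi> \<longlongrightarrow> p) (at_left r))) \<and>
      (\<forall>t \<in> co_interval T. w (\<phi> t) \<ge> w x0 + t)"
proof -
  let ?L = "max_speed + 1"
  obtain X where X: "\<And>n. X n \<in> \<Union>Green" "X \<longlonglongrightarrow> x0"
    using x0(1) unfolding closure_sequential by blast
  have "\<exists>\<psi> b. (0::ereal) < b \<and> \<psi> 0 = X n \<and> ?L-lipschitz_on UNIV \<psi> \<and>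
    (\<forall>t\<in>co_interval b. green_germ (\<lambda>s. \<psi> (t + s)) \<and> w (X n) + t \<le> w (\<psi> t)) \<and>
    (b = \<infinity> \<or> (\<exists>r. b = ereal r \<and> \<psi> r \<notin> S))" (is "\<exists>\<psi> b. ?P n \<psi> b") for n
    by (rule green_solution[OF X(1)[of n]]) blast
  then have "\<forall>n. \<exists>b. \<exists>\<psi>. ?P n \<psi> b" by blast
  from choice[OF this] obtain b where "\<forall>n. \<exists>\<psi>. ?P n \<psi> (b n)" by (elim exE)
  from choice[OF this] have "\<exists>\<psi> b. \<forall>n. ?P n (\<psi> n) (b n)" by blast
  then obtain \<psi> b where b: "\<And>n. (0::ereal) < b n" and \<psi>0: "\<And>n. \<psi> n 0 = X n"
    and lip: "\<And>n. ?L-lipschitz_on UNIV (\<psi> n)"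
    and \<psi>: "\<And>n t. t \<in> co_interval (b n) \<Longrightarrow> green_germ (\<lambda>s. \<psi> n (t + s)) \<and> w (X n) + t \<le> w (\<psi> n t)"
    and exit: "\<And>n. b n = \<infinity> \<or> (\<exists>r. b n = ereal r \<and> \<psi> n r \<notin> S)"
    by blast
  obtain M where "\<And>n. norm (X n) \<le> M"
    using convergent_imp_bounded[OF X(2)] by (auto simp: bounded_iff)
  then obtain q \<phi> where q: "strict_mono q" and lip_\<phi>: "?L-lipschitz_on UNIV \<phi>"
    and lim: "\<And>t. (\<lambda>k. \<psi> (q k) t) \<longlonglongrightarrow> \<phi> t"
    using lipschitz_convergent_subsequence[where \<psi> = \<psi> and L = ?L and M = M, OF lip] \<psi>0 by auto
  have cont: "continuous_on UNIV \<phi>" by (rule lipschitz_on_continuous_on[OF lip_\<phi>])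
  have "(\<lambda>k. X (q k)) \<longlonglongrightarrow> x0" using LIMSEQ_subseq_LIMSEQ[OF X(2) q] by (simp add: o_def)
  then have "\<phi> 0 = x0" using lim[of 0] LIMSEQ_unique by (simp add: \<psi>0)
  obtain T where T: "(0::ereal) < T" "\<And>t. t \<in> co_interval T \<Longrightarrow> \<phi> t \<in> S"
    "T = \<infinity> \<or> (\<exists>r. T = ereal r \<and> \<phi> r \<notin> S)"
    using exit_time[OF cont open_S] \<open>\<phi> 0 = x0\<close> x0(2) D_eq by blast
  \<comment> \<open>A path that ends at a finite time is outside \<open>S\<close> there. For large
    \<open>k\<close> the paths are in \<open>S\<close> throughout \<open>{0..t}\<close>, so none of
    these can have ended by time \<open>t\<close>.\<close>
  have long: "\<forall>\<^sub>F k in sequentially. t \<in> co_interval (b (q k))" if t: "t \<in> co_interval T" for t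
  proof -
    have "0 \<le> t" "ereal t < T" using t by (auto simp: co_interval_def)
    have "u \<in> co_interval T" if "0 \<le> u" "u \<le> t" for u
      using that t le_less_trans[of "ereal u" "ereal t" T] by (simp add: co_interval_def)
    then have "\<forall>\<^sub>F k in sequentially. \<forall>u\<in>{0..t}. \<psi> (q k) u \<in> S"
      using T(2) by (intro lipschitz_limit_eventually_in_open[OF lip lim open_S \<open>0 \<le> t\<close>]) auto
    then show ?thesis
    proof eventually_elim
      case (elim k)
      show ?case
      proof (cases "b (q k) = \<infinity>")
        case True
        then show ?thesis using \<open>0 \<le> t\<close> by simp
      next
        case False
        then obtain r where r: "b (q k) = ereal r" "\<psi> (q k) r \<notin> S" using exit by blast
        then have "0 \<le> r" using b[of "q k"] by simp
        then have "t < r" using elim r(2) by force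
        then show ?thesis using r(1) \<open>0 \<le> t\<close> by simp
      qed
    qed
  qed
  \<comment> \<open>Since \<open>w (X n)\<close> is nonnegative, the approximating paths satisfy
    \<open>t \<le> w\<close>, and continuity of \<open>w\<close> on \<open>D\<close> keeps this in
    the limit. As \<open>w x0\<close> is 0, this is already the required bound.\<close>
  have growth: "\<phi> t \<in> D \<and> t \<le> w (\<phi> t)" if t: "t \<in> co_interval T" for t
  proof -
    have mem: "\<forall>\<^sub>F k in sequentially. \<psi> (q k) t \<in> \<Union>Green \<and> t \<le> w (\<psi> (q k) t)"
      using long[OF t]
    proof eventually_elim
      case (elim k)
      have "0 \<le> w (X (q k))" using X(1) green_subset by (intro w_nonneg) blast
      then show ?case using \<psi>[OF elim] green_germ_mem by fastforce
    qed
    then have "\<forall>\<^sub>F k in sequentially. \<psi> (q k) t \<in> K"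
      by eventually_elim (use green_subset D_eq in blast)
    then have "\<phi> t \<in> K" by (rule Lim_in_closed_set[OF closed_K _ sequentially_bot lim])
    then have "\<phi> t \<in> D" using T(2)[OF t] D_eq by simp
    have "\<forall>\<^sub>F k in sequentially. \<psi> (q k) t \<in> D"
      using mem by eventually_elim (use green_subset in blast)
    then have "(\<lambda>k. w (\<psi> (q k) t)) \<longlonglongrightarrow> w (\<phi> t)"
      by (rule continuous_on_tendsto_compose[OF w_continuous lim \<open>\<phi> t \<in> D\<close>])
    then have "t \<le> w (\<phi> t)"
      by (rule tendsto_lowerbound) (use mem in \<open>auto elim: eventually_mono\<close>)
    then show ?thesis using \<open>\<phi> t \<in> D\<close> by simp
  qed
  have "w x0 = 0" using w_eq_0_iff[OF x0(2)] x0(3) by simp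
  \<comment> \<open>Time 0 is left out because \<open>x0\<close> is not green; it rejoins as a
    single point in \<open>neg\<close>.\<close>
  define B where "B = {t. 0 < t \<and> ereal t < T \<and> \<not> closed_green_germ (\<lambda>h. \<phi> (t + h))}"
  have "negligible B"
    unfolding locally_negligible_alt[of B]
  proof
    fix t0 assume "t0 \<in> B"
    then have t0: "0 < t0" "t0 \<in> co_interval T" by (auto simp: B_def co_interval_def)
    have "\<phi> t0 \<in> \<Union>Green" using growth[OF t0(2)] t0(1) w_eq_0_iff[of "\<phi> t0"] by auto
    obtain d where d: "0 < d" "{t0..<t0 + d} \<subseteq> co_interval T" using co_interval_right_nbhd[OF t0(2)] .
    \<comment> \<open>The bound \<open>t0\<close> keeps the window within nonnegative times, and
      \<open>d / 2\<close> keeps its right end inside the half-open interval, so that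
      \<open>long\<close> applies there and covers the whole window.\<close>
    define \<delta>0 where "\<delta>0 = min t0 (d / 2)"
    have "\<delta>0 > 0" "t0 - \<delta>0 \<ge> 0" "t0 + \<delta>0 \<in> {t0..<t0 + d}"
      using d(1) t0(1) by (auto simp: \<delta>0_def)
    then have "t0 + \<delta>0 \<in> co_interval T" using d(2) by blast
    have "\<forall>\<^sub>F k in sequentially. \<forall>u\<in>{t0 - \<delta>0<..<t0 + \<delta>0}. green_germ (\<lambda>s. \<psi> (q k) (u + s))"
      using long[OF \<open>t0 + \<delta>0 \<in> co_interval T\<close>]
    proof eventually_elim
      case (elim k)
      show ?case
      proof
        fix u assume u: "u \<in> {t0 - \<delta>0<..<t0 + \<delta>0}"
        have "u \<in> co_interval (b (q k))"
          using elim u \<open>t0 - \<delta>0 \<ge> 0\<close> less_trans[of "ereal u" "ereal (t0 + \<delta>0)"] by (simp add: co_interval_def)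
        then show "green_germ (\<lambda>s. \<psi> (q k) (u + s))" using \<psi> by blast
      qed
    qed
    from green_limit_germ_ae[OF lip lim \<open>\<phi> t0 \<in> \<Union>Green\<close> \<open>\<delta>0 > 0\<close> this]
    obtain \<delta> N where N: "0 < \<delta>" "negligible N"
      "\<And>s. s \<in> {t0 - \<delta><..<t0 + \<delta>} \<Longrightarrow> s \<notin> N \<Longrightarrow> closed_green_germ (\<lambda>h. \<phi> (s + h))" by blast
    show "\<exists>U. openin (top_of_set B) U \<and> t0 \<in> U \<and> negligible U"
    proof (intro exI conjI)
      show "openin (top_of_set B) (B \<inter> {t0 - \<delta><..<t0 + \<delta>})" by (simp add: openin_open_Int)
      show "t0 \<in> B \<inter> {t0 - \<delta><..<t0 + \<delta>}" using \<open>t0 \<in> B\<close> N(1) by simp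
      show "negligible (B \<inter> {t0 - \<delta><..<t0 + \<delta>})"
        by (rule negligible_subset[OF N(2)]) (use N(3) in \<open>unfold B_def, blast\<close>)
    qed
  qed
  then have neg: "negligible (insert 0 B)" by simp
  have "eps_solution D F \<epsilon> x0 (co_interval T) \<phi>"
  proof (rule eps_solutionI[OF T(1) \<open>\<phi> 0 = x0\<close> lip_\<phi> _ neg])
    show "\<phi> t \<in> D" if "t \<in> co_interval T" for t using growth[OF that] by simp
    show "closed_green_germ (\<lambda>s. \<phi> (t + s))" if "t \<in> co_interval T" "t \<notin> insert 0 B" for t
      using that by (auto simp: B_def co_interval_def)
  qed
  moreover have "T = \<infinity> \<or> (\<exists>r p. T = ereal r \<and> p \<notin> S \<and> (\<phi> \<longlongrightarrow> p) (at_left r))"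
  proof -
    have "(\<phi> \<longlongrightarrow> \<phi> r) (at_left r)" for r
      using cont by (auto simp: continuous_on_def intro: tendsto_within_subset)
    then show ?thesis using T(3) by blast
  qed
  moreover have "\<forall>t \<in> co_interval T. w (\<phi> t) \<ge> w x0 + t"
    using growth \<open>w x0 = 0\<close> by simp
  ultimately show ?thesis using T(1) by blast
qed

end

theorem proposition3p2:
  fixes D S K :: "(real ^ 'n) set"
    and F :: "real ^ 'n \<Rightarrow> (real ^ 'n) set"
    and \<epsilon> :: real
    and \<U> :: "nat \<Rightarrow> ('i::wellorder, real ^ 'n) wo_family"
    and Green :: "(real ^ 'n) set set"
    and G :: "(real ^ 'n) set \<Rightarrow> real ^ 'n \<Rightarrow> (real ^ 'n) set"
    and w :: "real ^ 'n \<Rightarrow> real"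
  assumes "open S" and "closed K" and "D = S \<inter> K"
    and "\<forall>x\<in>closure D. F x \<noteq> {}"
    and "uniformly_bounded_on (closure D) F"
    and "0 < \<epsilon>"
    and "sigma_relatively_open_partition D \<U>"
    and "invariant_partial_approx D F \<epsilon> \<U> Green G"
    and "quasi_lyapunov D Green G w"
  shows "\<forall>x0 \<in> closure (\<Union>Green) \<inter> D.
    \<exists>(T :: ereal) \<phi>. 0 < T \<and>
      eps_solution D F \<epsilon> x0 (co_interval T) \<phi> \<and>
      (T = \<infinity> \<or> (\<exists>r p. T = ereal r \<and> p \<notin> S \<and> (\<phi> \<longlongrightarrow> p) (at_left r))) \<and>
      (\<forall>t \<in> co_interval T. w (\<phi> t) \<ge> w x0 + t) \<and>
      (x0 \<in> \<Union>Green \<longrightarrow> (\<forall>U\<in>Green. forward_invariant U T \<phi>))"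
proof
  have system: "quasi_lyapunov_system D S K F \<epsilon> \<U> Green G w"
    by unfold_locales fact+
  fix x0 assume x0: "x0 \<in> closure (\<Union>Green) \<inter> D"
  show "\<exists>(T :: ereal) \<phi>. 0 < T \<and>
      eps_solution D F \<epsilon> x0 (co_interval T) \<phi> \<and>
      (T = \<infinity> \<or> (\<exists>r p. T = ereal r \<and> p \<notin> S \<and> (\<phi> \<longlongrightarrow> p) (at_left r))) \<and>
      (\<forall>t \<in> co_interval T. w (\<phi> t) \<ge> w x0 + t) \<and>
      (x0 \<in> \<Union>Green \<longrightarrow> (\<forall>U\<in>Green. forward_invariant U T \<phi>))"
  proof (cases "x0 \<in> \<Union>Green")
    case True
    then show ?thesis
      using quasi_lyapunov_system.solution_from_green[OF system] by blast
  next
    case False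
    then show ?thesis
      using quasi_lyapunov_system.solution_from_boundary[OF system, of x0] x0 by blast
  qed
qed

end
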